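(* Let $p$ be a prime and let $R$ be a NIP $\mathbb{F}_p$-algebra which is an integral domain. Then $R$ is a Henselian local domain.
   Context: All rings are commutative and unital. A ring is NIP if its complete theory in the language of rings is NIP. *)

theory Defs
  imports "HOL-Algebra.UnivPoly" "HOL-Algebra.IntRing"
begin

section \<open>First-order logic in the language of rings\<close>

datatype rterm =
    TVar nat
  | TZero
  | TOne
  | TAdd rterm rterm
  | TNeg rterm
  | TMul rterm rterm

datatype rform =
    FEq rterm rterm
  | FNot rform
  | FAnd rform rform
  | FEx nat rform

primrec term_vars :: "rterm \<Rightarrow> nat set" where
  "term_vars (TVar x) = {x}"
| "term_vars TZero = {}"
| "term_vars TOne = {}"
| "term_vars (TAdd s t) = term_vars s \<union> term_vars t"
| "term_vars (TNeg t) = term_vars t"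
| "term_vars (TMul s t) = term_vars s \<union> term_vars t"

primrec free_vars :: "rform \<Rightarrow> nat set" where
  "free_vars (FEq s t) = term_vars s \<union> term_vars t"
| "free_vars (FNot \<phi>) = free_vars \<phi>"
| "free_vars (FAnd \<phi> \<psi>) = free_vars \<phi> \<union> free_vars \<psi>"
| "free_vars (FEx x \<phi>) = free_vars \<phi> - {x}"

primrec term_val :: "('a, 'b) ring_scheme \<Rightarrow> (nat \<Rightarrow> 'a) \<Rightarrow> rterm \<Rightarrow> 'a" where
  "term_val R e (TVar x) = e x"
| "term_val R e TZero = \<zero>\<^bsub>R\<^esub>"
| "term_val R e TOne = \<one>\<^bsub>R\<^esub>"
| "term_val R e (TAdd s t) = term_val R e s \<oplus>\<^bsub>R\<^esub> term_val R e t"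
| "term_val R e (TNeg t) = \<ominus>\<^bsub>R\<^esub> term_val R e t"
| "term_val R e (TMul s t) = term_val R e s \<otimes>\<^bsub>R\<^esub> term_val R e t"

primrec sat :: "('a, 'b) ring_scheme \<Rightarrow> (nat \<Rightarrow> 'a) \<Rightarrow> rform \<Rightarrow> bool" where
  "sat R e (FEq s t) \<longleftrightarrow> term_val R e s = term_val R e t"
| "sat R e (FNot \<phi>) \<longleftrightarrow> \<not> sat R e \<phi>"
| "sat R e (FAnd \<phi> \<psi>) \<longleftrightarrow> sat R e \<phi> \<and> sat R e \<psi>"
| "sat R e (FEx x \<phi>) \<longleftrightarrow> (\<exists>a \<in> carrier R. sat R (e(x := a)) \<phi>)"

definition complete_theory :: "('a, 'b) ring_scheme \<Rightarrow> rform set" where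
  "complete_theory R =
     {\<sigma>. free_vars \<sigma> = {} \<and> (\<forall>e. range e \<subseteq> carrier R \<longrightarrow> sat R e \<sigma>)}"

definition FTrue :: rform where
  "FTrue = FEq TZero TZero"

definition FConj :: "rform list \<Rightarrow> rform" where
  "FConj \<phi>s = foldr FAnd \<phi>s FTrue"

definition FExs :: "nat list \<Rightarrow> rform \<Rightarrow> rform" where
  "FExs xs \<phi> = foldr FEx xs \<phi>"

section \<open>The independence property\<close>

text \<open>
  A partitioned formula \<open>\<phi>(x;y)\<close> with \<open>|x| = k\<close> and \<open>|y| = m\<close> is a formula with free variables
  among \<open>0, \<dots>, k+m-1\<close>, the first \<open>k\<close> of which form the tuple \<open>x\<close> and the others the tuple \<open>y\<close>.

  \<open>instance_at k m i \<phi>\<close> is \<open>\<phi>(x_i; y)\<close>, where the tuple \<open>x_i\<close> consists of the \<open>k\<close> variables from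
  \<open>k + m + i * k\<close> on. Instead of substituting, the variables \<open>0, \<dots>, k-1\<close> are quantified and
  equated with those of \<open>x_i\<close>, so capture of variables is not an issue.
\<close>

definition instance_at :: "nat \<Rightarrow> nat \<Rightarrow> nat \<Rightarrow> rform \<Rightarrow> rform" where
  "instance_at k m i \<phi> =
     FExs [0..<k]
       (FAnd (FConj (map (\<lambda>j. FEq (TVar j) (TVar (k + m + i * k + j))) [0..<k])) \<phi>)"

text \<open>
  The sentence \<open>\<exists>x_0 \<dots> x_{n-1}. \<And>_{S \<subseteq> {0,\<dots>,n-1}} \<exists>y.
    (\<And>_{i \<in> S} \<phi>(x_i; y)) \<and> (\<And>_{i \<notin> S} \<not> \<phi>(x_i; y))\<close>,
  saying that \<open>\<phi>(x;y)\<close> shatters some \<open>n\<close>-element family of \<open>k\<close>-tuples.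
\<close>

definition shatter_sentence :: "nat \<Rightarrow> nat \<Rightarrow> rform \<Rightarrow> nat \<Rightarrow> rform" where
  "shatter_sentence k m \<phi> n =
     FExs [k + m ..< k + m + n * k]
       (FConj (map (\<lambda>S. FExs [k ..< k + m]
                 (FConj (map (\<lambda>i. if i \<in> set S then instance_at k m i \<phi>
                                   else FNot (instance_at k m i \<phi>)) [0..<n])))
          (subseqs [0..<n])))"

definition has_IP :: "rform set \<Rightarrow> nat \<Rightarrow> nat \<Rightarrow> rform \<Rightarrow> bool" where
  "has_IP T k m \<phi> \<longleftrightarrow> (\<forall>n. shatter_sentence k m \<phi> n \<in> T)"

text \<open>For a complete theory \<open>T\<close>, so that membership in \<open>T\<close> is truth in every model of \<open>T\<close>.\<close>

definition NIP_theory :: "rform set \<Rightarrow> bool" where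
  "NIP_theory T \<longleftrightarrow> (\<forall>k m \<phi>. free_vars \<phi> \<subseteq> {..<k + m} \<longrightarrow> \<not> has_IP T k m \<phi>)"

definition NIP_ring :: "('a, 'b) ring_scheme \<Rightarrow> bool" where
  "NIP_ring R \<longleftrightarrow> NIP_theory (complete_theory R)"

subsection \<open>Shattering in the ring itself\<close>

definition join_env :: "nat \<Rightarrow> (nat \<Rightarrow> 'a) \<Rightarrow> (nat \<Rightarrow> 'a) \<Rightarrow> nat \<Rightarrow> 'a" where
  "join_env k a b j = (if j < k then a j else b (j - k))"

lemma term_val_cong:
  "(\<And>x. x \<in> term_vars t \<Longrightarrow> e x = e' x) \<Longrightarrow> term_val R e t = term_val R e' t"
  by (induction t) auto

lemma sat_cong:
  "(\<And>x. x \<in> free_vars \<phi> \<Longrightarrow> e x = e' x) \<Longrightarrow> sat R e \<phi> \<longleftrightarrow> sat R e' \<phi>"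
proof (induction \<phi> arbitrary: e e')
  case (FEq s t)
  have "term_val R e s = term_val R e' s"
    by (rule term_val_cong) (rule FEq, simp)
  moreover have "term_val R e t = term_val R e' t"
    by (rule term_val_cong) (rule FEq, simp)
  ultimately show ?case by simp
next
  case (FNot \<phi>)
  have "sat R e \<phi> \<longleftrightarrow> sat R e' \<phi>"
    by (rule FNot.IH) (rule FNot.prems, simp)
  then show ?case by simp
next
  case (FAnd \<phi> \<psi>)
  have "sat R e \<phi> \<longleftrightarrow> sat R e' \<phi>"
    by (rule FAnd.IH(1)) (rule FAnd.prems, simp)
  moreover have "sat R e \<psi> \<longleftrightarrow> sat R e' \<psi>"
    by (rule FAnd.IH(2)) (rule FAnd.prems, simp)
  ultimately show ?case by simp
next
  case (FEx x \<phi>)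
  have "sat R (e(x := a)) \<phi> \<longleftrightarrow> sat R (e'(x := a)) \<phi>" for a
  proof (rule FEx.IH)
    fix y assume "y \<in> free_vars \<phi>"
    then show "(e(x := a)) y = (e'(x := a)) y"
      using FEx.prems[of y] by (cases "y = x") simp_all
  qed
  then show ?case by simp
qed

lemma sat_FConj: "sat R e (FConj \<phi>s) \<longleftrightarrow> (\<forall>\<phi> \<in> set \<phi>s. sat R e \<phi>)"
  by (induction \<phi>s) (auto simp: FConj_def FTrue_def)

lemma free_vars_FConj: "free_vars (FConj \<phi>s) = (\<Union>\<phi> \<in> set \<phi>s. free_vars \<phi>)"
  by (induction \<phi>s) (auto simp: FConj_def FTrue_def)

lemma free_vars_FExs: "free_vars (FExs xs \<phi>) = free_vars \<phi> - set xs"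
  by (induction xs) (auto simp: FExs_def)

lemma sat_FExs:
  "sat R e (FExs xs \<phi>) \<longleftrightarrow>
     (\<exists>f. (\<forall>x \<in> set xs. f x \<in> carrier R) \<and> sat R (\<lambda>x. if x \<in> set xs then f x else e x) \<phi>)"
proof (induction xs arbitrary: e)
  case Nil
  then show ?case by (simp add: FExs_def)
next
  case (Cons y xs)
  have "sat R e (FExs (y # xs) \<phi>) \<longleftrightarrow> (\<exists>a \<in> carrier R. sat R (e(y := a)) (FExs xs \<phi>))"
    by (simp add: FExs_def)
  also have "\<dots> \<longleftrightarrow> (\<exists>a \<in> carrier R. \<exists>f. (\<forall>x \<in> set xs. f x \<in> carrier R) \<and>
      sat R (\<lambda>x. if x \<in> set xs then f x else (e(y := a)) x) \<phi>)"
    by (simp only: Cons.IH)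
  also have "\<dots> \<longleftrightarrow> (\<exists>f. (\<forall>x \<in> set (y # xs). f x \<in> carrier R) \<and>
      sat R (\<lambda>x. if x \<in> set (y # xs) then f x else e x) \<phi>)" (is "?L \<longleftrightarrow> ?R")
  proof
    assume ?L
    then obtain a f where a: "a \<in> carrier R" and f: "\<forall>x \<in> set xs. f x \<in> carrier R"
      and s: "sat R (\<lambda>x. if x \<in> set xs then f x else (e(y := a)) x) \<phi>" by blast
    let ?g = "\<lambda>x. if x \<in> set xs then f x else a"
    have eq: "(\<lambda>x. if x \<in> set xs then f x else (e(y := a)) x) =
          (\<lambda>x. if x \<in> set (y # xs) then ?g x else e x)"
      by auto
    show ?R
      by (rule exI[of _ ?g]) (use a f s[unfolded eq] in simp)
  next
    assume ?R
    then obtain f where f: "\<forall>x \<in> set (y # xs). f x \<in> carrier R"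
      and s: "sat R (\<lambda>x. if x \<in> set (y # xs) then f x else e x) \<phi>" by blast
    have eq: "(\<lambda>x. if x \<in> set (y # xs) then f x else e x) =
          (\<lambda>x. if x \<in> set xs then f x else (e(y := f y)) x)"
      by auto
    show ?L
      by (rule bexI[of _ "f y"], rule exI[of _ f]) (use f s[unfolded eq] in simp_all)
  qed
  finally show ?case .
qed

lemma sat_instance_at:
  assumes "free_vars \<phi> \<subseteq> {..<k + m}"
    and "\<And>j. j < k \<Longrightarrow> e (k + m + i * k + j) \<in> carrier R"
  shows "sat R e (instance_at k m i \<phi>) \<longleftrightarrow>
    sat R (join_env k (\<lambda>j. e (k + m + i * k + j)) (\<lambda>j. e (k + j))) \<phi>"
    (is "_ \<longleftrightarrow> sat R ?J \<phi>")
proof -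
  let ?E = "\<lambda>f x. if x < k then f x else e x"
  have ex: "sat R e (instance_at k m i \<phi>) \<longleftrightarrow>
     (\<exists>f. (\<forall>j<k. f j \<in> carrier R) \<and> (\<forall>j<k. f j = e (k + m + i * k + j)) \<and> sat R (?E f) \<phi>)"
    by (simp add: instance_at_def sat_FExs sat_FConj atLeast0LessThan ball_simps Ball_def[of "{..<k}"])
  have cong: "sat R (?E f) \<phi> \<longleftrightarrow> sat R ?J \<phi>"
    if "\<forall>j<k. f j = e (k + m + i * k + j)" for f
    by (rule sat_cong) (use that in \<open>auto simp: join_env_def\<close>)
  show ?thesis
  proof
    assume "sat R e (instance_at k m i \<phi>)"
    then show "sat R ?J \<phi>" unfolding ex using cong by blast
  next
    assume "sat R ?J \<phi>"
    then have "sat R (?E (\<lambda>j. e (k + m + i * k + j))) \<phi>" using cong by simp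
    then show "sat R e (instance_at k m i \<phi>)"
      unfolding ex using assms(2) by (intro exI[of _ "\<lambda>j. e (k + m + i * k + j)"]) simp
  qed
qed

lemma free_vars_shatter_sentence:
  assumes "free_vars \<phi> \<subseteq> {..<k + m}"
  shows "free_vars (shatter_sentence k m \<phi> n) = {}"
proof -
  have idx: "i * k + j < n * k" if "i < n" "j < k" for i j :: nat
  proof -
    have "i * k + j < Suc i * k" using that by simp
    also have "\<dots> \<le> n * k" using that by (intro mult_le_mono1) simp
    finally show ?thesis .
  qed
  have inst: "free_vars (instance_at k m i \<phi>) \<subseteq> {k..<k + m + n * k}" if "i < n" for i
  proof
    fix x assume "x \<in> free_vars (instance_at k m i \<phi>)"
    then have "k \<le> x" "x < k + m \<or> (\<exists>j<k. x = k + m + i * k + j)"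
      using assms by (auto simp: instance_at_def free_vars_FExs free_vars_FConj)
    then show "x \<in> {k..<k + m + n * k}"
      using idx[OF that] by (auto simp: add.assoc)
  qed
  have "free_vars (if i \<in> S then instance_at k m i \<phi> else FNot (instance_at k m i \<phi>))
      \<subseteq> {k..<k + m + n * k}" if "i < n" for i S
    using inst[OF that] by simp
  then have "free_vars (FConj (map (\<lambda>i. if i \<in> S then instance_at k m i \<phi>
      else FNot (instance_at k m i \<phi>)) [0..<n])) \<subseteq> {k..<k + m + n * k}" for S
    unfolding free_vars_FConj set_map set_upt
    by (intro UN_least, elim imageE) (simp only: atLeastLessThan_iff)
  then have "free_vars (FExs [k..<k + m] (FConj (map (\<lambda>i. if i \<in> S then instance_at k m i \<phi>
      else FNot (instance_at k m i \<phi>)) [0..<n]))) \<subseteq> {k + m..<k + m + n * k}" for S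
    unfolding free_vars_FExs by fastforce
  then show ?thesis
    unfolding shatter_sentence_def free_vars_FExs[of "[k + m..<k + m + n * k]"] free_vars_FConj
      set_map set_upt by blast
qed

lemma sat_shatter_sentence:
  fixes R :: "('a, 'b) ring_scheme"
  assumes fv: "free_vars \<phi> \<subseteq> {..<k + m}"
  shows "sat R e (shatter_sentence k m \<phi> n) \<longleftrightarrow>
    (\<exists>a. (\<forall>i<n. \<forall>j<k. a i j \<in> carrier R) \<and>
      (\<forall>S \<subseteq> {..<n}. \<exists>b. (\<forall>j<m. b j \<in> carrier R) \<and>
         (\<forall>i<n. sat R (join_env k (a i) b) \<phi> \<longleftrightarrow> i \<in> S)))"
    (is "_ \<longleftrightarrow> ?R")
proof -
  define E where "E f g x = (if k \<le> x \<and> x < k + m then g x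
      else if k + m \<le> x \<and> x < k + m + n * k then f x else e x)" for f g :: "nat \<Rightarrow> 'a" and x
  have idx: "i * k + j < n * k" if "i < n" "j < k" for i j :: nat
  proof -
    have "i * k + j < Suc i * k" using that by simp
    also have "\<dots> \<le> n * k" using that by (intro mult_le_mono1) simp
    finally show ?thesis .
  qed
  have pow: "set ` set (subseqs [0..<n]) = Pow {..<n}"
    by (simp add: subseqs_powset atLeast0LessThan)
  have ex: "sat R e (shatter_sentence k m \<phi> n) \<longleftrightarrow>
    (\<exists>f. (\<forall>x \<in> {k + m..<k + m + n * k}. f x \<in> carrier R) \<and>
      (\<forall>S \<in> set ` set (subseqs [0..<n]). \<exists>g. (\<forall>x \<in> {k..<k + m}. g x \<in> carrier R) \<and>
        (\<forall>i<n. sat R (E f g) (instance_at k m i \<phi>) \<longleftrightarrow> i \<in> S)))"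
  proof -
    have E: "(\<lambda>x. if x \<in> {k..<k + m} then g x
        else if x \<in> {k + m..<k + m + n * k} then f x else e x) = E f g" for f g
      by (auto simp: E_def fun_eq_iff)
    have "(\<forall>\<psi> \<in> set (map (\<lambda>i. if i \<in> S then instance_at k m i \<phi>
              else FNot (instance_at k m i \<phi>)) [0..<n]). sat R e' \<psi>) \<longleftrightarrow>
        (\<forall>i<n. sat R e' (instance_at k m i \<phi>) \<longleftrightarrow> i \<in> S)" for S e'
      by (simp del: if_image_distrib add: atLeast0LessThan Ball_def) auto
    then show ?thesis
      unfolding shatter_sentence_def sat_FExs sat_FConj
      by (simp only: set_map ball_simps sat_FExs sat_FConj E set_upt)
  qed
  have inst: "sat R (E f g) (instance_at k m i \<phi>) \<longleftrightarrow>
      sat R (join_env k (\<lambda>j. f (k + m + i * k + j)) (\<lambda>j. g (k + j))) \<phi>"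
    if "\<forall>x \<in> {k + m..<k + m + n * k}. f x \<in> carrier R" "i < n" for f g i
  proof -
    have A: "E f g (k + m + i * k + j) = f (k + m + i * k + j)" if "j < k" for j
      using idx[OF \<open>i < n\<close> that] by (simp add: E_def add.assoc)
    have "sat R (E f g) (instance_at k m i \<phi>) \<longleftrightarrow>
      sat R (join_env k (\<lambda>j. E f g (k + m + i * k + j)) (\<lambda>j. E f g (k + j))) \<phi>"
      by (rule sat_instance_at[OF fv])
        (use A that idx[OF \<open>i < n\<close>] in \<open>auto simp: add.assoc\<close>)
    also have "\<dots> \<longleftrightarrow> sat R (join_env k (\<lambda>j. f (k + m + i * k + j)) (\<lambda>j. g (k + j))) \<phi>"
    proof (rule sat_cong)
      fix x assume "x \<in> free_vars \<phi>"
      then have "x < k + m" using fv by auto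
      then show "join_env k (\<lambda>j. E f g (k + m + i * k + j)) (\<lambda>j. E f g (k + j)) x =
         join_env k (\<lambda>j. f (k + m + i * k + j)) (\<lambda>j. g (k + j)) x"
        using A by (auto simp: join_env_def E_def)
    qed
    finally show ?thesis .
  qed
  show ?thesis
  proof
    assume "sat R e (shatter_sentence k m \<phi> n)"
    then obtain f where f: "\<forall>x \<in> {k + m..<k + m + n * k}. f x \<in> carrier R"
      and F: "\<forall>S \<in> Pow {..<n}. \<exists>g. (\<forall>x \<in> {k..<k + m}. g x \<in> carrier R) \<and>
        (\<forall>i<n. sat R (E f g) (instance_at k m i \<phi>) \<longleftrightarrow> i \<in> S)"
      unfolding ex pow by blast
    show ?R
    proof (intro exI[of _ "\<lambda>i j. f (k + m + i * k + j)"] conjI allI impI)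
      fix i j assume "i < n" "j < k"
      then show "f (k + m + i * k + j) \<in> carrier R"
        using f idx by (auto simp: add.assoc)
    next
      fix S assume "S \<subseteq> {..<n}"
      then obtain g where "\<forall>x \<in> {k..<k + m}. g x \<in> carrier R"
        "\<forall>i<n. sat R (E f g) (instance_at k m i \<phi>) \<longleftrightarrow> i \<in> S"
        using F by blast
      then show "\<exists>b. (\<forall>j<m. b j \<in> carrier R) \<and>
         (\<forall>i<n. sat R (join_env k (\<lambda>j. f (k + m + i * k + j)) b) \<phi> \<longleftrightarrow> i \<in> S)"
        using inst[OF f] by (intro exI[of _ "\<lambda>j. g (k + j)"]) auto
    qed
  next
    assume ?R
    then obtain a where a: "\<And>i j. i < n \<Longrightarrow> j < k \<Longrightarrow> a i j \<in> carrier R"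
      and F: "\<And>S. S \<subseteq> {..<n} \<Longrightarrow> \<exists>b. (\<forall>j<m. b j \<in> carrier R) \<and>
         (\<forall>i<n. sat R (join_env k (a i) b) \<phi> \<longleftrightarrow> i \<in> S)" by blast
    define f where "f x = a ((x - (k + m)) div k) ((x - (k + m)) mod k)" for x
    have f: "\<forall>x \<in> {k + m..<k + m + n * k}. f x \<in> carrier R"
    proof
      fix x assume x: "x \<in> {k + m..<k + m + n * k}"
      then have k: "0 < k" by (cases k) auto
      have "(x - (k + m)) div k < n"
        using x k by (subst div_less_iff_less_mult) auto
      then show "f x \<in> carrier R" unfolding f_def using k by (intro a) auto
    qed
    have fa: "f (k + m + i * k + j) = a i j" if "j < k" for i j
    proof -
      have "k + m + i * k + j - (k + m) = i * k + j" by simp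
      then show ?thesis using that by (simp add: f_def)
    qed
    have fj: "sat R (join_env k (\<lambda>j. f (k + m + i * k + j)) b) \<phi> \<longleftrightarrow> sat R (join_env k (a i) b) \<phi>" for i b
      by (rule sat_cong) (simp add: join_env_def fa)
    show "sat R e (shatter_sentence k m \<phi> n)"
      unfolding ex pow
    proof (rule exI[of _ f], rule conjI[OF f], rule ballI)
      fix S assume "S \<in> Pow {..<n}"
      then obtain b where b: "\<forall>j<m. b j \<in> carrier R"
        "\<forall>i<n. sat R (join_env k (a i) b) \<phi> \<longleftrightarrow> i \<in> S" using F by blast
      show "\<exists>g. (\<forall>x \<in> {k..<k + m}. g x \<in> carrier R) \<and>
        (\<forall>i<n. sat R (E f g) (instance_at k m i \<phi>) \<longleftrightarrow> i \<in> S)"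
        by (rule exI[of _ "\<lambda>x. b (x - k)"]) (use b inst[OF f] fj in auto)
    qed
  qed
qed

lemma has_IP_complete_theory_iff:
  fixes R :: "('a, 'b) ring_scheme"
  assumes "carrier R \<noteq> {}" and fv: "free_vars \<phi> \<subseteq> {..<k + m}"
  shows "has_IP (complete_theory R) k m \<phi> \<longleftrightarrow>
    (\<forall>n :: nat. \<exists>a. (\<forall>i<n. \<forall>j<k. a i j \<in> carrier R) \<and>
      (\<forall>S \<subseteq> {..<n}. \<exists>b. (\<forall>j<m. b j \<in> carrier R) \<and>
         (\<forall>i<n. sat R (join_env k (a i) b) \<phi> \<longleftrightarrow> i \<in> S)))"
proof -
  from assms(1) obtain c where "c \<in> carrier R" by blast
  then have "range (\<lambda>_ :: nat. c) \<subseteq> carrier R" by auto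
  then have *: "(\<forall>e :: nat \<Rightarrow> 'a. range e \<subseteq> carrier R \<longrightarrow> P) \<longleftrightarrow> P" for P by blast
  show ?thesis
    by (simp only: mem_Collect_eq * simp_thms has_IP_def complete_theory_def free_vars_shatter_sentence[OF fv]
        sat_shatter_sentence[OF fv])
qed

section \<open>Henselian local rings\<close>

definition local_ring :: "('a, 'b) ring_scheme \<Rightarrow> bool" where
  "local_ring R \<longleftrightarrow> cring R \<and> (\<exists>!M. maximalideal M R)"

definition UP_monic :: "('a, 'b) ring_scheme \<Rightarrow> (nat \<Rightarrow> 'a) \<Rightarrow> bool" where
  "UP_monic R f \<longleftrightarrow> f \<in> carrier (UP R) \<and> coeff (UP R) f (deg R f) = \<one>\<^bsub>R\<^esub>"

definition UP_deriv :: "('a, 'b) ring_scheme \<Rightarrow> (nat \<Rightarrow> 'a) \<Rightarrow> nat \<Rightarrow> 'a" where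
  "UP_deriv R f = (\<lambda>i. [Suc i] \<cdot>\<^bsub>R\<^esub> coeff (UP R) f (Suc i))"

lemma UP_deriv_closed:
  assumes "ring R" "f \<in> carrier (UP R)"
  shows "UP_deriv R f \<in> carrier (UP R)"
proof -
  interpret ring R by fact
  have f: "f \<in> up R" using assms(2) by (simp add: UP_def)
  have c: "coeff (UP R) f = f" using f by (simp add: UP_def)
  obtain n where "bound \<zero>\<^bsub>R\<^esub> n f" using f by (auto simp: up_def)
  then have "bound \<zero>\<^bsub>R\<^esub> n (UP_deriv R f)"
    by (auto simp: bound_def UP_deriv_def c)
  moreover have "UP_deriv R f \<in> UNIV \<rightarrow> carrier R"
    using f by (auto simp: UP_deriv_def c up_def)
  ultimately show ?thesis by (auto simp: UP_def up_def)
qed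

text \<open>
  A local ring is Henselian if simple roots in the residue field of monic polynomials over the ring
  lift to roots in the ring. \<open>eval R (R Quot M) ((+>\<^bsub>R\<^esub>) M) \<alpha> f\<close> is the value at \<open>\<alpha>\<close> of the
  reduction of \<open>f\<close> modulo \<open>M\<close>.
\<close>

definition henselian_local_ring :: "('a, 'b) ring_scheme \<Rightarrow> bool" where
  "henselian_local_ring R \<longleftrightarrow> local_ring R \<and>
     (\<forall>M f \<alpha>. maximalideal M R \<and> UP_monic R f \<and> \<alpha> \<in> carrier (R Quot M) \<and>
        eval R (R Quot M) ((+>\<^bsub>R\<^esub>) M) \<alpha> f = \<zero>\<^bsub>R Quot M\<^esub> \<and>
        eval R (R Quot M) ((+>\<^bsub>R\<^esub>) M) \<alpha> (UP_deriv R f) \<noteq> \<zero>\<^bsub>R Quot M\<^esub>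
        \<longrightarrow> (\<exists>a \<in> carrier R. eval R R id a f = \<zero>\<^bsub>R\<^esub> \<and> M +>\<^bsub>R\<^esub> a = \<alpha>))"

end

theory Submission
  imports Defs
begin

text \<open>
  Suppose that neither \<open>e\<close> nor \<open>1 - e\<close> is a unit of a domain of characteristic \<open>p\<close>, and put
  \<open>d = e (1 - e)\<close>. The Artin-Schreier equation \<open>z^p - z = x\<close> with \<open>z\<close> in \<open>(d)\<close> is then sensitive to
  lifts of \<open>e\<close>: if \<open>z = e\<close> modulo \<open>d\<close>, then \<open>z^p - z\<close> has no preimage in \<open>(d)\<close>, because the
  difference \<open>u\<close> of \<open>z\<close> and such a preimage would satisfy \<open>u^p = u\<close> and \<open>u = e\<close> modulo \<open>d\<close>.
  As in the theorem of Kaplan, Scanlon and Wagner, the simultaneous equations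
  \<open>c_i^p (z_i^p - z_i) = y\<close>, \<open>i < n\<close>, are solved by additive polynomials in one parameter \<open>w\<close>,
  namely \<open>y = P_V(w)\<close> and \<open>z_i = P_H(w) / P_H(v_i)\<close>, where \<open>V\<close> is spanned over the prime field by
  \<open>v_0, \<dots>, v_{n-1}\<close>, where \<open>H\<close> is spanned by the \<open>v_j\<close> with \<open>j \<noteq> i\<close>, and where \<open>P_V\<close> is the product of
  the \<open>x - v\<close> with \<open>v\<close> in \<open>V\<close>. Choosing \<open>w\<close> as a sum of some of the \<open>E v_j\<close>, where \<open>E\<close> lifts \<open>e\<close> and is
  idempotent to a high order, makes each \<open>z_i\<close> congruent to \<open>0\<close> or to \<open>e\<close> at will. So the formula
  \<open>\<exists>r. a ((d r)^p - d r) = y\<close> has the independence property. Hence a NIP domain of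
  characteristic \<open>p\<close> is local.

  Let now \<open>f\<close> be monic with a simple root \<open>b\<close> modulo the maximal ideal. Some prime ideal \<open>I\<close> of \<open>R[X]\<close>
  contains \<open>f\<close>, meets \<open>R\<close> in \<open>0\<close>, consists of polynomials whose value at \<open>b\<close> lies in the maximal ideal,
  and has the form \<open>(f : h)\<close>. The last property makes \<open>R[X]/I\<close> interpretable in \<open>R\<close>, so this domain is
  NIP and therefore local. In the local ring \<open>R[X]/I\<close> the cofactor of \<open>X - b\<close> in \<open>f - f(b)\<close> is a unit, so
  \<open>X - b\<close> lies in the extension of the maximal ideal, and Nakayama's lemma gives
  \<open>R[X]/I = R\<close>. The image of \<open>X\<close> is the required root.
\<close>

section \<open>Frobenius and approximate idempotents\<close>

text \<open>This rule is missing from the set \<open>cring_simprules\<close> used by the method \<open>algebra\<close>.\<close>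
lemmas (in cring) r_one_simprule
  [algebra add: cring "zero R" "add R" "a_inv R" "a_minus R" "one R" "monoid.mult R"] = r_one

section \<open>The binomial theorem and the Frobenius map\<close>

context cring begin

lemma minus_zeroI: "a \<ominus> b = \<zero> \<Longrightarrow> a \<in> carrier R \<Longrightarrow> b \<in> carrier R \<Longrightarrow> a = b"
  by (metis a_minus_def add.inv_closed add.inv_equality add.inv_inv)

lemma binomial:
  assumes [simp]: "a \<in> carrier R" "b \<in> carrier R"
  shows "(a \<oplus> b) [^] (n::nat) = (\<Oplus>k\<in>{..n}. [(n choose k)] \<cdot> (a [^] k \<otimes> b [^] (n - k)))"
proof (induction n)
  case 0
  then show ?case by simp
next
  case (Suc n)
  let ?F = "\<lambda>n k. [(n choose k)] \<cdot> (a [^] k \<otimes> b [^] (n - k))"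
  let ?A = "\<Oplus>k\<in>{..n}. [(n choose k)] \<cdot> (a [^] Suc k \<otimes> b [^] (n - k))"
  let ?B = "\<Oplus>k\<in>{..n}. [(n choose Suc k)] \<cdot> (a [^] Suc k \<otimes> b [^] (n - k))"
  have A: "finsum R (?F n) {..n} \<otimes> a = ?A"
    by (subst finsum_ldistr)
      (auto intro!: finsum_cong' simp: add_pow_rdistr m_ac)
  have "finsum R (?F n) {..n} \<otimes> b = (\<Oplus>k\<in>{..n}. [(n choose k)] \<cdot> (a [^] k \<otimes> b [^] (Suc n - k)))"
    by (subst finsum_ldistr)
      (auto intro!: finsum_cong' simp: add_pow_ldistr m_assoc Suc_diff_le)
  \<comment> \<open>The new summand at \<open>Suc n\<close> vanishes with its binomial coefficient.
    It is added so that the summand at 0 can be split off and the rest reindexed over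
    \<open>{..n}\<close>, where Pascal's rule joins \<open>?A\<close> and \<open>?B\<close>.\<close>
  also have "\<dots> = (\<Oplus>k\<in>{..Suc n}. [(n choose k)] \<cdot> (a [^] k \<otimes> b [^] (Suc n - k)))"
    by (simp add: Pi_def binomial_eq_0)
  also have "\<dots> = ?B \<oplus> b [^] Suc n"
    by (subst finsum_Suc2) (auto simp: Pi_def)
  finally have B: "finsum R (?F n) {..n} \<otimes> b = ?B \<oplus> b [^] Suc n" .
  have "finsum R (?F (Suc n)) {..Suc n} =
      (\<Oplus>k\<in>{..n}. [(Suc n choose Suc k)] \<cdot> (a [^] Suc k \<otimes> b [^] (n - k))) \<oplus> b [^] Suc n"
    by (subst finsum_Suc2) (auto simp: Pi_def)
  also have "(\<Oplus>k\<in>{..n}. [(Suc n choose Suc k)] \<cdot> (a [^] Suc k \<otimes> b [^] (n - k))) = ?A \<oplus> ?B"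
    by (subst finsum_addf[symmetric]) (auto intro!: finsum_cong' simp: add.nat_pow_mult)
  finally have "finsum R (?F (Suc n)) {..Suc n} = ?A \<oplus> ?B \<oplus> b [^] Suc n" .
  moreover have "(a \<oplus> b) [^] Suc n = finsum R (?F n) {..n} \<otimes> a \<oplus> finsum R (?F n) {..n} \<otimes> b"
    using Suc by (simp add: r_distr)
  ultimately show ?case using A B by (simp add: a_assoc)
qed

text \<open>The inner binomial coefficients of a prime exponent are divisible by \<open>p\<close>,
  so only the two extreme terms of the binomial sum survive.\<close>

lemma frobenius_add:
  fixes p :: nat
  assumes p: "Factorial_Ring.prime p" and char: "[p] \<cdot> \<one> = \<zero>"
    and [simp]: "a \<in> carrier R" "b \<in> carrier R"
  shows "(a \<oplus> b) [^] p = a [^] p \<oplus> b [^] p"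
proof -
  \<comment> \<open>Two successors are exposed so that the top and the bottom summand can be split
    off one after the other.\<close>
  obtain m where m: "p = Suc (Suc m)"
    using prime_ge_2_nat[OF p] by (metis add_2_eq_Suc le_Suc_ex)
  have van: "[q] \<cdot> x = \<zero>" if "p dvd q" "x \<in> carrier R" for q :: nat and x
  proof -
    have "[q] \<cdot> x = ([q] \<cdot> \<one>) \<otimes> x" using that by (simp add: add_pow_ldistr)
    moreover obtain r where "q = p * r" using \<open>p dvd q\<close> by (rule dvdE)
    then have "[q] \<cdot> \<one> = [r] \<cdot> ([p] \<cdot> \<one>)" by (simp add: add.nat_pow_pow)
    ultimately show ?thesis using char that by simp
  qed
  have "(a \<oplus> b) [^] p = (\<Oplus>k\<in>{..p}. [(p choose k)] \<cdot> (a [^] k \<otimes> b [^] (p - k)))"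
    by (rule binomial) auto
  also have "\<dots> = (\<Oplus>k\<in>{..p}. if k = 0 then b [^] p else if k = p then a [^] p else \<zero>)"
  proof (rule finsum_cong')
    fix k assume "k \<in> {..p}"
    then show "[(p choose k)] \<cdot> (a [^] k \<otimes> b [^] (p - k)) =
        (if k = 0 then b [^] p else if k = p then a [^] p else \<zero>)"
      using p by (auto simp: van dvd_choose_prime)
  qed auto
  also have "\<dots> = a [^] p \<oplus> b [^] p"
  proof -
    have "(\<Oplus>k\<in>{..m}. if Suc k = 0 then b [^] p else if Suc k = p then a [^] p else \<zero>) =
        (\<Oplus>k\<in>{..m}. \<zero>)"
      by (rule finsum_cong') (auto simp: m)
    then show ?thesis
      unfolding m by (subst finsum_Suc, force, subst finsum_Suc2, force) simp
  qed
  finally show ?thesis .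
qed

lemma frobenius_uminus:
  fixes p :: nat
  assumes p: "Factorial_Ring.prime p" and char: "[p] \<cdot> \<one> = \<zero>"
    and [simp]: "a \<in> carrier R"
  shows "(\<ominus> a) [^] p = \<ominus> (a [^] p)"
proof -
  have "a [^] p \<oplus> (\<ominus> a) [^] p = (a \<oplus> \<ominus> a) [^] p"
    by (rule frobenius_add[OF p char, symmetric]) auto
  also have "\<dots> = \<zero>" using prime_gt_0_nat[OF p] by (simp add: r_neg nat_pow_zero)
  finally show ?thesis by (metis add.inv_equality add.m_comm assms(3) a_inv_closed nat_pow_closed)
qed

lemma frobenius_minus:
  fixes p :: nat
  assumes p: "Factorial_Ring.prime p" and char: "[p] \<cdot> \<one> = \<zero>"
    and [simp]: "a \<in> carrier R" "b \<in> carrier R"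
  shows "(a \<ominus> b) [^] p = a [^] p \<ominus> b [^] p"
  using assms by (simp add: a_minus_def frobenius_add frobenius_uminus)


text \<open>The products of a power of \<open>d\<close> with a unit modulo \<open>d\<close>. They
  serve as denominators in \<open>d\<close>-adic computations: they form a multiplicative set,
  survive perturbation by high powers of \<open>d\<close>, and are nonzero if \<open>d\<close> is a
  nonzero nonunit of a domain.\<close>

definition unit_power :: "'a \<Rightarrow> 'a set" where
  "unit_power d = {d [^] M \<otimes> s | (M :: nat) s. s \<in> carrier R \<and>
     (\<exists>t \<in> carrier R. \<exists>r \<in> carrier R. s \<otimes> t = \<one> \<ominus> d \<otimes> r)}"

lemma unit_powerI:
  assumes "s \<in> carrier R" "t \<in> carrier R" "r \<in> carrier R" "s \<otimes> t = \<one> \<ominus> d \<otimes> r"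
  shows "d [^] (M :: nat) \<otimes> s \<in> unit_power d"
  using assms unfolding unit_power_def by blast

lemma unit_powerE:
  assumes "g \<in> unit_power d"
  obtains M s t r where "s \<in> carrier R" "t \<in> carrier R" "r \<in> carrier R"
    "s \<otimes> t = \<one> \<ominus> d \<otimes> r" "g = d [^] (M :: nat) \<otimes> s"
  using assms unfolding unit_power_def by blast

context
  fixes d assumes d [simp]: "d \<in> carrier R"
begin

lemma unit_power_carrier: "g \<in> unit_power d \<Longrightarrow> g \<in> carrier R"
  by (auto simp: unit_power_def)

lemma unit_power_pow: "d [^] (N :: nat) \<in> unit_power d"
proof -
  have "\<one> \<otimes> \<one> = \<one> \<ominus> d \<otimes> \<zero>" using d by algebra
  from unit_powerI[OF _ _ _ this, of N] show ?thesis by simp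
qed

lemma unit_power_one: "\<one> \<in> unit_power d"
  using unit_power_pow[of 0] by simp

lemma unit_power_mult:
  assumes "g \<in> unit_power d" "h \<in> unit_power d"
  shows "g \<otimes> h \<in> unit_power d"
proof -
  obtain M s t r where 1 [simp]: "s \<in> carrier R" "t \<in> carrier R" "r \<in> carrier R"
    and e: "s \<otimes> t = \<one> \<ominus> d \<otimes> r" and g: "g = d [^] (M :: nat) \<otimes> s"
    using assms(1) by (rule unit_powerE)
  obtain M' s' t' r' where 2 [simp]: "s' \<in> carrier R" "t' \<in> carrier R" "r' \<in> carrier R"
    and e': "s' \<otimes> t' = \<one> \<ominus> d \<otimes> r'" and h: "h = d [^] (M' :: nat) \<otimes> s'"
    using assms(2) by (rule unit_powerE)
  have "(s \<otimes> s') \<otimes> (t \<otimes> t') = (s \<otimes> t) \<otimes> (s' \<otimes> t')" using 1 2 by algebra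
  also have "\<dots> = \<one> \<ominus> d \<otimes> (r \<oplus> r' \<ominus> d \<otimes> r \<otimes> r')"
    unfolding e e' using d 1 2 by algebra
  finally have "d [^] (M + M') \<otimes> (s \<otimes> s') \<in> unit_power d"
    by (intro unit_powerI) auto
  moreover have "g \<otimes> h = d [^] (M + M') \<otimes> (s \<otimes> s')"
    unfolding g h by (simp add: nat_pow_mult[symmetric] m_ac)
  ultimately show ?thesis by simp
qed

lemma unit_power_nat_pow:
  "g \<in> unit_power d \<Longrightarrow> g [^] (k :: nat) \<in> unit_power d"
  by (induction k) (auto intro: unit_power_one unit_power_mult)

lemma unit_power_uminus:
  assumes "g \<in> unit_power d"
  shows "\<ominus> g \<in> unit_power d"
proof -
  obtain M s t r where 1 [simp]: "s \<in> carrier R" "t \<in> carrier R" "r \<in> carrier R"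
    and e: "s \<otimes> t = \<one> \<ominus> d \<otimes> r" and g: "g = d [^] (M :: nat) \<otimes> s"
    using assms(1) by (rule unit_powerE)
  have "(\<ominus> s) \<otimes> (\<ominus> t) = \<one> \<ominus> d \<otimes> r"
    using e by (simp add: l_minus r_minus)
  then have "d [^] M \<otimes> (\<ominus> s) \<in> unit_power d"
    by (intro unit_powerI) auto
  then show ?thesis unfolding g by (simp add: r_minus)
qed

text \<open>Once \<open>N\<close> exceeds the exponent of \<open>d\<close> in \<open>g\<close>, the
  factor \<open>s\<close> changes only by a multiple of \<open>d\<close> and stays a unit modulo
  \<open>d\<close>. The form with \<open>eventually\<close> lets one exponent meet finitely many
  such conditions.\<close>

lemma unit_power_perturb:
  assumes "g \<in> unit_power d"
  shows "\<forall>\<^sub>F N in sequentially. \<forall>r \<in> carrier R. g \<oplus> d [^] (N :: nat) \<otimes> r \<in> unit_power d"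
proof -
  obtain M s t r where 1 [simp]: "s \<in> carrier R" "t \<in> carrier R" "r \<in> carrier R"
    and e: "s \<otimes> t = \<one> \<ominus> d \<otimes> r" and g: "g = d [^] (M :: nat) \<otimes> s"
    using assms(1) by (rule unit_powerE)
  show ?thesis
  proof (rule eventually_sequentiallyI[of "Suc M"], intro ballI)
    fix N q assume "Suc M \<le> N" and q [simp]: "q \<in> carrier R"
    then obtain K where N: "N = M + Suc K" by (metis add_Suc_shift le_Suc_ex)
    define u where "u = d [^] K \<otimes> q"
    have u [simp]: "u \<in> carrier R" unfolding u_def by simp
    have "(s \<oplus> d \<otimes> u) \<otimes> t = s \<otimes> t \<oplus> d \<otimes> u \<otimes> t" using d 1 u by algebra
    also have "\<dots> = \<one> \<ominus> d \<otimes> (r \<ominus> u \<otimes> t)" unfolding e using d 1 u by algebra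
    finally have "d [^] M \<otimes> (s \<oplus> d \<otimes> u) \<in> unit_power d"
      by (intro unit_powerI) auto
    also have "d [^] M \<otimes> (s \<oplus> d \<otimes> u) = g \<oplus> d [^] N \<otimes> q"
      unfolding g N u_def by (simp add: nat_pow_mult[symmetric] r_distr m_ac)
    finally show "g \<oplus> d [^] N \<otimes> q \<in> unit_power d" .
  qed
qed

end

text \<open>The product of the \<open>c i\<close> serves as \<open>C\<close>. Such a common multiple
  sets the precision to which an idempotent has to be approximated.\<close>

lemma unit_power_finprod:
  assumes "d \<in> carrier R" "finite I" "\<And>i. i \<in> I \<Longrightarrow> c i \<in> unit_power d"
  shows "\<exists>C \<in> unit_power d. \<forall>i \<in> I. \<exists>q \<in> carrier R. C = c i \<otimes> q"
  using assms(2,3)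
proof (induction I rule: finite_induct)
  case empty
  then show ?case using unit_power_one[OF assms(1)] by blast
next
  case (insert i I)
  then obtain C where C: "C \<in> unit_power d" "\<forall>j \<in> I. \<exists>q \<in> carrier R. C = c j \<otimes> q" by auto
  have [simp]: "C \<in> carrier R" "c i \<in> carrier R"
    using unit_power_carrier[OF assms(1)] C insert by auto
  show ?case
  proof (rule bexI[of _ "c i \<otimes> C"], intro ballI)
    show "c i \<otimes> C \<in> unit_power d"
      using insert C unit_power_mult[OF assms(1)] by blast
    fix j assume "j \<in> insert i I"
    then consider "j = i" | "j \<in> I" by auto
    then show "\<exists>q \<in> carrier R. c i \<otimes> C = c j \<otimes> q"
    proof cases
      case 2
      then obtain q where q: "q \<in> carrier R" "C = c j \<otimes> q" using C by blast
      moreover have "c j \<in> carrier R"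
        using 2 insert unit_power_carrier[OF assms(1)] by auto
      ultimately have "c i \<otimes> C = c j \<otimes> (c i \<otimes> q)" by (simp add: m_lcomm)
      then show ?thesis using q by auto
    qed auto
  qed
qed

text \<open>Newton's iteration: with \<open>F = E^2 - E\<close>, passing from \<open>E\<close> to
  \<open>E - (2E - 1) F\<close> turns the error \<open>F\<close> into \<open>F^2 (4F - 3)\<close>,
  because \<open>(2E - 1)^2 = 4F + 1\<close>.\<close>

lemma approximate_idempotent_pow:
  assumes e: "e \<in> carrier R"
  defines "d \<equiv> e \<otimes> (\<one> \<ominus> e)"
  shows "\<exists>E \<in> carrier R. \<exists>r \<in> carrier R. \<exists>k \<in> carrier R.
    E = e \<oplus> d \<otimes> r \<and> E \<otimes> E \<ominus> E = d [^] Suc M \<otimes> k"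
proof (induction M)
  case 0
  have "e \<otimes> e \<ominus> e = e \<otimes> (\<one> \<ominus> e) \<otimes> (\<ominus> \<one>)" using e by algebra
  then have "e \<otimes> e \<ominus> e = d [^] Suc 0 \<otimes> (\<ominus> \<one>)" unfolding d_def using e by simp
  moreover have "e = e \<oplus> d \<otimes> \<zero>" unfolding d_def using e by simp
  ultimately show ?case using e by blast
next
  case (Suc M)
  then obtain E r k where c: "E \<in> carrier R" "r \<in> carrier R" "k \<in> carrier R"
    and E: "E = e \<oplus> d \<otimes> r" and k: "E \<otimes> E \<ominus> E = d [^] Suc M \<otimes> k" by blast
  have d: "d \<in> carrier R" unfolding d_def using e by simp
  define F where "F = E \<otimes> E \<ominus> E"
  define u where "u = d [^] M"
  have u: "u \<in> carrier R" unfolding u_def using d by simp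
  have F: "F \<in> carrier R" unfolding F_def using c by simp
  have F': "F = d \<otimes> (u \<otimes> k)" unfolding F_def k u_def using d c by (simp add: m_ac)
  define m where "m = E \<oplus> E \<ominus> \<one>"
  have m: "m \<in> carrier R" unfolding m_def using c by simp
  \<comment> \<open>The new error is a multiple of \<open>F^2\<close>, hence of
    \<open>d^(2M + 2)\<close>; the induction extracts only \<open>d^(M + 2)\<close> from it.\<close>
  let ?E = "E \<ominus> m \<otimes> F"
  define t where "t = F \<oplus> F \<oplus> F \<oplus> F \<ominus> \<one> \<ominus> \<one> \<ominus> \<one>"
  have t: "t \<in> carrier R" unfolding t_def using F by simp
  have m2: "m \<otimes> m = F \<oplus> F \<oplus> F \<oplus> F \<oplus> \<one>" unfolding m_def F_def using c by algebra
  have sq: "(E \<ominus> x) \<otimes> (E \<ominus> x) \<ominus> (E \<ominus> x) = (E \<otimes> E \<ominus> E) \<ominus> (E \<oplus> E \<ominus> \<one>) \<otimes> x \<oplus> x \<otimes> x"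
    if "x \<in> carrier R" for x using c that by algebra
  have "?E \<otimes> ?E \<ominus> ?E = F \<ominus> m \<otimes> (m \<otimes> F) \<oplus> (m \<otimes> F) \<otimes> (m \<otimes> F)"
    using sq[of "m \<otimes> F"] m F unfolding F_def[symmetric] m_def[symmetric] by simp
  also have "\<dots> = F \<ominus> (m \<otimes> m) \<otimes> F \<oplus> (m \<otimes> m) \<otimes> (F \<otimes> F)" using m F by algebra
  also have "\<dots> = F \<otimes> F \<otimes> t" unfolding m2 t_def using F by algebra
  also have "\<dots> = F \<otimes> (d \<otimes> (u \<otimes> k)) \<otimes> t" by (simp only: F'[symmetric])
  also have "\<dots> = d \<otimes> F \<otimes> (u \<otimes> k \<otimes> t)" using d c(3) u F t by (simp add: m_ac)
  also have "\<dots> = d \<otimes> (d \<otimes> (u \<otimes> k)) \<otimes> (u \<otimes> k \<otimes> t)" by (simp only: F'[symmetric])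
  also have "\<dots> = (u \<otimes> d \<otimes> d) \<otimes> (k \<otimes> u \<otimes> k \<otimes> t)" using d c(3) u F t by (simp add: m_ac)
  finally have "?E \<otimes> ?E \<ominus> ?E = d [^] Suc (Suc M) \<otimes> (k \<otimes> u \<otimes> k \<otimes> t)"
    by (simp add: u_def)
  moreover have "?E = e \<oplus> d \<otimes> (r \<ominus> m \<otimes> (u \<otimes> k))"
  proof -
    have "?E = (e \<oplus> d \<otimes> r) \<ominus> m \<otimes> (d \<otimes> (u \<otimes> k))"
      by (simp only: F'[symmetric] E[symmetric])
    also have "\<dots> = e \<oplus> d \<otimes> (r \<ominus> m \<otimes> (u \<otimes> k))" using c d u e m by algebra
    finally show ?thesis .
  qed
  ultimately show ?case using c d u e F m t
    by (intro bexI[of _ ?E] bexI[of _ "r \<ominus> m \<otimes> (u \<otimes> k)"]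
        bexI[of _ "k \<otimes> u \<otimes> k \<otimes> t"] conjI) simp_all
qed

text \<open>If \<open>s t'\<close> misses 1 by some error, then adding \<open>t\<close> times this
  error to \<open>t'\<close> multiplies the error by \<open>d r\<close>.\<close>

lemma inverse_mod_pow:
  assumes c: "s \<in> carrier R" "t \<in> carrier R" "r \<in> carrier R" "d \<in> carrier R"
    and st: "s \<otimes> t = \<one> \<ominus> d \<otimes> r"
  shows "\<exists>t' \<in> carrier R. \<exists>r' \<in> carrier R. s \<otimes> t' = \<one> \<ominus> d [^] Suc M \<otimes> r'"
proof (induction M)
  case 0
  then show ?case using assms by auto
next
  case (Suc M)
  then obtain t' r' where c': "t' \<in> carrier R" "r' \<in> carrier R"
    and st': "s \<otimes> t' = \<one> \<ominus> d [^] Suc M \<otimes> r'" by blast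
  define u where "u = d [^] Suc M"
  have u: "u \<in> carrier R" unfolding u_def using c by simp
  have "s \<otimes> (t' \<oplus> t \<otimes> u \<otimes> r') = s \<otimes> t' \<oplus> (s \<otimes> t) \<otimes> u \<otimes> r'" using c c' u by algebra
  also have "\<dots> = \<one> \<ominus> u \<otimes> d \<otimes> (r \<otimes> r')"
    unfolding st st' u_def[symmetric] using c c' u by algebra
  finally have "s \<otimes> (t' \<oplus> t \<otimes> u \<otimes> r') = \<one> \<ominus> d [^] Suc (Suc M) \<otimes> (r \<otimes> r')"
    by (simp add: u_def)
  then show ?case using c c' u by (intro bexI[of _ "t' \<oplus> t \<otimes> u \<otimes> r'"] bexI[of _ "r \<otimes> r'"]) simp_all
qed

text \<open>Newton's iteration takes care of the power of \<open>d\<close> in \<open>C\<close>.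
  Multiplying the result by \<open>s t'\<close>, which is 1 modulo \<open>d^(M + 1)\<close>, makes
  the error divisible by the factor \<open>s\<close> too and keeps the residue modulo
  \<open>d\<close>.\<close>

lemma approximate_idempotent:
  assumes e: "e \<in> carrier R"
  defines "d \<equiv> e \<otimes> (\<one> \<ominus> e)"
  assumes C: "C \<in> unit_power d"
  shows "\<exists>E \<in> carrier R. \<exists>r \<in> carrier R. \<exists>k \<in> carrier R.
    E = e \<oplus> d \<otimes> r \<and> E \<otimes> E \<ominus> E = C \<otimes> d \<otimes> k"
proof -
  have d: "d \<in> carrier R" unfolding d_def using e by simp
  obtain M s t r where 1: "s \<in> carrier R" "t \<in> carrier R" "r \<in> carrier R"
    and st: "s \<otimes> t = \<one> \<ominus> d \<otimes> r" and C: "C = d [^] (M :: nat) \<otimes> s"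
    using C by (rule unit_powerE)
  define u where "u = d [^] M"
  have u: "u \<in> carrier R" unfolding u_def using d by simp
  obtain E r0 k where 2: "E \<in> carrier R" "r0 \<in> carrier R" "k \<in> carrier R"
    and E: "E = e \<oplus> d \<otimes> r0" and k: "E \<otimes> E \<ominus> E = u \<otimes> d \<otimes> k"
    using approximate_idempotent_pow[OF e, of M] unfolding d_def u_def by auto
  obtain t' r' where 3: "t' \<in> carrier R" "r' \<in> carrier R"
    and st': "s \<otimes> t' = \<one> \<ominus> u \<otimes> d \<otimes> r'"
    using inverse_mod_pow[OF 1 d st, of M] unfolding u_def by auto
  let ?k = "t' \<otimes> (k \<ominus> E \<otimes> E \<otimes> r')"
  let ?r = "r0 \<otimes> (\<one> \<ominus> u \<otimes> d \<otimes> r') \<ominus> e \<otimes> u \<otimes> r'"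
  have "E \<otimes> (s \<otimes> t') \<otimes> (E \<otimes> (s \<otimes> t')) \<ominus> E \<otimes> (s \<otimes> t') =
      s \<otimes> t' \<otimes> (E \<otimes> E \<ominus> E \<oplus> E \<otimes> E \<otimes> (s \<otimes> t' \<ominus> \<one>))"
    using 1 2 3 by algebra
  also have "\<dots> = s \<otimes> t' \<otimes> (u \<otimes> d \<otimes> k \<oplus> E \<otimes> E \<otimes> (\<one> \<ominus> u \<otimes> d \<otimes> r' \<ominus> \<one>))"
    by (simp only: k st')
  also have "\<dots> = u \<otimes> s \<otimes> d \<otimes> (t' \<otimes> (k \<ominus> E \<otimes> E \<otimes> r'))"
    using 1 2 3 d u by algebra
  finally have "E \<otimes> (s \<otimes> t') \<otimes> (E \<otimes> (s \<otimes> t')) \<ominus> E \<otimes> (s \<otimes> t') =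
      C \<otimes> d \<otimes> ?k" unfolding C u_def .
  moreover have "E \<otimes> (s \<otimes> t') = e \<oplus> d \<otimes> ?r"
    unfolding st' unfolding E using e d u 2 3 by algebra
  ultimately show ?thesis using e d u 1 2 3
    by (intro bexI[of _ "E \<otimes> (s \<otimes> t')"] bexI[of _ ?r] bexI[of _ ?k] conjI) simp_all
qed

end

section \<open>Additive polynomials\<close>

context cring begin

text \<open>
  What is needed of a polynomial function that is a sum of terms \<open>c_k x^(p^k)\<close> with \<open>c_0 = l\<close>; the last
  condition holds because \<open>E^p = E\<close> modulo \<open>E^2 - E\<close>.
\<close>
definition additive_poly :: "('a \<Rightarrow> 'a) \<Rightarrow> 'a \<Rightarrow> bool" where
  "additive_poly f l \<longleftrightarrow> l \<in> carrier R \<and> f \<in> carrier R \<rightarrow> carrier R \<and>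
     (\<forall>x \<in> carrier R. \<forall>y \<in> carrier R. f (x \<oplus> y) = f x \<oplus> f y) \<and>
     (\<forall>x \<in> carrier R. \<exists>r \<in> carrier R. f x = x \<otimes> (l \<oplus> x \<otimes> r)) \<and>
     (\<forall>E \<in> carrier R. \<forall>x \<in> carrier R. \<exists>r \<in> carrier R.
        f (E \<otimes> x) = E \<otimes> f x \<oplus> (E \<otimes> E \<ominus> E) \<otimes> r)"

lemma additive_poly_closed:
  "additive_poly f l \<Longrightarrow> x \<in> carrier R \<Longrightarrow> f x \<in> carrier R"
  by (auto simp: additive_poly_def)

lemma additive_poly_add:
  "additive_poly f l \<Longrightarrow> x \<in> carrier R \<Longrightarrow> y \<in> carrier R \<Longrightarrow> f (x \<oplus> y) = f x \<oplus> f y"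
  by (auto simp: additive_poly_def)

lemma additive_poly_linear:
  assumes "additive_poly f l" "x \<in> carrier R"
  obtains r where "r \<in> carrier R" "f x = x \<otimes> (l \<oplus> x \<otimes> r)"
  using assms unfolding additive_poly_def by blast

lemma additive_poly_mult:
  assumes "additive_poly f l" "E \<in> carrier R" "x \<in> carrier R"
  obtains r where "r \<in> carrier R" "f (E \<otimes> x) = E \<otimes> f x \<oplus> (E \<otimes> E \<ominus> E) \<otimes> r"
  using assms unfolding additive_poly_def by blast

lemma additive_poly_id: "additive_poly (\<lambda>x. x) \<one>"
proof -
  have 1: "\<exists>r \<in> carrier R. x = x \<otimes> (\<one> \<oplus> x \<otimes> r)" if "x \<in> carrier R" for x
    using that by (intro bexI[of _ \<zero>]) auto
  have 2: "\<exists>r \<in> carrier R. E \<otimes> x = E \<otimes> x \<oplus> (E \<otimes> E \<ominus> E) \<otimes> r"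
    if "E \<in> carrier R" "x \<in> carrier R" for E x
    using that by (intro bexI[of _ \<zero>]) auto
  show ?thesis using 1 2 by (auto simp: additive_poly_def)
qed

lemma pow_mod_idempotent:
  assumes E: "E \<in> carrier R"
  shows "\<exists>q \<in> carrier R. E [^] Suc n = E \<oplus> (E \<otimes> E \<ominus> E) \<otimes> q"
proof (induction n)
  case 0
  then show ?case using E by (intro bexI[of _ \<zero>]) auto
next
  case (Suc n)
  then obtain q where q: "q \<in> carrier R" "E [^] Suc n = E \<oplus> (E \<otimes> E \<ominus> E) \<otimes> q" by blast
  have "E [^] Suc (Suc n) = (E \<oplus> (E \<otimes> E \<ominus> E) \<otimes> q) \<otimes> E"
    using q(2) by (simp only: nat_pow_Suc)
  also have "\<dots> = E \<oplus> (E \<otimes> E \<ominus> E) \<otimes> (q \<otimes> E \<oplus> \<one>)" using E q(1) by algebra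
  finally show ?case using E q(1) by (intro bexI[of _ "q \<otimes> E \<oplus> \<one>"]) auto
qed

end

section \<open>Additive polynomials in characteristic \<open>p\<close>\<close>

locale char_p_cring = cring +
  fixes p :: nat
  assumes prime_p: "Factorial_Ring.prime p" and char_p: "[p] \<cdot> \<one> = \<zero>"
begin

lemmas frob_add = frobenius_add[OF prime_p char_p]
lemmas frob_minus = frobenius_minus[OF prime_p char_p]

lemma p_minus_one: "Suc (p - 1) = p" "Suc (Suc (p - 2)) = p" "Suc (p - 2) = p - 1"
  using prime_ge_2_nat[OF prime_p] by auto

lemma pow_p: "x [^] p = x [^] (p - 1) \<otimes> x"
  using nat_pow_Suc[of x "p - 1"] by (simp only: p_minus_one)

lemma pow_p_minus_one: "x [^] (p - 1) = x [^] (p - 2) \<otimes> x"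
  using nat_pow_Suc[of x "p - 2"] by (simp only: p_minus_one)

lemma zero_pow_p: "\<zero> [^] p = \<zero>"
  using prime_gt_0_nat[OF prime_p] by (simp add: nat_pow_zero)

text \<open>In characteristic two the sign disappears, and for odd \<open>p\<close> the exponent is
  even.\<close>

lemma uminus_pow_p_minus_one:
  assumes [simp]: "x \<in> carrier R"
  shows "(\<ominus> x) [^] (p - 1) = x [^] (p - 1)"
proof (cases "p = 2")
  case True
  then have "\<one> \<oplus> \<one> = \<zero>" using char_p by (simp add: numeral_2_eq_2)
  then have "\<ominus> \<one> = \<one>" by (simp add: minus_equality)
  then have "\<ominus> x = x" using l_minus[of \<one> x] by simp
  then show ?thesis by simp
next
  case False
  then have "even (p - 1)"
    using prime_odd_nat[OF prime_p] prime_ge_2_nat[OF prime_p] by simp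
  then obtain k where k: "p - 1 = 2 * k" by blast
  have "(\<ominus> x) [^] (2::nat) = x [^] (2::nat)"
    by (simp add: numeral_2_eq_2 l_minus r_minus)
  then show ?thesis unfolding k by (simp add: nat_pow_pow[symmetric])
qed

text \<open>For \<open>c = f(w)^(p-1)\<close> this adjoins \<open>w\<close> to the root space of
  \<open>f\<close>, since the product of all \<open>T - a f(w)\<close> with \<open>a\<close> in the
  prime field is \<open>T^p - f(w)^(p-1) T\<close>. The power \<open>f^p\<close> leaves the linear
  coefficient alone because \<open>p\<close> is at least 2.\<close>

lemma additive_poly_step:
  assumes f: "additive_poly f l" and c: "c \<in> carrier R"
  shows "additive_poly (\<lambda>x. f x [^] p \<ominus> c \<otimes> f x) (\<ominus> (c \<otimes> l))"
proof -
  have l: "l \<in> carrier R" using f by (simp add: additive_poly_def)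
  note fc [simp] = additive_poly_closed[OF f]
  have add: "f (x \<oplus> y) [^] p \<ominus> c \<otimes> f (x \<oplus> y) =
      (f x [^] p \<ominus> c \<otimes> f x) \<oplus> (f y [^] p \<ominus> c \<otimes> f y)"
    if [simp]: "x \<in> carrier R" "y \<in> carrier R" for x y
  proof -
    define a b a' b' where "a = f x" "b = f y" "a' = f x [^] p" "b' = f y [^] p"
    have "a \<in> carrier R" "b \<in> carrier R" "a' \<in> carrier R" "b' \<in> carrier R"
      by (simp_all add: a_b_a'_b'_def)
    then have "(a' \<oplus> b') \<ominus> c \<otimes> (a \<oplus> b) = (a' \<ominus> c \<otimes> a) \<oplus> (b' \<ominus> c \<otimes> b)"
      using c by algebra
    then show ?thesis
      by (simp add: additive_poly_add[OF f] frob_add a_b_a'_b'_def)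
  qed
  have lin: "\<exists>r \<in> carrier R. f x [^] p \<ominus> c \<otimes> f x = x \<otimes> (\<ominus> (c \<otimes> l) \<oplus> x \<otimes> r)"
    if x: "x \<in> carrier R" for x
  proof -
    obtain r where r: "r \<in> carrier R" "f x = x \<otimes> (l \<oplus> x \<otimes> r)"
      using additive_poly_linear[OF f x] .
    \<comment> \<open>Two factors \<open>f x\<close> are split off the \<open>p\<close>-th power, so
      that it contributes a multiple of \<open>x^2\<close>.\<close>
    define w where "w = f x [^] (p - 2)"
    have w: "w \<in> carrier R" unfolding w_def using x by simp
    have "f x [^] p = w \<otimes> f x \<otimes> f x" unfolding w_def pow_p pow_p_minus_one ..
    then have "f x [^] p \<ominus> c \<otimes> f x = (w \<otimes> f x \<ominus> c) \<otimes> f x"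
      using c w x by (simp add: l_distr a_minus_def l_minus)
    also have "\<dots> = (w \<otimes> (x \<otimes> (l \<oplus> x \<otimes> r)) \<ominus> c) \<otimes> (x \<otimes> (l \<oplus> x \<otimes> r))"
      by (simp only: r(2)[symmetric])
    also have "\<dots> = x \<otimes> (\<ominus> (c \<otimes> l) \<oplus> x \<otimes> (w \<otimes> (l \<oplus> x \<otimes> r) \<otimes> (l \<oplus> x \<otimes> r) \<ominus> c \<otimes> r))"
      using x c w l r(1) by algebra
    finally show ?thesis using x c w l r(1) by auto
  qed
  have mul: "\<exists>r \<in> carrier R. f (E \<otimes> x) [^] p \<ominus> c \<otimes> f (E \<otimes> x) =
      E \<otimes> (f x [^] p \<ominus> c \<otimes> f x) \<oplus> (E \<otimes> E \<ominus> E) \<otimes> r"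
    if E: "E \<in> carrier R" and x: "x \<in> carrier R" for E x
  proof -
    define F where "F = E \<otimes> E \<ominus> E"
    have F: "F \<in> carrier R" unfolding F_def using E by simp
    obtain r where r: "r \<in> carrier R" "f (E \<otimes> x) = E \<otimes> f x \<oplus> F \<otimes> r"
      using additive_poly_mult[OF f E x] unfolding F_def .
    \<comment> \<open>Modulo \<open>F\<close> the power \<open>E^p\<close> is \<open>E\<close>, and
      Frobenius sends the old error \<open>F r\<close> to \<open>F^p r^p\<close>, again a multiple
      of \<open>F\<close>.\<close>
    obtain q where q: "q \<in> carrier R" "E [^] p = E \<oplus> F \<otimes> q"
      using pow_mod_idempotent[OF E, of "p - 1"] unfolding F_def p_minus_one by blast
    define a a' F' r' where "a = f x" "a' = f x [^] p" "F' = F [^] (p - 1)" "r' = r [^] p"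
    note defs = a_a'_F'_r'_def
    have cl: "a \<in> carrier R" "a' \<in> carrier R" "F' \<in> carrier R" "r' \<in> carrier R"
      using x F r unfolding defs by simp_all
    have "f (E \<otimes> x) [^] p = E [^] p \<otimes> a' \<oplus> F' \<otimes> F \<otimes> r'"
      unfolding r(2) defs using x E F r(1)
      by (simp add: frob_add nat_pow_distrib pow_p[of F])
    then have "f (E \<otimes> x) [^] p \<ominus> c \<otimes> f (E \<otimes> x) =
        (E \<oplus> F \<otimes> q) \<otimes> a' \<oplus> F' \<otimes> F \<otimes> r' \<ominus> c \<otimes> (E \<otimes> a \<oplus> F \<otimes> r)"
      unfolding q(2) r(2) defs by simp
    also have "\<dots> = E \<otimes> (a' \<ominus> c \<otimes> a) \<oplus> F \<otimes> (q \<otimes> a' \<oplus> F' \<otimes> r' \<ominus> c \<otimes> r)"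
      using cl E F q(1) r(1) c by algebra
    finally have "f (E \<otimes> x) [^] p \<ominus> c \<otimes> f (E \<otimes> x) =
        E \<otimes> (f x [^] p \<ominus> c \<otimes> f x) \<oplus> (E \<otimes> E \<ominus> E) \<otimes> (q \<otimes> a' \<oplus> F' \<otimes> r' \<ominus> c \<otimes> r)"
      unfolding defs F_def .
    then show ?thesis using cl E F q(1) r(1) c by (intro bexI[of _ "q \<otimes> a' \<oplus> F' \<otimes> r' \<ominus> c \<otimes> r"]) auto
  qed
  show ?thesis
    unfolding additive_poly_def using l c add lin mul by auto
qed

text \<open>The two ways of enlarging the root space of an additive polynomial by two vectors agree.\<close>
lemma additive_poly_swap:
  assumes ABZ: "A \<in> carrier R" "B \<in> carrier R" "Z \<in> carrier R"
  shows "(Z [^] p \<ominus> A [^] (p - 1) \<otimes> Z) [^] p \<ominus>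
      (B [^] p \<ominus> A [^] (p - 1) \<otimes> B) [^] (p - 1) \<otimes> (Z [^] p \<ominus> A [^] (p - 1) \<otimes> Z) =
    (Z [^] p \<ominus> B [^] (p - 1) \<otimes> Z) [^] p \<ominus>
      (A [^] p \<ominus> B [^] (p - 1) \<otimes> A) [^] (p - 1) \<otimes> (Z [^] p \<ominus> B [^] (p - 1) \<otimes> Z)"
proof -
  define u w where "u = A [^] (p - 1)" and "w = B [^] (p - 1)"
  define u' w' Z' Z'' where "u' = u [^] p" "w' = w [^] p" "Z' = Z [^] p" "Z'' = Z' [^] p"
  \<comment> \<open>The common factor of the two outer coefficients, which become \<open>w t\<close>
    and \<open>u t\<close>. The sign between \<open>w - u\<close> and \<open>u - w\<close> is lost
    in the power \<open>p - 1\<close>.\<close>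
  define t where "t = (w \<ominus> u) [^] (p - 1)"
  have c [simp]: "u \<in> carrier R" "w \<in> carrier R" unfolding u_def w_def using ABZ by simp_all
  have c' [simp]: "u' \<in> carrier R" "w' \<in> carrier R" "Z' \<in> carrier R" "Z'' \<in> carrier R"
    unfolding u'_w'_Z'_Z''_def using ABZ c by simp_all
  have t: "t \<in> carrier R" unfolding t_def by simp
  have "w \<ominus> u = \<ominus> (u \<ominus> w)" using c by algebra
  then have t': "t = (u \<ominus> w) [^] (p - 1)"
    unfolding t_def by (simp only: uminus_pow_p_minus_one minus_closed c)
  have tp: "t \<otimes> (w \<ominus> u) = w' \<ominus> u'"
    unfolding t_def u'_w'_Z'_Z''_def by (simp only: pow_p[symmetric] frob_minus c)
  have "B [^] p \<ominus> u \<otimes> B = B \<otimes> (w \<ominus> u)"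
    using ABZ c unfolding pow_p w_def[symmetric] by (simp add: a_minus_def r_distr r_minus m_comm)
  then have 1: "(B [^] p \<ominus> u \<otimes> B) [^] (p - 1) = w \<otimes> t"
    unfolding t_def w_def using ABZ by (simp add: nat_pow_distrib u_def)
  have "A [^] p \<ominus> w \<otimes> A = A \<otimes> (u \<ominus> w)"
    using ABZ c unfolding pow_p u_def[symmetric] by (simp add: a_minus_def r_distr r_minus m_comm)
  then have 2: "(A [^] p \<ominus> w \<otimes> A) [^] (p - 1) = u \<otimes> t"
    unfolding t' u_def using ABZ by (simp add: nat_pow_distrib w_def)
  have 3: "(Z [^] p \<ominus> u \<otimes> Z) [^] p = Z'' \<ominus> u' \<otimes> Z'" "(Z [^] p \<ominus> w \<otimes> Z) [^] p = Z'' \<ominus> w' \<otimes> Z'"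
    unfolding u'_w'_Z'_Z''_def using ABZ c by (simp_all add: frob_minus nat_pow_distrib)
  \<comment> \<open>The two sides differ only in the coefficient of \<open>Z^p\<close>, by
    \<open>w^p - u^p - t (w - u)\<close>, and this is zero by Frobenius.\<close>
  have "Z'' \<ominus> u' \<otimes> Z' \<ominus> (w \<otimes> t) \<otimes> (Z' \<ominus> u \<otimes> Z) =
      Z'' \<ominus> w' \<otimes> Z' \<ominus> (u \<otimes> t) \<otimes> (Z' \<ominus> w \<otimes> Z) \<oplus> (w' \<ominus> u' \<ominus> t \<otimes> (w \<ominus> u)) \<otimes> Z'"
    using ABZ c c' t by algebra
  also have "\<dots> = Z'' \<ominus> w' \<otimes> Z' \<ominus> (u \<otimes> t) \<otimes> (Z' \<ominus> w \<otimes> Z)"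
    unfolding tp using ABZ c c' t by algebra
  finally show ?thesis
    unfolding u_def[symmetric] w_def[symmetric] 1 2 3 by (simp only: u'_w'_Z'_Z''_def)
qed

end

section \<open>Artin-Schreier systems\<close>

context char_p_cring begin

text \<open>Here \<open>f (d^N)\<close> is \<open>d^N (l + d^N r)\<close>, and for large
  \<open>N\<close> the second factor is a harmless perturbation of \<open>l\<close>, whatever
  \<open>r\<close> is.\<close>

lemma eventually_additive_poly_unit_power:
  assumes f: "additive_poly f l" and l: "l \<in> unit_power d" and d: "d \<in> carrier R"
  shows "\<forall>\<^sub>F N in sequentially. f (d [^] (N :: nat)) \<in> unit_power d"
  using unit_power_perturb[OF d l]
proof eventually_elim
  case (elim N)
  have dN: "d [^] N \<in> carrier R" using d by simp
  obtain r where "r \<in> carrier R" "f (d [^] N) = d [^] N \<otimes> (l \<oplus> d [^] N \<otimes> r)"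
    using additive_poly_linear[OF f dN] .
  then show ?case
    using elim unit_power_mult[OF d unit_power_pow[OF d, of N]] by simp
qed

text \<open>With \<open>V\<close> and \<open>H\<close> as above, \<open>y = P_V\<close>, \<open>z i = P_H\<close> and \<open>c i = P_H(v_i)\<close>.\<close>
definition artin_schreier_system ::
    "'a \<Rightarrow> nat \<Rightarrow> ('a \<Rightarrow> 'a) \<Rightarrow> (nat \<Rightarrow> 'a \<Rightarrow> 'a) \<Rightarrow> (nat \<Rightarrow> 'a) \<Rightarrow> (nat \<Rightarrow> 'a) \<Rightarrow> bool" where
  "artin_schreier_system d n y z c v \<longleftrightarrow> (\<exists>l \<in> unit_power d. additive_poly y l) \<and>
     (\<forall>i<n. (\<exists>l \<in> unit_power d. additive_poly (z i) l) \<and> c i \<in> unit_power d \<and> v i \<in> carrier R \<and>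
       (\<forall>j<n. z i (v j) = (if i = j then c i else \<zero>)) \<and>
       (\<forall>x \<in> carrier R. y x = z i x [^] p \<ominus> c i [^] (p - 1) \<otimes> z i x))"

text \<open>The new vector is \<open>w = d^N\<close> for a large \<open>N\<close>. The old
  hyperplanes are enlarged by \<open>w\<close>, and the old space \<open>V\<close> becomes the
  hyperplane that belongs to \<open>w\<close>.\<close>

lemma artin_schreier_system_Suc:
  assumes d: "d \<in> carrier R" and sys: "artin_schreier_system d n y z c v"
  shows "\<exists>y z c v. artin_schreier_system d (Suc n) y z c v"
proof -
  obtain ly where ly: "ly \<in> unit_power d" "additive_poly y ly"
    using sys by (auto simp: artin_schreier_system_def)
  obtain lz where lz: "\<And>i. i < n \<Longrightarrow> lz i \<in> unit_power d" "\<And>i. i < n \<Longrightarrow> additive_poly (z i) (lz i)"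
    using sys unfolding artin_schreier_system_def by metis
  have c: "c i \<in> unit_power d" and v: "v i \<in> carrier R"
    and zv: "\<And>j. j < n \<Longrightarrow> z i (v j) = (if i = j then c i else \<zero>)"
    and yz: "\<And>x. x \<in> carrier R \<Longrightarrow> y x = z i x [^] p \<ominus> c i [^] (p - 1) \<otimes> z i x" if "i < n" for i
    using sys that by (auto simp: artin_schreier_system_def)
  note up_carrier = unit_power_carrier[OF d]
  have cc: "c i \<in> carrier R" if "i < n" for i using c[OF that] up_carrier by blast
  have "\<forall>\<^sub>F N in sequentially. y (d [^] N) \<in> unit_power d \<and>
      (\<forall>i\<in>{..<n}. z i (d [^] N) \<in> unit_power d \<and>
         (\<forall>r \<in> carrier R. c i [^] (p - 1) \<oplus> d [^] (N :: nat) \<otimes> r \<in> unit_power d))"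
    using ly lz c d
    by (auto intro!: eventually_conj eventually_ball_finite eventually_additive_poly_unit_power
        unit_power_perturb unit_power_nat_pow)
  \<comment> \<open>One exponent has to make \<open>P_V(w)\<close> and every \<open>P_H(w)\<close> a
    denominator and has to allow \<open>c i^(p-1)\<close> to be changed by any multiple of
    \<open>w\<close>.\<close>
  then obtain N where "y (d [^] (N :: nat)) \<in> unit_power d \<and>
      (\<forall>i\<in>{..<n}. z i (d [^] N) \<in> unit_power d \<and>
         (\<forall>r \<in> carrier R. c i [^] (p - 1) \<oplus> d [^] N \<otimes> r \<in> unit_power d))"
    by (auto simp: eventually_sequentially)
  moreover define w where "w = d [^] N"
  ultimately have yw: "y w \<in> unit_power d"
    and zw: "\<And>i. i < n \<Longrightarrow> z i w \<in> unit_power d"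
    and cN: "\<And>i r. i < n \<Longrightarrow> r \<in> carrier R \<Longrightarrow> c i [^] (p - 1) \<oplus> w \<otimes> r \<in> unit_power d"
    by auto
  have w: "w \<in> carrier R" unfolding w_def using d by simp
  have zc: "z i x \<in> carrier R" if "i < n" "x \<in> carrier R" for i x
    using additive_poly_closed[OF lz(2)] that by blast
  have yc: "y x \<in> carrier R" if "x \<in> carrier R" for x
    using additive_poly_closed[OF ly(2)] that by blast
  \<comment> \<open>Adjoining \<open>w\<close> replaces a polynomial \<open>g\<close> by
    \<open>g^p - g(w)^(p-1) g\<close>. For the old indices, \<open>c' i\<close> is the value of
    \<open>z' i\<close> at \<open>v i\<close>.\<close>
  define y' where "y' x = y x [^] p \<ominus> y w [^] (p - 1) \<otimes> y x" for x
  define z' where "z' i = (if i < n then \<lambda>x. z i x [^] p \<ominus> z i w [^] (p - 1) \<otimes> z i x else y)" for i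
  define c' where "c' i = (if i < n then c i [^] p \<ominus> z i w [^] (p - 1) \<otimes> c i else y w)" for i
  define v' where "v' i = (if i < n then v i else w)" for i
  have y': "\<exists>l \<in> unit_power d. additive_poly y' l"
    unfolding y'_def
    using additive_poly_step[OF ly(2), of "y w [^] (p - 1)"] yc w
      unit_power_uminus[OF d unit_power_mult[OF d unit_power_nat_pow[OF d yw] ly(1)]]
    by blast
  have z': "\<exists>l \<in> unit_power d. additive_poly (z' i) l" if "i < Suc n" for i
  proof (cases "i < n")
    case True
    then show ?thesis
      unfolding z'_def
      using additive_poly_step[OF lz(2), of i "z i w [^] (p - 1)"] zc w
        unit_power_uminus[OF d unit_power_mult[OF d unit_power_nat_pow[OF d zw] lz(1)]]
      by (simp, blast)
  next
    case False
    then show ?thesis unfolding z'_def using ly by auto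
  qed
  have c': "c' i \<in> unit_power d" if "i < Suc n" for i
  proof (cases "i < n")
    case True
    \<comment> \<open>The new constant is \<open>c i (c i^(p-1) - z i w^(p-1))\<close>. As
      \<open>w\<close> divides \<open>z i w\<close>, the bracket is one of the perturbations
      foreseen in the choice of \<open>N\<close>.\<close>
    obtain r where r: "r \<in> carrier R" "z i w = w \<otimes> (lz i \<oplus> w \<otimes> r)"
      using additive_poly_linear[OF lz(2)[OF True] w] .
    define q where "q = \<ominus> (z i w [^] (p - 2) \<otimes> (lz i \<oplus> w \<otimes> r))"
    have lzc: "lz i \<in> carrier R" using lz(1)[OF True] up_carrier by blast
    have q: "q \<in> carrier R" unfolding q_def using r(1) lzc w zc[OF True w] by simp
    have "z i w [^] (p - 1) = z i w [^] (p - 2) \<otimes> z i w" by (rule pow_p_minus_one)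
    also have "\<dots> = z i w [^] (p - 2) \<otimes> (w \<otimes> (lz i \<oplus> w \<otimes> r))" using r(2) by simp
    also have "\<dots> = \<ominus> (w \<otimes> q)"
      unfolding q_def using r(1) lzc w zc[OF True w] by (simp add: r_minus m_lcomm)
    finally have "c i [^] (p - 1) \<ominus> z i w [^] (p - 1) = c i [^] (p - 1) \<oplus> w \<otimes> q"
      using w q cc[OF True] by (simp add: a_minus_def)
    moreover have "c' i = (c i [^] (p - 1) \<ominus> z i w [^] (p - 1)) \<otimes> c i"
      using True zc w cc unfolding c'_def pow_p[of "c i"] by (simp add: a_minus_def l_distr l_minus)
    ultimately show ?thesis
      using unit_power_mult[OF d cN[OF True q] c[OF True]] by simp
  next
    case False
    then show ?thesis unfolding c'_def using yw by simp
  qed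
  have zero: "z' i (v' j) = (if i = j then c' i else \<zero>)" if ij: "i < Suc n" "j < Suc n" for i j
  proof -
    have pp: "x [^] p \<ominus> x [^] (p - 1) \<otimes> x = \<zero>" if "x \<in> carrier R" for x
      using that unfolding pow_p by (simp add: a_minus_def r_neg)
    have z0: "\<zero> [^] p \<ominus> x \<otimes> \<zero> = \<zero>" if "x \<in> carrier R" for x
      using that by (simp add: zero_pow_p a_minus_def)
    consider "i < n" "j < n" | "i < n" "j = n" | "i = n" "j < n" | "i = n" "j = n"
      using ij by linarith
    then show ?thesis
    proof cases
      case 1
      then show ?thesis
        using z0[of "z i w [^] (p - 1)"] zc w unfolding z'_def v'_def c'_def by (simp add: zv del: r_null)
    next
      case 2
      then show ?thesis using pp[OF zc[OF _ w]] unfolding z'_def v'_def by simp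
    next
      case 3
      then show ?thesis using pp[OF cc] unfolding z'_def v'_def by (simp add: yz v zv)
    next
      case 4
      then show ?thesis unfolding z'_def v'_def c'_def by simp
    qed
  qed
  have rel: "y' x = z' i x [^] p \<ominus> c' i [^] (p - 1) \<otimes> z' i x" if "i < Suc n" "x \<in> carrier R" for i x
  proof (cases "i < n")
    case True
    \<comment> \<open>Adjoining \<open>v i\<close> and then \<open>w\<close> to the hyperplane
      agrees with the opposite order: the swap identity for \<open>A = c i\<close>,
      \<open>B = z i w\<close> and \<open>Z = z i x\<close>.\<close>
    then show ?thesis
      unfolding y'_def z'_def c'_def
      using additive_poly_swap[OF cc[OF True] zc[OF True w] zc[OF True that(2)]]
        yz[OF True w] yz[OF True that(2)] by simp
  next
    case False
    then show ?thesis unfolding y'_def z'_def c'_def by simp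
  qed
  have v': "v' i \<in> carrier R" for i using v w by (simp add: v'_def)
  have "artin_schreier_system d (Suc n) y' z' c' v'"
    unfolding artin_schreier_system_def using y' z' c' v' zero rel by blast
  then show ?thesis by blast
qed

lemma ex_artin_schreier_system:
  assumes "d \<in> carrier R"
  shows "\<exists>y z c v. artin_schreier_system d n y z c v"
proof (induction n)
  case 0
  \<comment> \<open>The zero space has the identity as its polynomial.\<close>
  show ?case
    using additive_poly_id unit_power_one[OF assms] unfolding artin_schreier_system_def by blast
next
  case (Suc n)
  then show ?case using artin_schreier_system_Suc[OF assms] by blast
qed

text \<open>Take for \<open>w\<close> the sum of the \<open>E v_j\<close> with \<open>j\<close> in
  \<open>S\<close>. The deviation of \<open>z i (E v_j)\<close> from \<open>E z i (v_j)\<close> is a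
  multiple of \<open>E^2 - E\<close>, hence of \<open>C d\<close> and so of \<open>c i d\<close>;
  after division by \<open>c i\<close> it disappears modulo \<open>d\<close>.\<close>

lemma artin_schreier_system_weights:
  assumes d: "d \<in> carrier R" and sys: "artin_schreier_system d n y z c v"
    and C: "C \<in> carrier R" "\<forall>i \<in> {..<n}. \<exists>q \<in> carrier R. C = c i \<otimes> q"
    and E: "E \<in> carrier R" "k \<in> carrier R" "E \<otimes> E \<ominus> E = C \<otimes> d \<otimes> k"
    and S: "S \<subseteq> {..<n}"
  shows "\<exists>w \<in> carrier R. \<forall>i<n. \<exists>q \<in> carrier R.
    z i w = c i \<otimes> ((if i \<in> S then E else \<zero>) \<oplus> d \<otimes> q)"
  using finite_subset[OF S finite_lessThan] S
proof (induction S rule: finite_induct)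
  case empty
  have "z i \<zero> = c i \<otimes> ((if i \<in> {} then E else \<zero>) \<oplus> d \<otimes> \<zero>)" if i: "i < n" for i
  proof -
    obtain l where l: "additive_poly (z i) l"
      using i sys by (auto simp: artin_schreier_system_def)
    have "c i \<in> carrier R" "l \<in> carrier R"
      using i sys unit_power_carrier[OF d] l by (auto simp: artin_schreier_system_def additive_poly_def)
    moreover obtain r where "r \<in> carrier R" "z i \<zero> = \<zero> \<otimes> (l \<oplus> \<zero> \<otimes> r)"
      using additive_poly_linear[OF l zero_closed] .
    ultimately show ?thesis using d by simp
  qed
  then show ?case by blast
next
  case (insert j S)
  then obtain w where w: "w \<in> carrier R"
    and wS: "\<And>i. i < n \<Longrightarrow> \<exists>q \<in> carrier R. z i w = c i \<otimes> ((if i \<in> S then E else \<zero>) \<oplus> d \<otimes> q)"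
    by auto
  have j: "j < n" "j \<notin> S" using insert by auto
  have v: "v j \<in> carrier R" using j sys by (auto simp: artin_schreier_system_def)
  have "\<exists>q \<in> carrier R. z i (w \<oplus> E \<otimes> v j) =
      c i \<otimes> ((if i \<in> insert j S then E else \<zero>) \<oplus> d \<otimes> q)" if i: "i < n" for i
  proof -
    obtain l where l: "additive_poly (z i) l"
      using i sys by (auto simp: artin_schreier_system_def)
    have ci: "c i \<in> carrier R"
      using i sys unit_power_carrier[OF d] by (auto simp: artin_schreier_system_def)
    obtain q where q: "q \<in> carrier R" "z i w = c i \<otimes> ((if i \<in> S then E else \<zero>) \<oplus> d \<otimes> q)"
      using wS[OF i] by blast
    obtain r where r: "r \<in> carrier R"
      "z i (E \<otimes> v j) = E \<otimes> z i (v j) \<oplus> (E \<otimes> E \<ominus> E) \<otimes> r"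
      using additive_poly_mult[OF l E(1) v] .
    obtain g where g: "g \<in> carrier R" "C = c i \<otimes> g" using C i by blast
    have zv: "z i (v j) = (if i = j then c i else \<zero>)"
      using i j sys by (auto simp: artin_schreier_system_def)
    let ?q = "q \<oplus> g \<otimes> k \<otimes> r"
    have "z i (w \<oplus> E \<otimes> v j) = c i \<otimes> ((if i \<in> S then E else \<zero>) \<oplus> d \<otimes> q) \<oplus>
        (E \<otimes> (if i = j then c i else \<zero>) \<oplus> c i \<otimes> g \<otimes> d \<otimes> k \<otimes> r)"
      using additive_poly_add[OF l w, of "E \<otimes> v j"] E(1) v q(2) r(2) by (simp add: zv E(3) g(2))
    also have "\<dots> = c i \<otimes> ((if i \<in> insert j S then E else \<zero>) \<oplus> d \<otimes> ?q)"
    proof (cases "i = j")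
      case True
      have "c i \<otimes> (\<zero> \<oplus> d \<otimes> q) \<oplus> (E \<otimes> a \<oplus> a \<otimes> g \<otimes> d \<otimes> k \<otimes> r) = a \<otimes> (E \<oplus> d \<otimes> ?q)"
        if "a \<in> carrier R" "c i = a" for a
        unfolding that(2) using that(1) d q(1) g(1) E(1,2) r(1)
        by algebra
      from this[OF ci refl] show ?thesis using True j(2) by simp
    next
      case False
      have "a \<otimes> (s \<oplus> d \<otimes> q) \<oplus> (E \<otimes> \<zero> \<oplus> a \<otimes> g \<otimes> d \<otimes> k \<otimes> r) = a \<otimes> (s \<oplus> d \<otimes> ?q)"
        if "a \<in> carrier R" "s \<in> carrier R" for a s
        using that d q(1) g(1) E(1,2) r(1) by algebra
      from this[OF ci, of "if i \<in> S then E else \<zero>"] show ?thesis using False E(1) by simp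
    qed
    finally show ?thesis using q(1) g(1) E(2) r(1) by blast
  qed
  moreover have "w \<oplus> E \<otimes> v j \<in> carrier R" using w E v by simp
  ultimately show ?case by blast
qed

end

text \<open>The coefficients are the \<open>c i^p\<close> of a system and \<open>y\<close> is
  \<open>P_V(w)\<close>. If \<open>z i w = c i x\<close>, the relation of the system reads
  \<open>c i^p (x^p - x) = y\<close>. The choice of \<open>w\<close> makes \<open>x\<close>
  congruent to \<open>e\<close> for \<open>i\<close> in \<open>S\<close> and to 0 otherwise, and
  only the second case admits a solution in \<open>(d)\<close>.\<close>

lemma (in domain) artin_schreier_shatters:
  assumes p: "Factorial_Ring.prime (p :: nat)" and char: "[p] \<cdot> \<one> = \<zero>"
    and e: "e \<in> carrier R" "e \<notin> Units R" "\<one> \<ominus> e \<notin> Units R"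
  defines "d \<equiv> e \<otimes> (\<one> \<ominus> e)"
  shows "\<exists>a. (\<forall>i<n. a i \<in> carrier R) \<and> (\<forall>S \<subseteq> {..<n :: nat}. \<exists>y \<in> carrier R. \<forall>i<n.
    (\<exists>r \<in> carrier R. a i \<otimes> ((d \<otimes> r) [^] p \<ominus> d \<otimes> r) = y) \<longleftrightarrow> i \<notin> S)"
proof -
  interpret char_p_cring R p
    by (unfold_locales) (use p char in auto)
  have d: "d \<in> carrier R" unfolding d_def using e by simp
  have unit: "x \<in> Units R" if "x \<in> carrier R" "y \<in> carrier R" "x \<otimes> y = \<one>" for x y
    using that m_comm[OF that(1,2)] by (auto simp: Units_def)
  have nz: "g \<noteq> \<zero>" if "g \<in> unit_power d" for g
  proof -
    have "\<one> \<in> Units R" by simp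
    then have "e \<noteq> \<zero>" "\<one> \<ominus> e \<noteq> \<zero>" using e(1,3) minus_zeroI[of \<one> e] e(2) by (auto simp: a_minus_def)
    then have d0: "d \<noteq> \<zero>" unfolding d_def using e(1) integral[of e "\<one> \<ominus> e"] by auto
    obtain M s t r where 1: "s \<in> carrier R" "t \<in> carrier R" "r \<in> carrier R"
      and st: "s \<otimes> t = \<one> \<ominus> d \<otimes> r" and g: "g = d [^] (M :: nat) \<otimes> s"
      using \<open>g \<in> unit_power d\<close> by (rule unit_powerE)
    \<comment> \<open>If \<open>s\<close> vanished, \<open>d\<close> would divide 1 and
      \<open>e\<close> would be a unit.\<close>
    have "s \<noteq> \<zero>"
    proof
      assume "s = \<zero>"
      then have "\<one> \<ominus> d \<otimes> r = \<zero>" using st[symmetric] 1 by simp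
      then have "\<one> = d \<otimes> r" by (rule minus_zeroI) (use 1 d in auto)
      also have "\<dots> = e \<otimes> ((\<one> \<ominus> e) \<otimes> r)" using e(1) 1 by (simp add: d_def m_assoc)
      finally have "e \<otimes> ((\<one> \<ominus> e) \<otimes> r) = \<one>" by (rule sym)
      then show False using unit[of e "(\<one> \<ominus> e) \<otimes> r"] e(1,2) 1(3) by simp
    qed
    moreover have "d [^] M \<noteq> \<zero>"
      using d d0 by (induction M) (auto simp: integral_iff)
    ultimately show ?thesis unfolding g using 1 d by (simp add: integral_iff)
  qed
  obtain y z c v where sys: "artin_schreier_system d n y z c v"
    using ex_artin_schreier_system[OF d] by blast
  have c: "c i \<in> unit_power d" if "i < n" for i
    using sys that by (auto simp: artin_schreier_system_def)
  have cc: "c i \<in> carrier R" if "i < n" for i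
    using c[OF that] unit_power_carrier[OF d] by blast
  \<comment> \<open>The error of \<open>E\<close> has to remain a multiple of \<open>d\<close> after
    division by any \<open>c i\<close>.\<close>
  obtain C where C: "C \<in> unit_power d" "\<forall>i \<in> {..<n}. \<exists>q \<in> carrier R. C = c i \<otimes> q"
    using unit_power_finprod[OF d finite_lessThan[of n], of c] c by blast
  have CC: "C \<in> carrier R" using C(1) unit_power_carrier[OF d] by blast
  obtain E r0 k where E: "E \<in> carrier R" "r0 \<in> carrier R" "k \<in> carrier R"
    "E = e \<oplus> d \<otimes> r0" "E \<otimes> E \<ominus> E = C \<otimes> d \<otimes> k"
    using approximate_idempotent[OF e(1) C(1)[unfolded d_def]] unfolding d_def by blast
  \<comment> \<open>In a domain \<open>u^p = u\<close> leaves \<open>u = 0\<close> or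
    \<open>u^(p-1) = 1\<close>. In the first case cancelling \<open>e\<close> shows that
    \<open>1 - e\<close> is a unit; in the second \<open>e\<close> is a unit because it divides
    \<open>u\<close>.\<close>
  have no_lift: False if u: "q \<in> carrier R" "u = e \<oplus> d \<otimes> q" "u [^] p = u" for u q
  proof -
    have uc: "u \<in> carrier R" using u d e by simp
    have "(u [^] (p - 1) \<ominus> \<one>) \<otimes> u = \<zero>"
      using u(3) uc unfolding pow_p by (simp add: a_minus_def l_distr l_minus r_neg)
    then consider "u = \<zero>" | "u [^] (p - 1) = \<one>"
      using uc minus_zeroI[of "u [^] (p - 1)" \<one>] by (auto simp: integral_iff)
    then show False
    proof cases
      case 1
      have "e \<otimes> (\<one> \<ominus> (\<one> \<ominus> e) \<otimes> (\<ominus> q)) = e \<oplus> e \<otimes> (\<one> \<ominus> e) \<otimes> q"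
        using e(1) u(1) by algebra
      also have "\<dots> = \<zero>" using 1 u(2) by (simp add: d_def)
      finally have "e \<otimes> (\<one> \<ominus> (\<one> \<ominus> e) \<otimes> (\<ominus> q)) = \<zero>" .
      moreover have "e \<noteq> \<zero>" using e(1,3) by (auto simp: a_minus_def)
      ultimately have "\<one> \<ominus> (\<one> \<ominus> e) \<otimes> (\<ominus> q) = \<zero>" using e(1) u(1) by (simp add: integral_iff)
      then have "\<one> = (\<one> \<ominus> e) \<otimes> (\<ominus> q)" by (rule minus_zeroI) (use e(1) u(1) in auto)
      then show False using unit[of "\<one> \<ominus> e" "\<ominus> q"] e(1,3) u(1) by simp
    next
      case 2
      have "x \<otimes> (e \<oplus> e \<otimes> (\<one> \<ominus> e) \<otimes> q) = e \<otimes> ((\<one> \<oplus> (\<one> \<ominus> e) \<otimes> q) \<otimes> x)"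
        if "x \<in> carrier R" for x
        using that e(1) u(1) by algebra
      then have "u [^] (p - 2) \<otimes> u = e \<otimes> ((\<one> \<oplus> (\<one> \<ominus> e) \<otimes> q) \<otimes> u [^] (p - 2))"
        using uc unfolding u(2) d_def by blast
      then have "e \<otimes> ((\<one> \<oplus> (\<one> \<ominus> e) \<otimes> q) \<otimes> u [^] (p - 2)) = \<one>"
        using 2 unfolding pow_p_minus_one by simp
      from unit[OF e(1) _ this] show False using e(1,2) u(1) uc by simp
    qed
  qed
  show ?thesis
  proof (intro exI[of _ "\<lambda>i. c i [^] p"] conjI allI impI)
    fix i assume "i < n"
    then show "c i [^] p \<in> carrier R" using cc by simp
  next
    fix S assume S: "S \<subseteq> {..<n}"
    obtain w where w: "w \<in> carrier R" and wS: "\<And>i. i < n \<Longrightarrow> \<exists>q \<in> carrier R.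
        z i w = c i \<otimes> ((if i \<in> S then E else \<zero>) \<oplus> d \<otimes> q)"
      using artin_schreier_system_weights[OF d sys CC C(2) E(1,3,5) S] by blast
    have ywc: "y w \<in> carrier R"
      using sys w additive_poly_closed by (auto simp: artin_schreier_system_def)
    have "(\<exists>r \<in> carrier R. c i [^] p \<otimes> ((d \<otimes> r) [^] p \<ominus> d \<otimes> r) = y w) \<longleftrightarrow> i \<notin> S"
      if i: "i < n" for i
    proof -
      obtain q where q: "q \<in> carrier R" "z i w = c i \<otimes> ((if i \<in> S then E else \<zero>) \<oplus> d \<otimes> q)"
        using wS[OF i] by blast
      define x where "x = (if i \<in> S then E else \<zero>) \<oplus> d \<otimes> q"
      have x: "x \<in> carrier R" unfolding x_def using E(1) d q(1) by simp
      have "y w = z i w [^] p \<ominus> c i [^] (p - 1) \<otimes> z i w"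
        using sys i w by (auto simp: artin_schreier_system_def)
      also have "\<dots> = c i [^] p \<otimes> (x [^] p \<ominus> x)"
        unfolding q(2) x_def[symmetric] using cc[OF i] x
        by (simp add: nat_pow_distrib a_minus_def r_distr r_minus pow_p[of "c i"] m_assoc)
      finally have yw: "y w = c i [^] p \<otimes> (x [^] p \<ominus> x)" .
      have c0: "c i [^] p \<noteq> \<zero>"
        using nz[OF unit_power_nat_pow[OF d c[OF i]]] .
      show ?thesis
      proof
        assume "i \<notin> S"
        then have "x = d \<otimes> q" unfolding x_def using d q(1) by simp
        then show "\<exists>r \<in> carrier R. c i [^] p \<otimes> ((d \<otimes> r) [^] p \<ominus> d \<otimes> r) = y w"
          using q(1) yw by auto
      next
        assume "\<exists>r \<in> carrier R. c i [^] p \<otimes> ((d \<otimes> r) [^] p \<ominus> d \<otimes> r) = y w"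
        then obtain r where r: "r \<in> carrier R"
          "c i [^] p \<otimes> ((d \<otimes> r) [^] p \<ominus> d \<otimes> r) = c i [^] p \<otimes> (x [^] p \<ominus> x)"
          unfolding yw by blast
        then have eq: "(d \<otimes> r) [^] p \<ominus> d \<otimes> r = x [^] p \<ominus> x"
          using m_lcancel[OF c0, of "(d \<otimes> r) [^] p \<ominus> d \<otimes> r" "x [^] p \<ominus> x"] cc[OF i] x d by simp
        show "i \<notin> S"
        proof
          assume "i \<in> S"
          then have x': "x = e \<oplus> d \<otimes> r0 \<oplus> d \<otimes> q" unfolding x_def using E(4) by simp
          define a a' b b' where "a = d \<otimes> r" "a' = (d \<otimes> r) [^] p" "b = x" "b' = x [^] p"
          have ab: "a \<in> carrier R" "a' \<in> carrier R" "b \<in> carrier R" "b' \<in> carrier R"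
            unfolding a_a'_b_b'_def using d r(1) x by simp_all
          \<comment> \<open>By additivity of Frobenius, the difference of two solutions of the same
            equation is fixed by the \<open>p\<close>-th power.\<close>
          have "b' \<ominus> a' = (b \<ominus> a) \<oplus> ((b' \<ominus> b) \<ominus> (a' \<ominus> a))"
            using ab by algebra
          also have "\<dots> = b \<ominus> a"
          proof -
            have "a' \<ominus> a = b' \<ominus> b" using eq unfolding a_a'_b_b'_def .
            then show ?thesis using ab by (simp only: minus_closed) (simp add: a_minus_def r_neg)
          qed
          finally have "(x \<ominus> d \<otimes> r) [^] p = x \<ominus> d \<otimes> r"
            unfolding a_a'_b_b'_def using x d r(1) by (simp add: frob_minus)
          moreover have "x \<ominus> d \<otimes> r = e \<oplus> d \<otimes> (r0 \<oplus> q \<ominus> r)"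
            unfolding x' using d e(1) r(1) q(1) E(2) by algebra
          ultimately show False
            using no_lift[of "r0 \<oplus> q \<ominus> r" "x \<ominus> d \<otimes> r"] E(2) q(1) r(1) by simp
        qed
      qed
    qed
    then show "\<exists>y \<in> carrier R. \<forall>i<n.
      (\<exists>r \<in> carrier R. c i [^] p \<otimes> ((d \<otimes> r) [^] p \<ominus> d \<otimes> r) = y) \<longleftrightarrow> i \<notin> S"
      using ywc by blast
  qed
qed

section \<open>A formula for the solvability of Artin-Schreier equations\<close>

primrec tpow :: "rterm \<Rightarrow> nat \<Rightarrow> rterm" where
  "tpow t 0 = TOne"
| "tpow t (Suc n) = TMul (tpow t n) t"

lemma term_val_tpow: "term_val R e (tpow t n) = term_val R e t [^]\<^bsub>R\<^esub> n"
  by (induction n) auto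

lemma term_vars_tpow: "term_vars (tpow t n) \<subseteq> term_vars t"
  by (induction n) auto

lemma (in domain) NIP_imp_unit_or_unit:
  assumes p: "Factorial_Ring.prime (p :: nat)" and char: "[p] \<cdot> \<one> = \<zero>"
    and NIP: "NIP_ring R" and e: "e \<in> carrier R"
  shows "e \<in> Units R \<or> \<one> \<ominus> e \<in> Units R"
proof (rule ccontr)
  assume nu: "\<not> (e \<in> Units R \<or> \<one> \<ominus> e \<in> Units R)"
  define d where "d = e \<otimes> (\<one> \<ominus> e)"
  have d: "d \<in> carrier R" unfolding d_def using e by simp
  \<comment> \<open>Variables 0 and 1 carry \<open>a\<close> and \<open>d\<close>, variable 2
    carries \<open>y\<close>, and 3 is bound to \<open>r\<close>; so the two tuples have lengths 2
    and 1.\<close>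
  define t where "t = TMul (TVar 1) (TVar 3)"
  define \<phi> where "\<phi> = FEx 3 (FEq (TMul (TVar 0) (TAdd (tpow t p) (TNeg t))) (TVar 2))"
  have fv: "free_vars \<phi> \<subseteq> {..<2 + 1}"
    using term_vars_tpow[of t p] by (auto simp: \<phi>_def t_def)
  have sat: "sat R (join_env 2 x y) \<phi> \<longleftrightarrow>
      (\<exists>r \<in> carrier R. x 0 \<otimes> ((x 1 \<otimes> r) [^] p \<ominus> x 1 \<otimes> r) = y 0)" for x y
    by (simp add: \<phi>_def t_def term_val_tpow join_env_def a_minus_def)
  have "has_IP (complete_theory R) 2 1 \<phi>"
    unfolding has_IP_complete_theory_iff[OF carrier_not_empty fv]
  proof
    fix n :: nat
    obtain a where a: "\<forall>i<n. a i \<in> carrier R"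
      and sh: "\<forall>S \<subseteq> {..<n}. \<exists>y \<in> carrier R. \<forall>i<n.
        (\<exists>r \<in> carrier R. a i \<otimes> ((d \<otimes> r) [^] p \<ominus> d \<otimes> r) = y) \<longleftrightarrow> i \<notin> S"
      using artin_schreier_shatters[OF p char e, of n] nu unfolding d_def by blast
    \<comment> \<open>The formula has no constant for \<open>d\<close>, so \<open>d\<close> is
      repeated as the second entry of every tuple.\<close>
    let ?a = "\<lambda>i j :: nat. if j = 0 then a i else d"
    show "\<exists>a. (\<forall>i<n. \<forall>j<2. a i j \<in> carrier R) \<and>
      (\<forall>S \<subseteq> {..<n}. \<exists>b. (\<forall>j<1. b j \<in> carrier R) \<and>
         (\<forall>i<n. sat R (join_env 2 (a i) b) \<phi> \<longleftrightarrow> i \<in> S))"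
    proof (intro exI[of _ ?a] conjI allI impI)
      fix S assume S: "S \<subseteq> {..<n}"
      \<comment> \<open>The equation is solvable outside the given set, hence the
        complement.\<close>
      obtain y where y: "y \<in> carrier R" "\<forall>i<n.
        (\<exists>r \<in> carrier R. a i \<otimes> ((d \<otimes> r) [^] p \<ominus> d \<otimes> r) = y) \<longleftrightarrow> i \<notin> {..<n} - S"
        using sh[rule_format, of "{..<n} - S"] by blast
      then show "\<exists>b. (\<forall>j<1. b j \<in> carrier R) \<and>
         (\<forall>i<n. sat R (join_env 2 (?a i) b) \<phi> \<longleftrightarrow> i \<in> S)"
        by (intro exI[of _ "\<lambda>_. y"]) (auto simp: sat)
    qed (use a d in auto)
  qed
  then show False using NIP fv unfolding NIP_ring_def NIP_theory_def by blast
qed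

section \<open>Rings presented by linear relations\<close>

text \<open>Recursion on the number of summands mirrors the term \<open>tsum\<close>, so values of
  sum terms need no closure conditions.\<close>

primrec rsum :: "('a, 'b) ring_scheme \<Rightarrow> (nat \<Rightarrow> 'a) \<Rightarrow> nat \<Rightarrow> 'a" where
  "rsum R f 0 = \<zero>\<^bsub>R\<^esub>"
| "rsum R f (Suc n) = rsum R f n \<oplus>\<^bsub>R\<^esub> f n"

lemma rsum_cong: "(\<And>i. i < n \<Longrightarrow> f i = g i) \<Longrightarrow> rsum R f n = rsum R g n"
  by (induction n) auto

context cring begin

lemma rsum_closed: "(\<And>i. i < n \<Longrightarrow> f i \<in> carrier R) \<Longrightarrow> rsum R f n \<in> carrier R"
  by (induction n) auto

lemma rsum_add:
  "(\<And>i. i < n \<Longrightarrow> f i \<in> carrier R) \<Longrightarrow> (\<And>i. i < n \<Longrightarrow> g i \<in> carrier R) \<Longrightarrow>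
    rsum R (\<lambda>i. f i \<oplus> g i) n = rsum R f n \<oplus> rsum R g n"
  by (induction n) (auto simp: rsum_closed a_ac)

lemma rsum_mult:
  "c \<in> carrier R \<Longrightarrow> (\<And>i. i < n \<Longrightarrow> f i \<in> carrier R) \<Longrightarrow>
    rsum R (\<lambda>i. c \<otimes> f i) n = c \<otimes> rsum R f n"
  by (induction n) (auto simp: rsum_closed r_distr)

lemma rsum_zero: "rsum R (\<lambda>i. \<zero>) n = \<zero>"
  by (induction n) auto

lemma rsum_uminus:
  "(\<And>i. i < n \<Longrightarrow> f i \<in> carrier R) \<Longrightarrow> rsum R (\<lambda>i. \<ominus> f i) n = \<ominus> rsum R f n"
  by (induction n) (auto simp: rsum_closed minus_add)

lemma add_uminus_eq_zero_iff:
  assumes "a \<in> carrier R" "b \<in> carrier R"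
  shows "a \<oplus> \<ominus> b = \<zero> \<longleftrightarrow> a = b"
  using minus_equality[of a "\<ominus> b"] assms by (auto simp: r_neg)

lemma rsum_unit:
  assumes "k < n" "x \<in> carrier R"
  shows "rsum R (\<lambda>i. if i = k then x else \<zero>) n = x"
  using assms(1)
proof (induction n)
  case (Suc n)
  show ?case
  proof (cases "k = n")
    case True
    then have "rsum R (\<lambda>i. if i = k then x else \<zero>) n = rsum R (\<lambda>i. \<zero>) n" by (intro rsum_cong) auto
    then show ?thesis using True assms(2) by (simp add: rsum_zero)
  next
    case False
    then show ?thesis using Suc assms(2) by simp
  qed
qed simp

lemma term_val_closed:
  "(\<And>x. x \<in> term_vars t \<Longrightarrow> e x \<in> carrier R) \<Longrightarrow> term_val R e t \<in> carrier R"
  by (induction t) auto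

end

primrec tsum :: "(nat \<Rightarrow> rterm) \<Rightarrow> nat \<Rightarrow> rterm" where
  "tsum f 0 = TZero"
| "tsum f (Suc n) = TAdd (tsum f n) (f n)"

lemma term_val_tsum: "term_val R e (tsum f n) = rsum R (\<lambda>i. term_val R e (f i)) n"
  by (induction n) auto

lemma term_vars_tsum: "term_vars (tsum f n) = (\<Union>i<n. term_vars (f i))"
  by (induction n) (auto simp: lessThan_Suc)

text \<open>
  In a ring spanned over \<open>R\<close> by \<open>n\<close> elements, a variable \<open>x\<close> becomes the block of the \<open>n\<close> variables
  from \<open>block_offset n m + n * x\<close> on. The variables below \<open>block_offset n m\<close> hold the structure
  constants, the coordinates of the unit and the matrix of the \<open>m\<close> linear equations that cut out the
  relations.
\<close>

definition block_offset :: "nat \<Rightarrow> nat \<Rightarrow> nat" where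
  "block_offset n m = n * n * n + n + m * n"

primrec block_term :: "nat \<Rightarrow> nat \<Rightarrow> rterm \<Rightarrow> nat \<Rightarrow> rterm" where
  "block_term n m (TVar x) = (\<lambda>l. TVar (block_offset n m + n * x + l))"
| "block_term n m TZero = (\<lambda>l. TZero)"
| "block_term n m TOne = (\<lambda>l. TVar (n * n * n + l))"
| "block_term n m (TAdd s t) = (\<lambda>l. TAdd (block_term n m s l) (block_term n m t l))"
| "block_term n m (TNeg t) = (\<lambda>l. TNeg (block_term n m t l))"
| "block_term n m (TMul s t) = (\<lambda>l. tsum (\<lambda>i. tsum (\<lambda>j.
     TMul (TMul (block_term n m s i) (block_term n m t j)) (TVar ((i * n + j) * n + l))) n) n)"

text \<open>Coordinates need not be unique, so an equation is translated by comparing the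
  \<open>m\<close> linear forms that detect relations, not the coordinates themselves.\<close>

primrec block_form :: "nat \<Rightarrow> nat \<Rightarrow> rform \<Rightarrow> rform" where
  "block_form n m (FEq s t) = FConj (map (\<lambda>j. FEq
     (tsum (\<lambda>i. TMul (TVar (n * n * n + n + j * n + i)) (block_term n m s i)) n)
     (tsum (\<lambda>i. TMul (TVar (n * n * n + n + j * n + i)) (block_term n m t i)) n)) [0..<m])"
| "block_form n m (FNot \<phi>) = FNot (block_form n m \<phi>)"
| "block_form n m (FAnd \<phi> \<psi>) = FAnd (block_form n m \<phi>) (block_form n m \<psi>)"
| "block_form n m (FEx x \<phi>) =
     FExs [block_offset n m + n * x..<block_offset n m + n * x + n] (block_form n m \<phi>)"

lemma pair_index_less:
  assumes "i < a" "j < (b :: nat)"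
  shows "i * b + j < a * b"
proof -
  have "i * b + j < Suc i * b" using assms by simp
  also have "\<dots> \<le> a * b" using assms by (intro mult_le_mono1) simp
  finally show ?thesis .
qed

section \<open>Free variables of translated formulas\<close>

definition block_vars :: "nat \<Rightarrow> nat \<Rightarrow> nat set \<Rightarrow> nat set" where
  "block_vars n m X = {..<block_offset n m} \<union> {block_offset n m + n * x + l | x l. x \<in> X \<and> l < n}"

lemma block_vars_mono: "X \<subseteq> Y \<Longrightarrow> block_vars n m X \<subseteq> block_vars n m Y"
  by (auto simp: block_vars_def)

lemma term_vars_block_term:
  "l < n \<Longrightarrow> term_vars (block_term n m t l) \<subseteq> block_vars n m (term_vars t)"
proof (induction t arbitrary: l)
  case (TMul s t)
  have "term_vars (block_term n m s i) \<subseteq> block_vars n m (term_vars (TMul s t))"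
    "term_vars (block_term n m t i) \<subseteq> block_vars n m (term_vars (TMul s t))" if "i < n" for i
    using TMul.IH(1)[OF that] TMul.IH(2)[OF that]
      block_vars_mono[of "term_vars s" "term_vars (TMul s t)" n m]
      block_vars_mono[of "term_vars t" "term_vars (TMul s t)" n m] by auto
  moreover have "(i * n + j) * n + l < block_offset n m" if "i < n" "j < n" for i j
    using pair_index_less[OF pair_index_less[OF that] TMul.prems] by (simp add: block_offset_def)
  then have "(i * n + j) * n + l \<in> block_vars n m X" if "i < n" "j < n" for i j X
    using that by (simp add: block_vars_def)
  ultimately show ?case by (simp add: term_vars_tsum UN_subset_iff)
next
  case (TAdd s t)
  then show ?case
    using order_trans[OF TAdd.IH(1) block_vars_mono[of "term_vars s" "term_vars (TAdd s t)" n m]]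
      order_trans[OF TAdd.IH(2) block_vars_mono[of "term_vars t" "term_vars (TAdd s t)" n m]]
    by simp
next
  case (TVar x)
  then show ?case by (auto simp: block_vars_def)
next
  case TOne
  then show ?case by (simp add: block_vars_def block_offset_def)
qed simp_all

lemma block_vars_diff:
  "block_vars n m X - {block_offset n m + n * x..<block_offset n m + n * x + n} \<subseteq> block_vars n m (X - {x})"
proof
  fix v assume v: "v \<in> block_vars n m X - {block_offset n m + n * x..<block_offset n m + n * x + n}"
  show "v \<in> block_vars n m (X - {x})"
  proof (cases "v < block_offset n m")
    case False
    then obtain y l where y: "v = block_offset n m + n * y + l" "y \<in> X" "l < n"
      using v by (auto simp: block_vars_def)
    then have "y \<noteq> x" using v by auto
    then show ?thesis using y by (auto simp: block_vars_def)
  qed (simp add: block_vars_def)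
qed

lemma free_vars_block_form: "free_vars (block_form n m \<phi>) \<subseteq> block_vars n m (free_vars \<phi>)"
proof (induction \<phi>)
  case (FEq s t)
  have "term_vars (block_term n m s i) \<subseteq> block_vars n m (free_vars (FEq s t))"
    "term_vars (block_term n m t i) \<subseteq> block_vars n m (free_vars (FEq s t))" if "i < n" for i
    using term_vars_block_term[OF that, of m s] term_vars_block_term[OF that, of m t]
      block_vars_mono[of "term_vars s" "free_vars (FEq s t)" n m]
      block_vars_mono[of "term_vars t" "free_vars (FEq s t)" n m] by auto
  moreover have "n * n * n + n + j * n + i \<in> block_vars n m X" if "j < m" "i < n" for i j X
    using pair_index_less[OF that] by (simp add: block_vars_def block_offset_def)
  ultimately show ?case by (simp add: term_vars_tsum free_vars_FConj UN_subset_iff)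
next
  case (FAnd \<phi> \<psi>)
  then show ?case
    using order_trans[OF FAnd.IH(1) block_vars_mono[of "free_vars \<phi>" "free_vars (FAnd \<phi> \<psi>)" n m]]
      order_trans[OF FAnd.IH(2) block_vars_mono[of "free_vars \<psi>" "free_vars (FAnd \<phi> \<psi>)" n m]]
    by simp
next
  case (FEx x \<phi>)
  then show ?case
    using block_vars_diff[of n m "free_vars \<phi>" x] by (auto simp: free_vars_FExs)
qed auto

lemma block_vars_lessThan: "block_vars n m {..<k} \<subseteq> {..<block_offset n m + n * k}"
proof -
  have "n * x + l < n * k" if "x < k" "l < n" for x l
    using pair_index_less[OF that] by (simp add: mult.commute)
  then show ?thesis by (auto simp: block_vars_def add.assoc trans_less_add1)
qed

text \<open>The generators \<open>b i\<close> need not be free: their relations are the kernel of a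
  finite matrix \<open>q\<close>. This makes equality in \<open>A\<close> first-order over
  \<open>R\<close>, with the entries of \<open>q\<close> as parameters next to the structure
  constants.\<close>

locale linear_presentation = ring_hom_cring R A h for R (structure) and A (structure) and h +
  fixes n m :: nat and b :: "nat \<Rightarrow> 'c" and q :: "nat \<Rightarrow> nat \<Rightarrow> 'a"
  assumes b: "i < n \<Longrightarrow> b i \<in> carrier A"
    and span: "x \<in> carrier A \<Longrightarrow>
      \<exists>u. (\<forall>i. u i \<in> carrier R) \<and> x = rsum A (\<lambda>i. h (u i) \<otimes>\<^bsub>A\<^esub> b i) n"
    and q: "j < m \<Longrightarrow> i < n \<Longrightarrow> q j i \<in> carrier R"
    and relations: "(\<And>i. i < n \<Longrightarrow> u i \<in> carrier R) \<Longrightarrow>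
      rsum A (\<lambda>i. h (u i) \<otimes>\<^bsub>A\<^esub> b i) n = \<zero>\<^bsub>A\<^esub> \<longleftrightarrow> (\<forall>j<m. rsum R (\<lambda>i. q j i \<otimes> u i) n = \<zero>)"
begin

definition comb :: "(nat \<Rightarrow> 'a) \<Rightarrow> 'c" where
  "comb u = rsum A (\<lambda>i. h (u i) \<otimes>\<^bsub>A\<^esub> b i) n"

lemma comb_cong: "(\<And>i. i < n \<Longrightarrow> u i = v i) \<Longrightarrow> comb u = comb v"
  unfolding comb_def by (rule rsum_cong) simp

lemma comb_closed: "(\<And>i. i < n \<Longrightarrow> u i \<in> carrier R) \<Longrightarrow> comb u \<in> carrier A"
  unfolding comb_def using b by (intro S.rsum_closed) simp

lemma comb_zero: "comb (\<lambda>i. \<zero>) = \<zero>\<^bsub>A\<^esub>"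
proof -
  have "comb (\<lambda>i. \<zero>) = rsum A (\<lambda>i. \<zero>\<^bsub>A\<^esub>) n"
    unfolding comb_def using b by (intro rsum_cong) simp
  then show ?thesis by (simp add: S.rsum_zero)
qed

lemma comb_add:
  assumes "\<And>i. i < n \<Longrightarrow> u i \<in> carrier R" "\<And>i. i < n \<Longrightarrow> v i \<in> carrier R"
  shows "comb (\<lambda>i. u i \<oplus> v i) = comb u \<oplus>\<^bsub>A\<^esub> comb v"
proof -
  have "comb (\<lambda>i. u i \<oplus> v i) = rsum A (\<lambda>i. h (u i) \<otimes>\<^bsub>A\<^esub> b i \<oplus>\<^bsub>A\<^esub> h (v i) \<otimes>\<^bsub>A\<^esub> b i) n"
    unfolding comb_def using b assms by (intro rsum_cong) (simp add: S.l_distr)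
  then show ?thesis unfolding comb_def using b assms by (simp add: S.rsum_add)
qed

lemma comb_uminus:
  assumes "\<And>i. i < n \<Longrightarrow> u i \<in> carrier R"
  shows "comb (\<lambda>i. \<ominus> u i) = \<ominus>\<^bsub>A\<^esub> comb u"
proof -
  have "comb (\<lambda>i. \<ominus> u i) = rsum A (\<lambda>i. \<ominus>\<^bsub>A\<^esub> (h (u i) \<otimes>\<^bsub>A\<^esub> b i)) n"
    unfolding comb_def using b assms by (intro rsum_cong) (simp add: S.l_minus)
  then show ?thesis unfolding comb_def using b assms by (simp add: S.rsum_uminus)
qed

lemma comb_smult:
  assumes "c \<in> carrier R" "\<And>i. i < n \<Longrightarrow> u i \<in> carrier R"
  shows "comb (\<lambda>i. c \<otimes> u i) = h c \<otimes>\<^bsub>A\<^esub> comb u"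
proof -
  have "comb (\<lambda>i. c \<otimes> u i) = rsum A (\<lambda>i. h c \<otimes>\<^bsub>A\<^esub> (h (u i) \<otimes>\<^bsub>A\<^esub> b i)) n"
    unfolding comb_def using b assms by (intro rsum_cong) (simp add: S.m_assoc)
  then show ?thesis unfolding comb_def using b assms by (simp add: S.rsum_mult)
qed

lemma comb_rsum:
  assumes "\<And>i j. i < k \<Longrightarrow> j < n \<Longrightarrow> u i j \<in> carrier R"
  shows "comb (\<lambda>j. rsum R (\<lambda>i. u i j) k) = rsum A (\<lambda>i. comb (u i)) k"
  using assms by (induction k) (simp_all add: comb_zero comb_add R.rsum_closed)

lemma comb_eq_iff:
  assumes u: "\<And>i. i < n \<Longrightarrow> u i \<in> carrier R" and v: "\<And>i. i < n \<Longrightarrow> v i \<in> carrier R"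
  shows "comb u = comb v \<longleftrightarrow> (\<forall>j<m. rsum R (\<lambda>i. q j i \<otimes> u i) n = rsum R (\<lambda>i. q j i \<otimes> v i) n)"
proof -
  have "comb u = comb v \<longleftrightarrow> comb u \<oplus>\<^bsub>A\<^esub> \<ominus>\<^bsub>A\<^esub> comb v = \<zero>\<^bsub>A\<^esub>"
    using comb_closed[of u, OF u] comb_closed[of v, OF v]
    by (simp add: S.add_uminus_eq_zero_iff)
  also have "\<dots> \<longleftrightarrow> comb (\<lambda>i. u i \<oplus> \<ominus> v i) = \<zero>\<^bsub>A\<^esub>"
    using u v by (simp add: comb_add comb_uminus)
  also have "\<dots> \<longleftrightarrow> (\<forall>j<m. rsum R (\<lambda>i. q j i \<otimes> (u i \<oplus> \<ominus> v i)) n = \<zero>)"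
    unfolding comb_def using u v by (intro relations) simp
  also have "\<dots> \<longleftrightarrow> (\<forall>j<m. rsum R (\<lambda>i. q j i \<otimes> u i) n = rsum R (\<lambda>i. q j i \<otimes> v i) n)"
  proof (intro all_cong1 imp_cong refl)
    fix j assume j: "j < m"
    let ?u = "rsum R (\<lambda>i. q j i \<otimes> u i) n" and ?v = "rsum R (\<lambda>i. q j i \<otimes> v i) n"
    have cl: "?u \<in> carrier R" "?v \<in> carrier R" using q[OF j] u v by (auto intro!: R.rsum_closed)
    have "rsum R (\<lambda>i. q j i \<otimes> (u i \<oplus> \<ominus> v i)) n = rsum R (\<lambda>i. q j i \<otimes> u i \<oplus> \<ominus> (q j i \<otimes> v i)) n"
      using q[OF j] u v by (intro rsum_cong) (simp add: R.r_distr R.r_minus)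
    also have "\<dots> = ?u \<oplus> \<ominus> ?v" using q[OF j] u v by (simp add: R.rsum_add R.rsum_uminus)
    finally show "rsum R (\<lambda>i. q j i \<otimes> (u i \<oplus> \<ominus> v i)) n = \<zero> \<longleftrightarrow> ?u = ?v"
      using cl by (simp add: R.add_uminus_eq_zero_iff)
  qed
  finally show ?thesis .
qed

text \<open>Any choice of coordinates will do. The value zero outside \<open>A\<close> frees
  \<open>coords_closed\<close> from a hypothesis.\<close>

definition coords :: "'c \<Rightarrow> nat \<Rightarrow> 'a" where
  "coords x = (if x \<in> carrier A then SOME u. (\<forall>i. u i \<in> carrier R) \<and> x = comb u else (\<lambda>_. \<zero>))"

lemma coords:
  shows coords_closed: "coords x i \<in> carrier R"
    and comb_coords: "x \<in> carrier A \<Longrightarrow> comb (coords x) = x"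
proof -
  have "(\<forall>i. coords x i \<in> carrier R) \<and> x = comb (coords x)" if "x \<in> carrier A"
    using someI_ex[OF span[OF that]] that unfolding coords_def comb_def by simp
  moreover have "coords x i \<in> carrier R" if "x \<notin> carrier A" using that by (simp add: coords_def)
  ultimately show "coords x i \<in> carrier R" "x \<in> carrier A \<Longrightarrow> comb (coords x) = x"
    by (cases "x \<in> carrier A"; simp)+
qed

text \<open>Decodes the layout of the translated formulas: the first segment is read to base
  \<open>n\<close> as digits \<open>i\<close>, \<open>j\<close>, \<open>l\<close>, the last one as
  row and column of \<open>q\<close>. Zero past the end keeps all values in
  \<open>R\<close>.\<close>

definition parameter :: "nat \<Rightarrow> 'a" where
  "parameter v = (if v < n * n * n
     then coords (b (v div n div n) \<otimes>\<^bsub>A\<^esub> b (v div n mod n)) (v mod n)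
     else if v < n * n * n + n then coords \<one>\<^bsub>A\<^esub> (v - n * n * n)
     else let w = v - (n * n * n + n) in if w < m * n then q (w div n) (w mod n) else \<zero>)"

lemma parameter_closed: "parameter v \<in> carrier R"
proof -
  have "q (w div n) (w mod n) \<in> carrier R" if "w < m * n" for w
  proof (rule q)
    show "w div n < m" using that by (simp add: less_mult_imp_div_less)
    show "w mod n < n" using that by (cases "n = 0") auto
  qed
  then show ?thesis by (simp add: parameter_def Let_def coords_closed)
qed

lemma parameter_mult:
  assumes "i < n" "j < n" "l < n"
  shows "parameter ((i * n + j) * n + l) = coords (b i \<otimes>\<^bsub>A\<^esub> b j) l"
  using pair_index_less[OF pair_index_less[OF assms(1,2)] assms(3)] assms
  by (simp add: parameter_def div_mult_self3)

lemma parameter_one: "l < n \<Longrightarrow> parameter (n * n * n + l) = coords \<one>\<^bsub>A\<^esub> l"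
  by (simp add: parameter_def)

lemma parameter_q:
  assumes "j < m" "i < n"
  shows "parameter (n * n * n + n + j * n + i) = q j i"
proof -
  have "n * n * n + n + j * n + i - (n * n * n + n) = j * n + i" by simp
  then show ?thesis using pair_index_less[OF assms] assms by (simp add: parameter_def)
qed

definition block_env :: "(nat \<Rightarrow> 'a) \<Rightarrow> nat \<Rightarrow> 'c" where
  "block_env e x = comb (\<lambda>l. e (block_offset n m + n * x + l))"

definition admissible :: "(nat \<Rightarrow> 'a) \<Rightarrow> bool" where
  "admissible e \<longleftrightarrow> range e \<subseteq> carrier R \<and> (\<forall>v < block_offset n m. e v = parameter v)"

text \<open>Sums and negatives are formed coordinatewise; a product is expanded bilinearly and
  reassembled from the stored coordinates of \<open>b i\<close> times \<open>b j\<close>.\<close>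

lemma comb_block_term:
  assumes e: "admissible e"
  shows "comb (\<lambda>l. term_val R e (block_term n m t l)) = term_val A (block_env e) t"
proof -
  have ec: "e v \<in> carrier R" for v using e by (auto simp: admissible_def)
  have tc: "term_val R e t \<in> carrier R" for t using ec by (intro R.term_val_closed)
  show ?thesis
  proof (induction t)
    case (TVar x)
    then show ?case by (simp add: block_env_def)
  next
    case TZero
    then show ?case by (simp add: comb_zero)
  next
    case TOne
    have "comb (\<lambda>l. e (n * n * n + l)) = comb (coords \<one>\<^bsub>A\<^esub>)"
      using e by (intro comb_cong) (simp add: admissible_def block_offset_def parameter_one)
    then show ?case by (simp add: comb_coords)
  next
    case (TAdd s t)
    then show ?case by (simp add: comb_add tc)
  next
    case (TNeg t)
    then show ?case by (simp add: comb_uminus tc)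
  next
    case (TMul s t)
    define u v where "u i = term_val R e (block_term n m s i)"
      and "v i = term_val R e (block_term n m t i)" for i
    have uv [simp]: "u i \<in> carrier R" "v i \<in> carrier R" for i
      unfolding u_def v_def by (simp_all add: tc)
    have "comb (\<lambda>l. term_val R e (block_term n m (TMul s t) l)) =
        comb (\<lambda>l. rsum R (\<lambda>i. rsum R (\<lambda>j. u i \<otimes> v j \<otimes> e ((i * n + j) * n + l)) n) n)"
      by (simp add: term_val_tsum u_def v_def)
    also have "\<dots> = rsum A (\<lambda>i. rsum A (\<lambda>j. comb (\<lambda>l. u i \<otimes> v j \<otimes> e ((i * n + j) * n + l))) n) n"
      by (simp add: comb_rsum R.rsum_closed ec)
    also have "\<dots> = rsum A (\<lambda>i. rsum A (\<lambda>j. (h (u i) \<otimes>\<^bsub>A\<^esub> b i) \<otimes>\<^bsub>A\<^esub> (h (v j) \<otimes>\<^bsub>A\<^esub> b j)) n) n"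
    proof (intro rsum_cong)
      fix i j assume ij: "i < n" "j < n"
      have "comb (\<lambda>l. e ((i * n + j) * n + l)) = comb (coords (b i \<otimes>\<^bsub>A\<^esub> b j))"
      proof (rule comb_cong)
        fix l assume l: "l < n"
        have "(i * n + j) * n + l < block_offset n m"
          using pair_index_less[OF pair_index_less[OF ij] l] by (simp add: block_offset_def)
        then show "e ((i * n + j) * n + l) = coords (b i \<otimes>\<^bsub>A\<^esub> b j) l"
          using e ij l by (simp add: admissible_def parameter_mult)
      qed
      then show "comb (\<lambda>l. u i \<otimes> v j \<otimes> e ((i * n + j) * n + l)) =
          (h (u i) \<otimes>\<^bsub>A\<^esub> b i) \<otimes>\<^bsub>A\<^esub> (h (v j) \<otimes>\<^bsub>A\<^esub> b j)"
        using ij b by (simp add: comb_smult ec comb_coords S.m_ac)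
    qed
    also have "\<dots> = rsum A (\<lambda>i. comb v \<otimes>\<^bsub>A\<^esub> (h (u i) \<otimes>\<^bsub>A\<^esub> b i)) n"
      unfolding comb_def using b by (intro rsum_cong) (simp add: S.rsum_mult S.rsum_closed S.m_comm)
    also have "\<dots> = comb v \<otimes>\<^bsub>A\<^esub> comb u"
      using b comb_closed[of v] unfolding comb_def[of u] by (simp add: S.rsum_mult)
    also have "\<dots> = comb u \<otimes>\<^bsub>A\<^esub> comb v"
      by (simp add: S.m_comm comb_closed)
    finally show ?case using TMul unfolding u_def v_def by simp
  qed
qed

lemma block_env_update:
  fixes e f :: "nat \<Rightarrow> 'a" and x :: nat
  defines "e' \<equiv> \<lambda>y. if y \<in> {block_offset n m + n * x..<block_offset n m + n * x + n} then f y else e y"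
  shows "block_env e' = (block_env e)(x := comb (\<lambda>l. f (block_offset n m + n * x + l)))"
proof
  fix y
  show "block_env e' y = ((block_env e)(x := comb (\<lambda>l. f (block_offset n m + n * x + l)))) y"
  proof (cases "y = x")
    case True
    then show ?thesis by (simp add: block_env_def e'_def cong: comb_cong)
  next
    case False
    \<comment> \<open>Blocks have length \<open>n\<close>, so two of them meet only if
      \<open>x < y + 1\<close> and \<open>y < x + 1\<close>.\<close>
    have "\<not> (n * x \<le> n * y + l \<and> n * y + l < n * x + n)" if l: "l < n" for l
    proof
      assume a: "n * x \<le> n * y + l \<and> n * y + l < n * x + n"
      then have "n * x < n * Suc y" "n * y < n * Suc x" using l by auto
      then have "x < Suc y" "y < Suc x" by (simp_all only: mult_less_cancel1)
      then show False using False by simp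
    qed
    then show ?thesis
      using False by (auto simp: block_env_def e'_def add.assoc intro!: comb_cong)
  qed
qed

text \<open>Equations are settled by \<open>comb_eq_iff\<close>. A quantifier over \<open>A\<close>
  becomes one over coordinate vectors because the generators span \<open>A\<close>.\<close>

lemma sat_block_form:
  "admissible e \<Longrightarrow> sat R e (block_form n m \<phi>) \<longleftrightarrow> sat A (block_env e) \<phi>"
proof (induction \<phi> arbitrary: e)
  case (FEq s t)
  have ec: "e v \<in> carrier R" for v using FEq by (auto simp: admissible_def)
  have tc: "term_val R e t \<in> carrier R" for t using ec by (intro R.term_val_closed)
  have Q: "rsum R (\<lambda>i. e (n * n * n + n + j * n + i) \<otimes> u i) n = rsum R (\<lambda>i. q j i \<otimes> u i) n"
    if "j < m" for j u
  proof (rule rsum_cong)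
    fix i assume i: "i < n"
    then have "n * n * n + n + j * n + i < block_offset n m"
      using pair_index_less[OF that i] by (simp add: block_offset_def)
    then show "e (n * n * n + n + j * n + i) \<otimes> u i = q j i \<otimes> u i"
      using FEq that i by (simp add: admissible_def parameter_q)
  qed
  have "sat A (block_env e) (FEq s t) \<longleftrightarrow>
      comb (\<lambda>l. term_val R e (block_term n m s l)) = comb (\<lambda>l. term_val R e (block_term n m t l))"
    by (simp add: comb_block_term[OF FEq])
  also have "\<dots> \<longleftrightarrow> sat R e (block_form n m (FEq s t))"
    by (subst comb_eq_iff) (auto simp: tc sat_FConj term_val_tsum Q)
  finally show ?case by simp
next
  case (FEx x \<phi>)
  let ?B = "{block_offset n m + n * x..<block_offset n m + n * x + n}"
  let ?e = "\<lambda>f y. if y \<in> ?B then f y else e y"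
  have adm: "admissible (?e f)" if "\<forall>y \<in> ?B. f y \<in> carrier R" for f
    using FEx.prems that by (auto simp: admissible_def)
  have "sat R e (block_form n m (FEx x \<phi>)) \<longleftrightarrow>
      (\<exists>f. (\<forall>y \<in> ?B. f y \<in> carrier R) \<and> sat R (?e f) (block_form n m \<phi>))"
    by (simp add: sat_FExs)
  also have "\<dots> \<longleftrightarrow> (\<exists>f. (\<forall>y \<in> ?B. f y \<in> carrier R) \<and>
      sat A ((block_env e)(x := comb (\<lambda>l. f (block_offset n m + n * x + l)))) \<phi>)"
    using FEx.IH[OF adm] by (intro ex_cong1 conj_cong refl) (simp only: block_env_update)
  also have "\<dots> \<longleftrightarrow> (\<exists>a \<in> carrier A. sat A ((block_env e)(x := a)) \<phi>)" (is "?L \<longleftrightarrow> ?R")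
  proof
    assume ?L
    then obtain f where f: "\<forall>y \<in> ?B. f y \<in> carrier R"
      "sat A ((block_env e)(x := comb (\<lambda>l. f (block_offset n m + n * x + l)))) \<phi>" by blast
    moreover have "comb (\<lambda>l. f (block_offset n m + n * x + l)) \<in> carrier A"
      using f(1) by (intro comb_closed) simp
    ultimately show ?R by blast
  next
    assume ?R
    then obtain a where a: "a \<in> carrier A" "sat A ((block_env e)(x := a)) \<phi>" by blast
    have "comb (\<lambda>l. coords a (block_offset n m + n * x + l - (block_offset n m + n * x))) = a"
      by (simp add: comb_coords[OF a(1)])
    then show ?L
      using a(2) by (intro exI[of _ "\<lambda>y. coords a (y - (block_offset n m + n * x))"])
        (auto simp: coords_closed)
  qed
  finally show ?case by simp
qed simp_all

text \<open>Coordinates turn a family shattered in \<open>A\<close> into one in \<open>R\<close>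
  that is shattered by the translated formula.\<close>

lemma NIP_ring_presented:
  assumes NIP: "NIP_ring R"
  shows "NIP_ring A"
proof (rule ccontr)
  assume "\<not> NIP_ring A"
  then obtain k m' \<phi> where fv: "free_vars \<phi> \<subseteq> {..<k + m'}"
    and IP: "has_IP (complete_theory A) k m' \<phi>"
    unfolding NIP_ring_def NIP_theory_def by blast
  \<comment> \<open>The stored constants are put at the front of every left tuple, before its
    \<open>n * k\<close> coordinates.\<close>
  define K where "K = block_offset n m + n * k"
  have fv': "free_vars (block_form n m \<phi>) \<subseteq> {..<K + n * m'}"
    using free_vars_block_form[of n m \<phi>] block_vars_mono[OF fv, of n m] block_vars_lessThan[of n m "k + m'"]
    by (auto simp: K_def distrib_left add.assoc)
  have "has_IP (complete_theory R) K (n * m') (block_form n m \<phi>)"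
    unfolding has_IP_complete_theory_iff[OF R.carrier_not_empty fv']
  proof
    fix N :: nat
    from IP have "\<exists>a. (\<forall>i<N. \<forall>j<k. a i j \<in> carrier A) \<and> (\<forall>S \<subseteq> {..<N}.
        \<exists>y. (\<forall>j<m'. y j \<in> carrier A) \<and> (\<forall>i<N. sat A (join_env k (a i) y) \<phi> \<longleftrightarrow> i \<in> S))"
      unfolding has_IP_complete_theory_iff[OF S.carrier_not_empty fv] by (rule spec)
    then obtain a where a: "\<forall>i<N. \<forall>j<k. a i j \<in> carrier A"
      and sh: "\<forall>S \<subseteq> {..<N}. \<exists>y. (\<forall>j<m'. y j \<in> carrier A) \<and>
         (\<forall>i<N. sat A (join_env k (a i) y) \<phi> \<longleftrightarrow> i \<in> S)"
      by (elim exE conjE)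
    define a' where "a' i v = (if v < block_offset n m then parameter v
      else coords (a i ((v - block_offset n m) div n)) ((v - block_offset n m) mod n))" for i v
    define y' where "y' y v = coords (y (v div n)) (v mod n)" for y v
    have adm: "admissible (join_env K (a' i) (y' y))" for i y
      by (auto simp: admissible_def join_env_def a'_def y'_def K_def coords_closed parameter_closed)
    have env: "block_env (join_env K (a' i) (y' y)) x = join_env k (a i) y x"
      if i: "i < N" and y: "\<forall>j<m'. y j \<in> carrier A" and x: "x < k + m'" for i y x
    proof (cases "x < k")
      case True
      have "n * x + l < n * k" if "l < n" for l
        using pair_index_less[OF True that] by (simp add: mult.commute)
      then have "block_env (join_env K (a' i) (y' y)) x = comb (coords (a i x))"
        unfolding block_env_def
        by (intro comb_cong) (simp add: join_env_def K_def a'_def add.assoc)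
      then show ?thesis using True a i by (simp add: comb_coords join_env_def)
    next
      case False
      then obtain z where z: "x = k + z" by (metis le_Suc_ex not_less)
      have "block_env (join_env K (a' i) (y' y)) x = comb (coords (y z))"
        unfolding block_env_def z
        by (intro comb_cong) (simp add: join_env_def K_def y'_def add.assoc distrib_left)
      then show ?thesis using x y by (simp add: z comb_coords join_env_def)
    qed
    have sat: "sat R (join_env K (a' i) (y' y)) (block_form n m \<phi>) \<longleftrightarrow> sat A (join_env k (a i) y) \<phi>"
      if "i < N" "\<forall>j<m'. y j \<in> carrier A" for i y
      unfolding sat_block_form[OF adm]
      by (rule sat_cong) (use env[OF that] fv in auto)
    show "\<exists>a. (\<forall>i<N. \<forall>j<K. a i j \<in> carrier R) \<and>
      (\<forall>S \<subseteq> {..<N}. \<exists>y. (\<forall>j<n * m'. y j \<in> carrier R) \<and>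
         (\<forall>i<N. sat R (join_env K (a i) y) (block_form n m \<phi>) \<longleftrightarrow> i \<in> S))"
    proof (intro exI[of _ a'] conjI allI impI)
      fix i j show "a' i j \<in> carrier R"
        by (simp add: a'_def coords_closed parameter_closed)
    next
      fix S assume "S \<subseteq> {..<N}"
      then obtain y where y: "\<forall>j<m'. y j \<in> carrier A"
        "\<forall>i<N. sat A (join_env k (a i) y) \<phi> \<longleftrightarrow> i \<in> S" using sh by blast
      then show "\<exists>y. (\<forall>j<n * m'. y j \<in> carrier R) \<and>
         (\<forall>i<N. sat R (join_env K (a' i) y) (block_form n m \<phi>) \<longleftrightarrow> i \<in> S)"
        by (intro exI[of _ "y' y"]) (simp add: sat y'_def coords_closed)
    qed
  qed
  then show False using NIP fv' unfolding NIP_ring_def NIP_theory_def by blast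
qed

end

section \<open>Local rings and polynomial rings\<close>

lemma (in ideal) rcos_eq_iff:
  assumes "a \<in> carrier R" "b \<in> carrier R"
  shows "I +> a = I +> b \<longleftrightarrow> a \<ominus> b \<in> I"
  using quotient_eq_iff_same_a_r_cos[OF is_ideal assms] by simp

lemma (in ideal) quotient_carrierE:
  assumes "x \<in> carrier (R Quot I)"
  obtains w where "w \<in> carrier R" "x = I +> w"
  using assms by (auto simp: FactRing_def A_RCOSETS_def')

lemma (in ideal) rcos_eq_zero_iff:
  assumes "a \<in> carrier R"
  shows "I +> a = \<zero>\<^bsub>R Quot I\<^esub> \<longleftrightarrow> a \<in> I"
  using a_rcos_zero[OF is_ideal] rcos_const_imp_mem[OF assms] by (auto simp: FactRing_def)

lemma (in ring_hom_cring) rsum_hom: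
  "(\<And>i. i < n \<Longrightarrow> f i \<in> carrier R) \<Longrightarrow> h (rsum R f n) = rsum S (\<lambda>i. h (f i)) n"
  by (induction n) (simp_all add: R.rsum_closed)

lemma (in ring_hom_cring) hom_add_pow:
  "x \<in> carrier R \<Longrightarrow> h ([(k :: nat)] \<cdot>\<^bsub>R\<^esub> x) = [k] \<cdot>\<^bsub>S\<^esub> h x"
  by (induction k) simp_all

section \<open>Rings in which \<open>e\<close> or \<open>1 - e\<close> is always a unit\<close>

context cring begin

definition nonunits :: "'a set" where
  "nonunits = {x \<in> carrier R. x \<notin> Units R}"

lemma Units_of_mult:
  assumes "x \<in> carrier R" "y \<in> carrier R" "x \<otimes> y \<in> Units R"
  shows "x \<in> Units R"
proof -
  define v where "v = y \<otimes> inv (x \<otimes> y)"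
  have v: "v \<in> carrier R" unfolding v_def using assms by simp
  moreover have "x \<otimes> v = \<one>" unfolding v_def using assms by (simp add: m_assoc[symmetric])
  moreover from this have "v \<otimes> x = \<one>" using assms v by (simp add: m_comm)
  ultimately show ?thesis using assms(1) unfolding Units_def by blast
qed

context
  assumes unit_or_unit: "\<And>e. e \<in> carrier R \<Longrightarrow> e \<in> Units R \<or> \<one> \<ominus> e \<in> Units R"
    and one_not_zero': "\<one> \<noteq> \<zero>"
begin

lemma nonunits_mult: "x \<in> nonunits \<Longrightarrow> y \<in> carrier R \<Longrightarrow> x \<otimes> y \<in> nonunits"
  using Units_of_mult[of x y] by (auto simp: nonunits_def)

text \<open>If \<open>v\<close> were inverse to \<open>x + y\<close>, then \<open>x v\<close> and
  \<open>y v\<close> would sum to 1, so one of them would be a unit, and with it \<open>x\<close> or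
  \<open>y\<close>.\<close>

lemma nonunits_add:
  assumes "x \<in> nonunits" "y \<in> nonunits"
  shows "x \<oplus> y \<in> nonunits"
proof (rule ccontr)
  assume "x \<oplus> y \<notin> nonunits"
  then have u: "x \<oplus> y \<in> Units R" using assms by (auto simp: nonunits_def)
  define v where "v = inv (x \<oplus> y)"
  have c: "x \<in> carrier R" "y \<in> carrier R" "v \<in> carrier R"
    using assms u by (auto simp: nonunits_def v_def)
  have "x \<otimes> v \<oplus> y \<otimes> v = (x \<oplus> y) \<otimes> v" using c by (simp add: l_distr)
  also have "\<dots> = \<one>" using u by (simp add: v_def)
  finally have 1: "x \<otimes> v \<oplus> y \<otimes> v = \<one>" .
  have "\<one> \<ominus> x \<otimes> v = (x \<otimes> v \<oplus> y \<otimes> v) \<ominus> x \<otimes> v" by (simp only: 1)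
  also have "\<dots> = y \<otimes> v" using c by algebra
  finally have "x \<otimes> v \<in> Units R \<or> y \<otimes> v \<in> Units R"
    using unit_or_unit[of "x \<otimes> v"] c by simp
  then show False
    using Units_of_mult[of x v] Units_of_mult[of y v] c assms by (auto simp: nonunits_def)
qed

lemma nonunits_ideal: "ideal nonunits R"
proof (rule idealI)
  show "subgroup nonunits (add_monoid R)"
  proof (rule add.subgroupI)
    have "\<zero> \<notin> Units R"
    proof
      assume "\<zero> \<in> Units R"
      then obtain y where "y \<in> carrier R" "y \<otimes> \<zero> = \<one>" by (auto simp: Units_def)
      then show False using one_not_zero' by simp
    qed
    then show "nonunits \<noteq> {}" by (auto simp: nonunits_def)
    show "\<ominus> x \<in> nonunits" if "x \<in> nonunits" for x
      using nonunits_mult[OF that, of "\<ominus> \<one>"] that by (simp add: r_minus nonunits_def)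
  qed (auto simp: nonunits_add, auto simp: nonunits_def)
  show "x \<otimes> a \<in> nonunits" if "a \<in> nonunits" "x \<in> carrier R" for a x
    using nonunits_mult[OF that] that by (simp add: m_comm nonunits_def)
qed (auto intro: nonunits_mult ring_axioms)

lemma ideal_imp_nonunits:
  assumes "ideal J R" "J \<noteq> carrier R"
  shows "J \<subseteq> nonunits"
proof
  interpret J: ideal J R by fact
  fix x assume x: "x \<in> J"
  have "x \<notin> Units R"
  proof
    assume u: "x \<in> Units R"
    then have "\<one> \<in> J" using J.I_l_closed[OF x, of "inv x"] by simp
    then show False using J.one_imp_carrier assms(2) by simp
  qed
  then show "x \<in> nonunits" using x J.Icarr by (simp add: nonunits_def)
qed

lemma nonunits_maximal: "maximalideal nonunits R"
proof (rule maximalidealI[OF nonunits_ideal])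
  show "carrier R \<noteq> nonunits" by (auto simp: nonunits_def)
  show "J = nonunits \<or> J = carrier R" if "ideal J R" "nonunits \<subseteq> J" for J
    using ideal_imp_nonunits[OF that(1)] that(2) by auto
qed

lemma maximalideal_eq_nonunits:
  assumes "maximalideal M R"
  shows "M = nonunits"
proof -
  interpret M: maximalideal M R by fact
  show ?thesis
    using M.I_maximal[OF nonunits_ideal ideal_imp_nonunits[OF M.is_ideal]] M.I_notcarr
    by (auto simp: nonunits_def)
qed

lemma local_ring_of_unit_or_unit: "local_ring R"
  unfolding local_ring_def using cring_axioms nonunits_maximal maximalideal_eq_nonunits by blast

end
end

section \<open>Division by monic polynomials and ideal quotients\<close>

context UP_domain begin

lemma coeff_rsum:
  "(\<And>i. i < n \<Longrightarrow> F i \<in> carrier P) \<Longrightarrow> coeff P (rsum P F n) k = rsum R (\<lambda>i. coeff P (F i) k) n"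
  by (induction n) (simp_all add: P.rsum_closed)

lemma rsum_monom_eq:
  assumes q: "q \<in> carrier P" "\<And>i. n \<le> i \<Longrightarrow> coeff P q i = \<zero>"
  shows "rsum P (\<lambda>i. monom P (coeff P q i) i) n = q"
proof (rule up_eqI)
  fix k
  have "coeff P (rsum P (\<lambda>i. monom P (coeff P q i) i) n) k =
      rsum R (\<lambda>i. if i = k then coeff P q k else \<zero>) n"
    using q(1) by (subst coeff_rsum) (auto intro!: rsum_cong)
  also have "\<dots> = coeff P q k"
  proof (cases "k < n")
    case True
    then show ?thesis using q(1) by (simp add: R.rsum_unit)
  next
    case False
    then have "rsum R (\<lambda>i. if i = k then coeff P q k else \<zero>) n = rsum R (\<lambda>i. \<zero>) n"
      by (intro rsum_cong) auto
    then show ?thesis using False q(2)[of k] by (simp add: R.rsum_zero)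
  qed
  finally show "coeff P (rsum P (\<lambda>i. monom P (coeff P q i) i) n) k = coeff P q k" .
qed (use q in \<open>auto intro!: P.rsum_closed\<close>)

text \<open>Pseudo-division multiplies the dividend by a power of the leading coefficient, which is
  1 here. Bounding the remainder through its coefficients covers the zero remainder.\<close>

lemma monic_division:
  assumes f: "f \<in> carrier P" "lcoeff f = \<one>" and q: "q \<in> carrier P"
  obtains k r where "k \<in> carrier P" "r \<in> carrier P" "q = f \<otimes>\<^bsub>P\<^esub> k \<oplus>\<^bsub>P\<^esub> r"
    "\<And>i. deg R f \<le> i \<Longrightarrow> coeff P r i = \<zero>"
proof -
  have "f \<noteq> \<zero>\<^bsub>P\<^esub>" using f(2) by auto
  from long_div_theorem[OF f(1) q this] obtain k r m where
    kr: "k \<in> carrier P" "r \<in> carrier P" "lcoeff f [^] (m :: nat) \<odot>\<^bsub>P\<^esub> q = f \<otimes>\<^bsub>P\<^esub> k \<oplus>\<^bsub>P\<^esub> r"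
      "r = \<zero>\<^bsub>P\<^esub> \<or> deg R r < deg R f" by blast
  show ?thesis
  proof (rule that[OF kr(1,2)])
    show "q = f \<otimes>\<^bsub>P\<^esub> k \<oplus>\<^bsub>P\<^esub> r" using kr(3) q unfolding f(2) by simp
    show "coeff P r i = \<zero>" if "deg R f \<le> i" for i
      using kr(2,4) that by (auto intro: deg_aboveD)
  qed
qed

text \<open>Degrees add over a domain, so a nonzero multiple of \<open>f\<close> has at least the
  degree of \<open>f\<close>. This is the uniqueness of remainders.\<close>

lemma monic_multiple_eq_zero:
  assumes f: "f \<in> carrier P" "lcoeff f = \<one>" and k: "k \<in> carrier P"
    and low: "\<And>i. deg R f \<le> i \<Longrightarrow> coeff P (f \<otimes>\<^bsub>P\<^esub> k) i = \<zero>"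
  shows "k = \<zero>\<^bsub>P\<^esub>"
proof (rule ccontr)
  assume k0: "k \<noteq> \<zero>\<^bsub>P\<^esub>"
  have f0: "f \<noteq> \<zero>\<^bsub>P\<^esub>" using f(2) by auto
  have "f \<otimes>\<^bsub>P\<^esub> k \<noteq> \<zero>\<^bsub>P\<^esub>" using f0 k0 f(1) k by (simp add: domain.integral_iff[OF UP_domain])
  then have "lcoeff (f \<otimes>\<^bsub>P\<^esub> k) \<noteq> \<zero>" using f(1) k by (intro lcoeff_nonzero2) auto
  moreover have "deg R (f \<otimes>\<^bsub>P\<^esub> k) = deg R f + deg R k" using f0 k0 f(1) k by (rule deg_mult)
  ultimately show False using low by simp
qed

text \<open>The ideal quotient \<open>(f : h)\<close>, that is, the annihilator of the class of
  \<open>h\<close> modulo \<open>f\<close>.\<close>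

definition colon :: "(nat \<Rightarrow> 'a) \<Rightarrow> (nat \<Rightarrow> 'a) \<Rightarrow> (nat \<Rightarrow> 'a) set" where
  "colon f h = {r \<in> carrier P. \<exists>k \<in> carrier P. r \<otimes>\<^bsub>P\<^esub> h = f \<otimes>\<^bsub>P\<^esub> k}"

lemma colon_closed: "r \<in> colon f h \<Longrightarrow> r \<in> carrier P"
  by (simp add: colon_def)

lemma colon_ideal:
  assumes f: "f \<in> carrier P" and h: "h \<in> carrier P"
  shows "ideal (colon f h) P"
proof (rule idealI)
  have smult: "x \<otimes>\<^bsub>P\<^esub> r \<in> colon f h" if "x \<in> carrier P" "r \<in> colon f h" for x r
  proof -
    obtain k where k: "k \<in> carrier P" "r \<otimes>\<^bsub>P\<^esub> h = f \<otimes>\<^bsub>P\<^esub> k" "r \<in> carrier P"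
      using \<open>r \<in> colon f h\<close> by (auto simp: colon_def)
    have "(x \<otimes>\<^bsub>P\<^esub> r) \<otimes>\<^bsub>P\<^esub> h = x \<otimes>\<^bsub>P\<^esub> (f \<otimes>\<^bsub>P\<^esub> k)" using that h k by (simp add: P.m_assoc)
    also have "\<dots> = f \<otimes>\<^bsub>P\<^esub> (x \<otimes>\<^bsub>P\<^esub> k)" using that f k(1) by (simp add: P.m_lcomm)
    finally show ?thesis using that k(1,3) by (auto simp: colon_def)
  qed
  then show "x \<otimes>\<^bsub>P\<^esub> r \<in> colon f h" if "r \<in> colon f h" "x \<in> carrier P" for r x using that by blast
  then show "r \<otimes>\<^bsub>P\<^esub> x \<in> colon f h" if "r \<in> colon f h" "x \<in> carrier P" for r x
    using that P.m_comm[of r x] by (auto simp: colon_def)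
  show "subgroup (colon f h) (add_monoid P)"
  proof (rule P.add.subgroupI)
    have "\<zero>\<^bsub>P\<^esub> \<otimes>\<^bsub>P\<^esub> h = f \<otimes>\<^bsub>P\<^esub> \<zero>\<^bsub>P\<^esub>" using f h by simp
    then show "colon f h \<noteq> {}" by (auto simp: colon_def)
    show "\<ominus>\<^bsub>P\<^esub> r \<in> colon f h" if "r \<in> colon f h" for r
      using smult[OF _ that, of "\<ominus>\<^bsub>P\<^esub> \<one>\<^bsub>P\<^esub>"] that by (simp add: P.l_minus colon_def)
    show "r \<oplus>\<^bsub>P\<^esub> s \<in> colon f h" if rs: "r \<in> colon f h" "s \<in> colon f h" for r s
    proof -
      obtain k l where "k \<in> carrier P" "r \<otimes>\<^bsub>P\<^esub> h = f \<otimes>\<^bsub>P\<^esub> k" "r \<in> carrier P"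
        "l \<in> carrier P" "s \<otimes>\<^bsub>P\<^esub> h = f \<otimes>\<^bsub>P\<^esub> l" "s \<in> carrier P"
        using rs by (auto simp: colon_def)
      then show ?thesis using f h
        by (auto simp: colon_def P.l_distr P.r_distr[symmetric] simp del: UP_r_distr intro!: bexI[of _ "k \<oplus>\<^bsub>P\<^esub> l"])
    qed
  qed (auto simp: colon_def)
qed (rule P.ring_axioms)

lemma colon_self: "f \<in> carrier P \<Longrightarrow> h \<in> carrier P \<Longrightarrow> f \<in> colon f h"
  by (auto simp: colon_def)

text \<open>Modulo a monic \<open>f\<close> the polynomial ring is free over the domain
  \<open>R\<close>, hence torsion-free, so a nonzero constant can be cancelled.\<close>

lemma colon_saturated:
  assumes f: "f \<in> carrier P" "lcoeff f = \<one>" and h: "h \<in> carrier P"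
    and \<delta>: "\<delta> \<in> carrier R" "\<delta> \<noteq> \<zero>" and r: "r \<in> carrier P"
    and r\<delta>: "monom P \<delta> 0 \<otimes>\<^bsub>P\<^esub> r \<in> colon f h"
  shows "r \<in> colon f h"
proof -
  obtain k where k: "k \<in> carrier P" "(monom P \<delta> 0 \<otimes>\<^bsub>P\<^esub> r) \<otimes>\<^bsub>P\<^esub> h = f \<otimes>\<^bsub>P\<^esub> k"
    using r\<delta> by (auto simp: colon_def)
  obtain l s where l: "l \<in> carrier P" "s \<in> carrier P" "r \<otimes>\<^bsub>P\<^esub> h = f \<otimes>\<^bsub>P\<^esub> l \<oplus>\<^bsub>P\<^esub> s"
    "\<And>i. deg R f \<le> i \<Longrightarrow> coeff P s i = \<zero>"
    using monic_division[OF f, of "r \<otimes>\<^bsub>P\<^esub> h"] r h by auto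
  define D where "D = monom P \<delta> 0"
  have D: "D \<in> carrier P" unfolding D_def using \<delta> by simp
  \<comment> \<open>This multiple of \<open>f\<close> equals \<open>D s\<close>, whose coefficients
    vanish from the degree of \<open>f\<close> on. So it is zero, and so is the remainder
    \<open>s\<close> of \<open>r h\<close>.\<close>
  have "f \<otimes>\<^bsub>P\<^esub> (k \<ominus>\<^bsub>P\<^esub> D \<otimes>\<^bsub>P\<^esub> l) = f \<otimes>\<^bsub>P\<^esub> k \<ominus>\<^bsub>P\<^esub> D \<otimes>\<^bsub>P\<^esub> (f \<otimes>\<^bsub>P\<^esub> l)"
    using f(1) k(1) D l(1) by algebra
  also have "\<dots> = D \<otimes>\<^bsub>P\<^esub> (r \<otimes>\<^bsub>P\<^esub> h) \<ominus>\<^bsub>P\<^esub> D \<otimes>\<^bsub>P\<^esub> (f \<otimes>\<^bsub>P\<^esub> l)"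
    using k(2) D r h unfolding D_def[symmetric] by (simp add: P.m_assoc)
  also have "\<dots> = D \<otimes>\<^bsub>P\<^esub> s"
    unfolding l(3) using D f(1) l(1,2) by algebra
  finally have eq: "f \<otimes>\<^bsub>P\<^esub> (k \<ominus>\<^bsub>P\<^esub> D \<otimes>\<^bsub>P\<^esub> l) = D \<otimes>\<^bsub>P\<^esub> s" .
  have cD: "coeff P (D \<otimes>\<^bsub>P\<^esub> s) i = \<delta> \<otimes> coeff P s i" for i
    unfolding D_def using \<delta> l(2) by (simp add: monom_mult_is_smult del: coeff_mult)
  have "k \<ominus>\<^bsub>P\<^esub> D \<otimes>\<^bsub>P\<^esub> l = \<zero>\<^bsub>P\<^esub>"
    by (rule monic_multiple_eq_zero[OF f]) (use k(1) D l \<delta> in \<open>simp_all add: eq cD del: coeff_mult\<close>)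
  then have Ds: "D \<otimes>\<^bsub>P\<^esub> s = \<zero>\<^bsub>P\<^esub>" using eq f(1) by simp
  have "s = \<zero>\<^bsub>P\<^esub>"
  proof (rule up_eqI)
    fix i
    have "\<delta> \<otimes> coeff P s i = \<zero>" using cD[of i] unfolding Ds by simp
    then show "coeff P s i = coeff P \<zero>\<^bsub>P\<^esub> i" using \<delta> l(2) by (simp add: R.integral_iff)
  qed (use l in auto)
  then show ?thesis using l f r by (auto simp: colon_def)
qed

lemma colon_mult_mono:
  assumes "f \<in> carrier P" "h \<in> carrier P" "u \<in> carrier P" "r \<in> colon f h"
  shows "r \<in> colon f (h \<otimes>\<^bsub>P\<^esub> u)"
proof -
  obtain k where k: "k \<in> carrier P" "r \<otimes>\<^bsub>P\<^esub> h = f \<otimes>\<^bsub>P\<^esub> k" "r \<in> carrier P"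
    using assms(4) by (auto simp: colon_def)
  have "r \<otimes>\<^bsub>P\<^esub> (h \<otimes>\<^bsub>P\<^esub> u) = f \<otimes>\<^bsub>P\<^esub> (k \<otimes>\<^bsub>P\<^esub> u)"
    using k assms by (simp add: P.m_assoc[symmetric])
  then show ?thesis using k assms by (auto simp: colon_def)
qed

lemma colon_mult_iff:
  assumes "f \<in> carrier P" "h \<in> carrier P" "u \<in> carrier P" "r \<in> carrier P"
  shows "r \<in> colon f (h \<otimes>\<^bsub>P\<^esub> u) \<longleftrightarrow> r \<otimes>\<^bsub>P\<^esub> u \<in> colon f h"
  using assms by (simp add: colon_def P.m_ac)

text \<open>Choose \<open>h\<close> with \<open>(f : h)\<close> inside \<open>Q\<close> so that the
  least degree of a nonzero element is as small as possible. Passing to a multiple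
  \<open>h u\<close> whose quotient is still inside \<open>Q\<close> cannot lower this degree, which
  forces primality.\<close>

lemma ex_prime_colon:
  assumes f: "f \<in> carrier P" "lcoeff f = \<one>" and Q: "primeideal Q P" and fQ: "f \<in> Q"
  shows "\<exists>h \<in> carrier P. primeideal (colon f h) P \<and> colon f h \<subseteq> Q"
proof -
  interpret Q: primeideal Q P by fact
  define H where "H = {h \<in> carrier P. colon f h \<subseteq> Q}"
  define \<mu> where "\<mu> h = (LEAST d. \<exists>g \<in> colon f h. g \<noteq> \<zero>\<^bsub>P\<^esub> \<and> deg R g = d)" for h
  have f0: "f \<noteq> \<zero>\<^bsub>P\<^esub>" using f(2) by auto
  have "\<one>\<^bsub>P\<^esub> \<in> H"
    using Q.I_r_closed[OF fQ] by (auto simp: H_def colon_def)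
  \<comment> \<open>Minimisation is over a nonempty set: \<open>(f : 1)\<close> is
    \<open>(f)\<close>, which lies in \<open>Q\<close>.\<close>
  then obtain h where hH: "h \<in> H" and min: "\<And>h'. h' \<in> H \<Longrightarrow> \<mu> h \<le> \<mu> h'"
    using ex_has_least_nat[of "\<lambda>h. h \<in> H" _ \<mu>] by blast
  have h: "h \<in> carrier P" and hQ: "colon f h \<subseteq> Q" using hH by (auto simp: H_def)
  interpret I: ideal "colon f h" P using colon_ideal[OF f(1) h] .
  \<comment> \<open>Without such an \<open>s\<close>, the product \<open>h u\<close> would be in
    \<open>H\<close> and \<open>v\<close> in \<open>(f : h u)\<close>. Dividing \<open>v\<close> by
    some \<open>g\<close> of least degree in \<open>(f : h)\<close> would then leave no remainder by
    minimality, and \<open>v\<close> would be in \<open>(f : h)\<close>.\<close>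
  have key: "\<exists>s \<in> carrier P. s \<notin> Q \<and> s \<otimes>\<^bsub>P\<^esub> u \<in> colon f h"
    if u: "u \<in> carrier P" and v: "v \<in> carrier P" "v \<notin> colon f h" and uv: "u \<otimes>\<^bsub>P\<^esub> v \<in> colon f h" for u v
  proof (rule ccontr)
    assume "\<not> ?thesis"
    then have no: "s \<in> Q" if "s \<in> carrier P" "s \<otimes>\<^bsub>P\<^esub> u \<in> colon f h" for s
      using that by blast
    have "colon f (h \<otimes>\<^bsub>P\<^esub> u) \<subseteq> Q"
    proof
      fix s assume s: "s \<in> colon f (h \<otimes>\<^bsub>P\<^esub> u)"
      then have "s \<in> carrier P" by (rule colon_closed)
      then show "s \<in> Q" using no s colon_mult_iff[OF f(1) h u] by blast
    qed
    then have hu: "h \<otimes>\<^bsub>P\<^esub> u \<in> H" using h u by (simp add: H_def)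
    interpret J: ideal "colon f (h \<otimes>\<^bsub>P\<^esub> u)" P using colon_ideal[OF f(1), of "h \<otimes>\<^bsub>P\<^esub> u"] h u by simp
    have vJ: "v \<in> colon f (h \<otimes>\<^bsub>P\<^esub> u)"
      using colon_mult_iff[OF f(1) h u v(1)] uv P.m_comm[OF u v(1)] by simp
    have "\<exists>d. \<exists>g \<in> colon f h. g \<noteq> \<zero>\<^bsub>P\<^esub> \<and> deg R g = d"
      using colon_self[OF f(1) h] f0 by blast
    then have "\<exists>g \<in> colon f h. g \<noteq> \<zero>\<^bsub>P\<^esub> \<and> deg R g = \<mu> h"
      unfolding \<mu>_def by (rule LeastI_ex)
    then obtain g where g: "g \<in> colon f h" "g \<noteq> \<zero>\<^bsub>P\<^esub>" "deg R g = \<mu> h" by blast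
    have gc: "g \<in> carrier P" using g(1) I.Icarr by blast
    \<comment> \<open>As \<open>g\<close> need not be monic, \<open>v\<close> is multiplied by a
      constant, which \<open>colon_saturated\<close> cancels in the end.\<close>
    from long_div_theorem[OF gc v(1) g(2)] obtain k r m where
      kr: "k \<in> carrier P" "r \<in> carrier P" "lcoeff g [^] (m :: nat) \<odot>\<^bsub>P\<^esub> v = g \<otimes>\<^bsub>P\<^esub> k \<oplus>\<^bsub>P\<^esub> r"
      "r = \<zero>\<^bsub>P\<^esub> \<or> deg R r < deg R g" by blast
    define \<delta> where "\<delta> = lcoeff g [^] m"
    have lg: "lcoeff g \<in> carrier R" "lcoeff g \<noteq> \<zero>" using gc lcoeff_nonzero2[OF gc g(2)] by auto
    have \<delta>: "\<delta> \<in> carrier R" "\<delta> \<noteq> \<zero>"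
      unfolding \<delta>_def using lg by (simp, induction m) (auto simp: R.integral_iff)
    define D where "D = monom P \<delta> 0"
    have D: "D \<in> carrier P" unfolding D_def using \<delta> by simp
    have Dv: "D \<otimes>\<^bsub>P\<^esub> v = g \<otimes>\<^bsub>P\<^esub> k \<oplus>\<^bsub>P\<^esub> r"
      using kr(3) \<delta> v unfolding D_def \<delta>_def by (simp add: monom_mult_is_smult)
    have gJ: "g \<otimes>\<^bsub>P\<^esub> k \<in> colon f (h \<otimes>\<^bsub>P\<^esub> u)"
      using J.I_r_closed[OF colon_mult_mono[OF f(1) h u g(1)] kr(1)] .
    have "r = D \<otimes>\<^bsub>P\<^esub> v \<ominus>\<^bsub>P\<^esub> g \<otimes>\<^bsub>P\<^esub> k"
      unfolding Dv using gc kr(1,2) by algebra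
    then have rJ: "r \<in> colon f (h \<otimes>\<^bsub>P\<^esub> u)"
      using J.I_l_closed[OF vJ D] gJ by (simp add: a_minus_def)
    have "r = \<zero>\<^bsub>P\<^esub>"
    proof (rule ccontr)
      assume r0: "r \<noteq> \<zero>\<^bsub>P\<^esub>"
      then have "\<mu> (h \<otimes>\<^bsub>P\<^esub> u) \<le> deg R r"
        unfolding \<mu>_def using rJ by (intro Least_le) blast
      then show False using min[OF hu] kr(4) r0 g(3) by simp
    qed
    then have "D \<otimes>\<^bsub>P\<^esub> v \<in> colon f h"
      using Dv I.I_r_closed[OF g(1) kr(1)] gc kr(1) by simp
    then show False using colon_saturated[OF f h \<delta> v(1)] v(2) unfolding D_def by blast
  qed
  have "primeideal (colon f h) P"
  proof (rule primeidealI)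
    show "carrier P \<noteq> colon f h" using hQ Q.I_notcarr Q.Icarr by blast
    fix u v assume uv: "u \<in> carrier P" "v \<in> carrier P" "u \<otimes>\<^bsub>P\<^esub> v \<in> colon f h"
    show "u \<in> colon f h \<or> v \<in> colon f h"
    proof (rule ccontr)
      assume n: "\<not> (u \<in> colon f h \<or> v \<in> colon f h)"
      \<comment> \<open>Applying \<open>key\<close> to \<open>u\<close> and \<open>v\<close>, then
        to \<open>s\<close> and \<open>u\<close>, gives two elements outside \<open>Q\<close> whose
        product lies in it.\<close>
      obtain s where s: "s \<in> carrier P" "s \<notin> Q" "s \<otimes>\<^bsub>P\<^esub> u \<in> colon f h"
        using key[OF uv(1,2) _ uv(3)] n by blast
      obtain t where "t \<in> carrier P" "t \<notin> Q" "t \<otimes>\<^bsub>P\<^esub> s \<in> colon f h"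
        using key[OF s(1) uv(1) _ s(3)] n by blast
      then show False using Q.I_prime[of t s] s hQ by blast
    qed
  qed (auto intro: I.is_ideal P.cring_axioms)
  then show ?thesis using h hQ by blast
qed

text \<open>The powers of \<open>X\<close> below the degree of the monic \<open>f\<close> span. A
  combination of them lies in \<open>I\<close> iff \<open>f\<close> divides its product with
  \<open>h\<close>, that is, iff the same combination of the remainders of \<open>X^i h\<close> is
  zero; the coefficients of that combination are the linear forms.\<close>

lemma linear_presentation_colon:
  assumes f: "f \<in> carrier P" "lcoeff f = \<one>" and h: "h \<in> carrier P"
  defines "I \<equiv> colon f h" and "n \<equiv> deg R f"
  shows "\<exists>q. linear_presentation R (P Quot I) (\<lambda>a. I +>\<^bsub>P\<^esub> monom P a 0) n n
    (\<lambda>i. I +>\<^bsub>P\<^esub> monom P \<one> i) q"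
proof -
  interpret I: ideal I P unfolding I_def by (rule colon_ideal[OF f(1) h])
  interpret \<pi>: ring_hom_cring P "P Quot I" "(+>\<^bsub>P\<^esub>) I"
    by (rule I.rcos_ring_hom_cring[OF P.cring_axioms])
  have "\<exists>k r. k \<in> carrier P \<and> r \<in> carrier P \<and> monom P \<one> i \<otimes>\<^bsub>P\<^esub> h = f \<otimes>\<^bsub>P\<^esub> k \<oplus>\<^bsub>P\<^esub> r \<and>
      (\<forall>j\<ge>n. coeff P r j = \<zero>)" for i
    using monic_division[OF f, of "monom P \<one> i \<otimes>\<^bsub>P\<^esub> h"] h unfolding n_def by (metis R.one_closed UP_mult_closed monom_closed)
  \<comment> \<open>The coefficients of the remainder \<open>r i\<close> of \<open>X^i h\<close>
    form column \<open>i\<close> of the matrix.\<close>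
  then obtain k r where kr: "\<And>i. k i \<in> carrier P" "\<And>i. r i \<in> carrier P"
    "\<And>i. monom P \<one> i \<otimes>\<^bsub>P\<^esub> h = f \<otimes>\<^bsub>P\<^esub> k i \<oplus>\<^bsub>P\<^esub> r i" "\<And>i j. n \<le> j \<Longrightarrow> coeff P (r i) j = \<zero>"
    by metis
  have mon: "monom P a i = monom P a 0 \<otimes>\<^bsub>P\<^esub> monom P \<one> i" if "a \<in> carrier R" for a i
    using that by (simp add: monom_mult[symmetric] del: monom_mult)
  have comb: "rsum (P Quot I) (\<lambda>i. (I +>\<^bsub>P\<^esub> monom P (u i) 0) \<otimes>\<^bsub>P Quot I\<^esub> (I +>\<^bsub>P\<^esub> monom P \<one> i)) n =
      I +>\<^bsub>P\<^esub> rsum P (\<lambda>i. monom P (u i) i) n" if u: "\<And>i. i < n \<Longrightarrow> u i \<in> carrier R" for u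
  proof -
    have "I +>\<^bsub>P\<^esub> rsum P (\<lambda>i. monom P (u i) i) n = rsum (P Quot I) (\<lambda>i. I +>\<^bsub>P\<^esub> monom P (u i) i) n"
      using u by (intro \<pi>.rsum_hom) simp
    also have "\<dots> = rsum (P Quot I)
        (\<lambda>i. (I +>\<^bsub>P\<^esub> monom P (u i) 0) \<otimes>\<^bsub>P Quot I\<^esub> (I +>\<^bsub>P\<^esub> monom P \<one> i)) n"
    proof (rule rsum_cong)
      fix i assume "i < n"
      then show "I +>\<^bsub>P\<^esub> monom P (u i) i =
          (I +>\<^bsub>P\<^esub> monom P (u i) 0) \<otimes>\<^bsub>P Quot I\<^esub> (I +>\<^bsub>P\<^esub> monom P \<one> i)"
        using u[of i] \<pi>.hom_mult[of "monom P (u i) 0" "monom P \<one> i"] mon[of "u i" i, symmetric]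
        by (simp del: monom_mult)
    qed
    finally show ?thesis by (rule sym)
  qed
  have "ring_hom_cring R (P Quot I) (\<lambda>a. I +>\<^bsub>P\<^esub> monom P a 0)"
    using ring_hom_trans[OF const_ring_hom \<pi>.homh]
    by (intro ring_hom_cringI R.cring_axioms \<pi>.S.cring_axioms) (simp add: comp_def)
  then have "linear_presentation R (P Quot I) (\<lambda>a. I +>\<^bsub>P\<^esub> monom P a 0) n n
    (\<lambda>i. I +>\<^bsub>P\<^esub> monom P \<one> i) (\<lambda>j i. coeff P (r i) j)"
  proof (intro linear_presentation.intro linear_presentation_axioms.intro)
    fix x assume "x \<in> carrier (P Quot I)"
    then obtain w where w: "w \<in> carrier P" "x = I +>\<^bsub>P\<^esub> w"
      by (rule I.quotient_carrierE)
    obtain l s where l: "l \<in> carrier P" "s \<in> carrier P" "w = f \<otimes>\<^bsub>P\<^esub> l \<oplus>\<^bsub>P\<^esub> s"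
      "\<And>i. n \<le> i \<Longrightarrow> coeff P s i = \<zero>"
      unfolding n_def using monic_division[OF f w(1)] by metis
    have "w \<ominus>\<^bsub>P\<^esub> s = f \<otimes>\<^bsub>P\<^esub> l"
      unfolding l(3) using f(1) l(1,2) by algebra
    then have "w \<ominus>\<^bsub>P\<^esub> s \<in> I"
      using I.I_r_closed[OF colon_self[OF f(1) h, folded I_def] l(1)] by simp
    then have "x = I +>\<^bsub>P\<^esub> s" using w l(2) I.rcos_eq_iff by simp
    then have "x = I +>\<^bsub>P\<^esub> rsum P (\<lambda>i. monom P (coeff P s i) i) n"
      using rsum_monom_eq[OF l(2,4)] by simp
    then show "\<exists>u. (\<forall>i. u i \<in> carrier R) \<and> x = rsum (P Quot I)
        (\<lambda>i. (I +>\<^bsub>P\<^esub> monom P (u i) 0) \<otimes>\<^bsub>P Quot I\<^esub> (I +>\<^bsub>P\<^esub> monom P \<one> i)) n"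
      using l(2) by (intro exI[of _ "coeff P s"]) (simp add: comb)
  next
    fix u assume u: "\<And>i. i < n \<Longrightarrow> u i \<in> carrier R"
    \<comment> \<open>The division \<open>U h = f K + S\<close> is assembled linearly from the
      divisions of the \<open>X^i h\<close>.\<close>
    define U where "U = rsum P (\<lambda>i. monom P (u i) i) n"
    define K where "K = rsum P (\<lambda>i. monom P (u i) 0 \<otimes>\<^bsub>P\<^esub> k i) n"
    define S where "S = rsum P (\<lambda>i. monom P (u i) 0 \<otimes>\<^bsub>P\<^esub> r i) n"
    have c: "U \<in> carrier P" "K \<in> carrier P" "S \<in> carrier P"
      unfolding U_def K_def S_def using u kr by (auto intro!: P.rsum_closed)
    have "U \<otimes>\<^bsub>P\<^esub> h = rsum P (\<lambda>i. h \<otimes>\<^bsub>P\<^esub> monom P (u i) i) n"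
      unfolding U_def using u h by (simp add: P.rsum_mult P.m_comm P.rsum_closed)
    also have "\<dots> = rsum P (\<lambda>i. f \<otimes>\<^bsub>P\<^esub> (monom P (u i) 0 \<otimes>\<^bsub>P\<^esub> k i) \<oplus>\<^bsub>P\<^esub> monom P (u i) 0 \<otimes>\<^bsub>P\<^esub> r i) n"
    proof (rule rsum_cong)
      fix i assume i: "i < n"
      have "h \<otimes>\<^bsub>P\<^esub> monom P (u i) i = monom P (u i) 0 \<otimes>\<^bsub>P\<^esub> (monom P \<one> i \<otimes>\<^bsub>P\<^esub> h)"
        using u[OF i] h by (simp add: mon[of "u i" i] P.m_ac)
      then show "h \<otimes>\<^bsub>P\<^esub> monom P (u i) i = f \<otimes>\<^bsub>P\<^esub> (monom P (u i) 0 \<otimes>\<^bsub>P\<^esub> k i) \<oplus>\<^bsub>P\<^esub> monom P (u i) 0 \<otimes>\<^bsub>P\<^esub> r i"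
        unfolding kr(3) using u[OF i] kr(1,2) f(1) by (simp add: P.r_distr P.m_lcomm)
    qed
    also have "\<dots> = f \<otimes>\<^bsub>P\<^esub> K \<oplus>\<^bsub>P\<^esub> S"
      unfolding K_def S_def using u kr(1,2) f(1) by (simp add: P.rsum_add P.rsum_mult)
    finally have Uh: "U \<otimes>\<^bsub>P\<^esub> h = f \<otimes>\<^bsub>P\<^esub> K \<oplus>\<^bsub>P\<^esub> S" .
    have cS: "coeff P S j = rsum R (\<lambda>i. coeff P (r i) j \<otimes> u i) n" for j
    proof -
      have "coeff P S j = rsum R (\<lambda>i. coeff P (monom P (u i) 0 \<otimes>\<^bsub>P\<^esub> r i) j) n"
        unfolding S_def using u kr(2) by (intro coeff_rsum) simp
      also have "\<dots> = rsum R (\<lambda>i. coeff P (r i) j \<otimes> u i) n"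
        using u kr(2) by (intro rsum_cong) (simp add: monom_mult_is_smult R.m_comm del: coeff_mult)
      finally show ?thesis .
    qed
    have low: "coeff P S j = \<zero>" if "n \<le> j" for j
    proof -
      have "coeff P S j = rsum R (\<lambda>i. \<zero>) n"
        unfolding cS using kr(4)[OF that] u by (intro rsum_cong) simp
      then show ?thesis by (simp add: R.rsum_zero)
    qed
    have "U \<in> I \<longleftrightarrow> (\<exists>l \<in> carrier P. f \<otimes>\<^bsub>P\<^esub> K \<oplus>\<^bsub>P\<^esub> S = f \<otimes>\<^bsub>P\<^esub> l)"
      unfolding I_def colon_def using c(1) Uh by simp
    also have "\<dots> \<longleftrightarrow> S = \<zero>\<^bsub>P\<^esub>"
    proof
      assume "\<exists>l \<in> carrier P. f \<otimes>\<^bsub>P\<^esub> K \<oplus>\<^bsub>P\<^esub> S = f \<otimes>\<^bsub>P\<^esub> l"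
      then obtain l where l: "l \<in> carrier P" "f \<otimes>\<^bsub>P\<^esub> K \<oplus>\<^bsub>P\<^esub> S = f \<otimes>\<^bsub>P\<^esub> l" by blast
      have "f \<otimes>\<^bsub>P\<^esub> (l \<ominus>\<^bsub>P\<^esub> K) = f \<otimes>\<^bsub>P\<^esub> l \<ominus>\<^bsub>P\<^esub> f \<otimes>\<^bsub>P\<^esub> K"
        using f(1) l(1) c(2) by algebra
      also have "\<dots> = S"
        unfolding l(2)[symmetric] using f(1) c by algebra
      finally have eq: "f \<otimes>\<^bsub>P\<^esub> (l \<ominus>\<^bsub>P\<^esub> K) = S" .
      have "l \<ominus>\<^bsub>P\<^esub> K = \<zero>\<^bsub>P\<^esub>"
        by (rule monic_multiple_eq_zero[OF f]) (use l(1) c(2) low in \<open>simp_all add: eq n_def del: coeff_mult\<close>)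
      then show "S = \<zero>\<^bsub>P\<^esub>" using eq f(1) by simp
    next
      assume "S = \<zero>\<^bsub>P\<^esub>"
      then show "\<exists>l \<in> carrier P. f \<otimes>\<^bsub>P\<^esub> K \<oplus>\<^bsub>P\<^esub> S = f \<otimes>\<^bsub>P\<^esub> l" using c(2) f(1) by auto
    qed
    also have "\<dots> \<longleftrightarrow> (\<forall>j<n. coeff P S j = \<zero>)"
    proof
      assume "\<forall>j<n. coeff P S j = \<zero>"
      then have "coeff P S j = coeff P \<zero>\<^bsub>P\<^esub> j" for j using low[of j] by (cases "j < n") auto
      then show "S = \<zero>\<^bsub>P\<^esub>" using c(3) by (intro up_eqI) auto
    qed simp
    finally have "U \<in> I \<longleftrightarrow> (\<forall>j<n. rsum R (\<lambda>i. coeff P (r i) j \<otimes> u i) n = \<zero>)"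
      unfolding cS .
    moreover have "I +>\<^bsub>P\<^esub> U = \<zero>\<^bsub>P Quot I\<^esub> \<longleftrightarrow> U \<in> I"
      using c(1) by (rule I.rcos_eq_zero_iff)
    ultimately show "rsum (P Quot I) (\<lambda>i. (I +>\<^bsub>P\<^esub> monom P (u i) 0) \<otimes>\<^bsub>P Quot I\<^esub> (I +>\<^bsub>P\<^esub> monom P \<one> i)) n =
        \<zero>\<^bsub>P Quot I\<^esub> \<longleftrightarrow> (\<forall>j<n. rsum R (\<lambda>i. coeff P (r i) j \<otimes> u i) n = \<zero>)"
      by (simp add: comb[OF u] U_def)
  qed (use kr in auto)
  then show ?thesis by blast
qed

end

section \<open>Lifting simple roots\<close>

context UP_domain begin

lemma UP_pre_univ_prop_id: "UP_pre_univ_prop R R id"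
  by (intro UP_pre_univ_prop.intro ring_hom_cringI id_ring_hom R.cring_axioms UP_cring_axioms)

definition ev :: "'a \<Rightarrow> (nat \<Rightarrow> 'a) \<Rightarrow> 'a" where
  "ev b = eval R R id b"

lemma ev_hom: "b \<in> carrier R \<Longrightarrow> ring_hom_cring P R (ev b)"
  using UP_pre_univ_prop.eval_ring_hom[OF UP_pre_univ_prop_id, of b]
  by (intro ring_hom_cringI P.cring_axioms R.cring_axioms) (simp add: P_def ev_def)

lemma ev_monom: "b \<in> carrier R \<Longrightarrow> a \<in> carrier R \<Longrightarrow> ev b (monom P a n) = a \<otimes> b [^] n"
  using UP_pre_univ_prop.eval_monom[OF UP_pre_univ_prop_id, of a b n]
  unfolding ev_def P_def by simp

lemma coeff_UP_deriv:
  assumes "f \<in> carrier P"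
  shows "coeff P (UP_deriv R f) i = [Suc i] \<cdot> coeff P f (Suc i)"
proof -
  have "UP_deriv R f \<in> up R"
    using UP_deriv_closed[OF R.ring_axioms, of f] assms by (simp add: P_def UP_def)
  then show ?thesis by (simp add: P_def UP_def UP_deriv_def)
qed

lemma UP_deriv_carrier: "f \<in> carrier P \<Longrightarrow> UP_deriv R f \<in> carrier P"
  using UP_deriv_closed[OF R.ring_axioms, of f] by (simp add: P_def)

lemma UP_deriv_add:
  assumes "f \<in> carrier P" "g \<in> carrier P"
  shows "UP_deriv R (f \<oplus>\<^bsub>P\<^esub> g) = UP_deriv R f \<oplus>\<^bsub>P\<^esub> UP_deriv R g"
  using assms
  by (intro up_eqI) (simp_all add: coeff_UP_deriv UP_deriv_carrier R.add.nat_pow_distrib del: R.add.nat_pow_Suc)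

lemma UP_deriv_zero: "UP_deriv R \<zero>\<^bsub>P\<^esub> = \<zero>\<^bsub>P\<^esub>"
  by (intro up_eqI) (simp_all add: coeff_UP_deriv UP_deriv_carrier del: R.add.nat_pow_Suc)

text \<open>For \<open>n = 0\<close> the exponent is truncated to 0, which is harmless because the
  coefficient is zero.\<close>

lemma UP_deriv_monom:
  assumes "a \<in> carrier R"
  shows "UP_deriv R (monom P a n) = monom P ([n] \<cdot> a) (n - 1)"
proof (rule up_eqI)
  fix i
  show "coeff P (UP_deriv R (monom P a n)) i = coeff P (monom P ([n] \<cdot> a) (n - 1)) i"
  proof (cases n)
    case 0
    then show ?thesis using assms by (simp add: coeff_UP_deriv del: R.add.nat_pow_Suc)
  next
    case (Suc m)
    then show ?thesis using assms by (simp add: coeff_UP_deriv del: R.add.nat_pow_Suc)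
  qed
qed (use assms in \<open>auto simp: UP_deriv_carrier\<close>)

definition lin :: "'a \<Rightarrow> nat \<Rightarrow> 'a" where
  "lin b = monom P \<one> 1 \<ominus>\<^bsub>P\<^esub> monom P b 0"

lemma lin_closed: "b \<in> carrier R \<Longrightarrow> lin b \<in> carrier P"
  by (simp add: lin_def)

text \<open>Multiplying \<open>C + (X - b) q\<close> by \<open>X = b + (X - b)\<close> gives
  \<open>b C + (X - b) (C + X q)\<close>. Evaluated at \<open>b\<close>, this recursion for the
  cofactor is the product rule.\<close>

lemma taylor_monom:
  assumes a: "a \<in> carrier R" and b: "b \<in> carrier R"
  shows "\<exists>q \<in> carrier P. monom P a n = monom P (ev b (monom P a n)) 0 \<oplus>\<^bsub>P\<^esub> lin b \<otimes>\<^bsub>P\<^esub> q \<and>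
    ev b q = ev b (UP_deriv R (monom P a n))"
proof -
  interpret ev: ring_hom_cring P R "ev b" by (rule ev_hom[OF b])
  have "\<exists>q \<in> carrier P. monom P a n = monom P (a \<otimes> b [^] n) 0 \<oplus>\<^bsub>P\<^esub> lin b \<otimes>\<^bsub>P\<^esub> q \<and>
    ev b q = [n] \<cdot> (a \<otimes> b [^] (n - 1))"
  proof (induction n)
    case 0
    have "monom P a 0 = monom P (a \<otimes> b [^] (0::nat)) 0 \<oplus>\<^bsub>P\<^esub> lin b \<otimes>\<^bsub>P\<^esub> \<zero>\<^bsub>P\<^esub>"
      using a b lin_closed by simp
    then show ?case using a by (intro bexI[of _ "\<zero>\<^bsub>P\<^esub>"]) auto
  next
    case (Suc n)
    then obtain q where q: "q \<in> carrier P"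
      "monom P a n = monom P (a \<otimes> b [^] n) 0 \<oplus>\<^bsub>P\<^esub> lin b \<otimes>\<^bsub>P\<^esub> q"
      "ev b q = [n] \<cdot> (a \<otimes> b [^] (n - 1))" by blast
    define X B C where "X = monom P \<one> 1" "B = monom P b 0" "C = monom P (a \<otimes> b [^] n) 0"
    have c: "X \<in> carrier P" "B \<in> carrier P" "C \<in> carrier P"
      unfolding X_B_C_def using a b by simp_all
    have "monom P a (Suc n) = X \<otimes>\<^bsub>P\<^esub> monom P a n"
      unfolding X_B_C_def using a by (simp add: monom_mult[symmetric] del: monom_mult)
    also have "\<dots> = X \<otimes>\<^bsub>P\<^esub> (C \<oplus>\<^bsub>P\<^esub> (X \<ominus>\<^bsub>P\<^esub> B) \<otimes>\<^bsub>P\<^esub> q)"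
      using q(2) unfolding X_B_C_def lin_def by simp
    also have "\<dots> = B \<otimes>\<^bsub>P\<^esub> C \<oplus>\<^bsub>P\<^esub> (X \<ominus>\<^bsub>P\<^esub> B) \<otimes>\<^bsub>P\<^esub> (C \<oplus>\<^bsub>P\<^esub> X \<otimes>\<^bsub>P\<^esub> q)"
      using c q(1) by algebra
    also have "B \<otimes>\<^bsub>P\<^esub> C = monom P (a \<otimes> b [^] Suc n) 0"
      unfolding X_B_C_def using a b by (simp add: monom_mult[symmetric] R.m_ac del: monom_mult)
    finally have 1: "monom P a (Suc n) = monom P (a \<otimes> b [^] Suc n) 0 \<oplus>\<^bsub>P\<^esub> lin b \<otimes>\<^bsub>P\<^esub> (C \<oplus>\<^bsub>P\<^esub> X \<otimes>\<^bsub>P\<^esub> q)"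
      unfolding X_B_C_def lin_def .
    have "ev b (C \<oplus>\<^bsub>P\<^esub> X \<otimes>\<^bsub>P\<^esub> q) = a \<otimes> b [^] n \<oplus> b \<otimes> [n] \<cdot> (a \<otimes> b [^] (n - 1))"
      using c q(1,3) a b by (simp add: X_B_C_def ev_monom)
    also have "b \<otimes> [n] \<cdot> (a \<otimes> b [^] (n - 1)) = [n] \<cdot> (a \<otimes> b [^] n)"
      using a b by (cases n) (simp_all add: R.add_pow_rdistr R.m_ac del: R.add.nat_pow_Suc)
    finally have "ev b (C \<oplus>\<^bsub>P\<^esub> X \<otimes>\<^bsub>P\<^esub> q) = [Suc n] \<cdot> (a \<otimes> b [^] (Suc n - 1))"
      using a b by (simp add: R.a_comm)
    then show ?case using 1 c q(1) by (intro bexI[of _ "C \<oplus>\<^bsub>P\<^esub> X \<otimes>\<^bsub>P\<^esub> q"]) auto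
  qed
  then show ?thesis using a b by (simp add: ev_monom UP_deriv_monom R.add_pow_ldistr)
qed

text \<open>The claim is additive in \<open>f\<close> and so spreads from monomials. It ties the
  simplicity of a root to the value of the cofactor.\<close>

lemma taylor:
  assumes f: "f \<in> carrier P" and b: "b \<in> carrier R"
  shows "\<exists>q \<in> carrier P. f = monom P (ev b f) 0 \<oplus>\<^bsub>P\<^esub> lin b \<otimes>\<^bsub>P\<^esub> q \<and> ev b q = ev b (UP_deriv R f)"
proof -
  interpret ev: ring_hom_cring P R "ev b" by (rule ev_hom[OF b])
  let ?T = "\<lambda>f. \<exists>q \<in> carrier P. f = monom P (ev b f) 0 \<oplus>\<^bsub>P\<^esub> lin b \<otimes>\<^bsub>P\<^esub> q \<and> ev b q = ev b (UP_deriv R f)"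
  have add: "?T (f \<oplus>\<^bsub>P\<^esub> g)" if fg: "f \<in> carrier P" "g \<in> carrier P" and T: "?T f" "?T g" for f g
  proof -
    obtain q r where qr: "q \<in> carrier P" "r \<in> carrier P"
      "f = monom P (ev b f) 0 \<oplus>\<^bsub>P\<^esub> lin b \<otimes>\<^bsub>P\<^esub> q" "ev b q = ev b (UP_deriv R f)"
      "g = monom P (ev b g) 0 \<oplus>\<^bsub>P\<^esub> lin b \<otimes>\<^bsub>P\<^esub> r" "ev b r = ev b (UP_deriv R g)"
      using T by blast
    define F G L where "F = monom P (ev b f) 0" "G = monom P (ev b g) 0" "L = lin b"
    have c: "F \<in> carrier P" "G \<in> carrier P" "L \<in> carrier P"
      unfolding F_G_L_def using fg b lin_closed by simp_all
    have "f \<oplus>\<^bsub>P\<^esub> g = (F \<oplus>\<^bsub>P\<^esub> L \<otimes>\<^bsub>P\<^esub> q) \<oplus>\<^bsub>P\<^esub> (G \<oplus>\<^bsub>P\<^esub> L \<otimes>\<^bsub>P\<^esub> r)"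
      using qr(3,5) unfolding F_G_L_def by simp
    also have "\<dots> = (F \<oplus>\<^bsub>P\<^esub> G) \<oplus>\<^bsub>P\<^esub> L \<otimes>\<^bsub>P\<^esub> (q \<oplus>\<^bsub>P\<^esub> r)"
      using c qr(1,2) by algebra
    also have "F \<oplus>\<^bsub>P\<^esub> G = monom P (ev b (f \<oplus>\<^bsub>P\<^esub> g)) 0"
      unfolding F_G_L_def using fg by simp
    finally have "f \<oplus>\<^bsub>P\<^esub> g = monom P (ev b (f \<oplus>\<^bsub>P\<^esub> g)) 0 \<oplus>\<^bsub>P\<^esub> lin b \<otimes>\<^bsub>P\<^esub> (q \<oplus>\<^bsub>P\<^esub> r)"
      unfolding F_G_L_def .
    moreover have "ev b (q \<oplus>\<^bsub>P\<^esub> r) = ev b (UP_deriv R (f \<oplus>\<^bsub>P\<^esub> g))"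
      using qr(1,2,4,6) fg by (simp add: UP_deriv_add UP_deriv_carrier)
    moreover have "q \<oplus>\<^bsub>P\<^esub> r \<in> carrier P" using qr(1,2) by simp
    ultimately show ?thesis by blast
  qed
  have zero: "?T \<zero>\<^bsub>P\<^esub>"
    using b lin_closed by (intro bexI[of _ "\<zero>\<^bsub>P\<^esub>"]) (simp_all add: UP_deriv_zero)
  have "?T (rsum P (\<lambda>i. monom P (coeff P f i) i) n)" for n
  proof (induction n)
    case 0
    then show ?case using zero by simp
  next
    case (Suc n)
    have "?T (rsum P (\<lambda>i. monom P (coeff P f i) i) n \<oplus>\<^bsub>P\<^esub> monom P (coeff P f n) n)"
      using Suc f b by (intro add taylor_monom) (auto intro!: P.rsum_closed)
    then show ?case by simp
  qed
  from this[of "Suc (deg R f)"] show ?thesis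
    using rsum_monom_eq[of f "Suc (deg R f)"] f by (simp add: deg_aboveD del: rsum.simps)
qed

text \<open>Nakayama's lemma for the span of the powers of the indeterminate modulo \<open>I\<close>.\<close>
lemma powers_descent:
  assumes I: "ideal I P" and k: "1 \<le> k" and b: "b \<in> carrier R" and c: "c \<in> carrier R" "t \<in> carrier P"
    and unit: "\<And>a. a \<in> carrier R \<Longrightarrow> \<one> \<oplus> c \<otimes> a \<in> Units R"
    and X: "lin b \<oplus>\<^bsub>P\<^esub> monom P c 0 \<otimes>\<^bsub>P\<^esub> t \<in> I"
    and span: "\<And>q. q \<in> carrier P \<Longrightarrow> \<exists>r \<in> carrier P. (\<forall>i\<ge>Suc k. coeff P r i = \<zero>) \<and> q \<ominus>\<^bsub>P\<^esub> r \<in> I"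
    and q: "q \<in> carrier P"
  shows "\<exists>r \<in> carrier P. (\<forall>i\<ge>k. coeff P r i = \<zero>) \<and> q \<ominus>\<^bsub>P\<^esub> r \<in> I"
proof -
  interpret I: ideal I P by fact
  have split: "\<exists>s a. s \<in> carrier P \<and> a \<in> carrier R \<and> (\<forall>i\<ge>k. coeff P s i = \<zero>) \<and> r = s \<oplus>\<^bsub>P\<^esub> monom P a k"
    if r: "r \<in> carrier P" "\<forall>i\<ge>Suc k. coeff P r i = \<zero>" for r
  proof -
    let ?m = "monom P (coeff P r k) k"
    have "coeff P (r \<ominus>\<^bsub>P\<^esub> ?m) i = \<zero>" if "k \<le> i" for i
      using r that by (cases "i = k") (auto simp: R.r_neg a_minus_def)
    moreover have "r = (r \<ominus>\<^bsub>P\<^esub> m) \<oplus>\<^bsub>P\<^esub> m" if "m \<in> carrier P" for m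
      using r(1) that by algebra
    from this[of ?m] have "r = (r \<ominus>\<^bsub>P\<^esub> ?m) \<oplus>\<^bsub>P\<^esub> ?m" using r(1) by simp
    ultimately show ?thesis using r(1) by (intro exI[of _ "r \<ominus>\<^bsub>P\<^esub> ?m"] exI[of _ "coeff P r k"]) auto
  qed
  define Y where "Y = monom P \<one> (k - 1)"
  define B C where "B = monom P b 0" "C = monom P c 0"
  have Y: "Y \<in> carrier P" and BC: "B \<in> carrier P" "C \<in> carrier P"
    unfolding Y_def B_C_def using b c by simp_all
  \<comment> \<open>Multiplying \<open>X = b - c t\<close> by \<open>X^(k-1)\<close> expresses
    \<open>X^k\<close> modulo \<open>I\<close>. Reducing \<open>t X^(k-1)\<close> to
    \<open>s + a X^k\<close> makes \<open>X^k\<close> occur on both sides.\<close>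
  obtain r where r: "r \<in> carrier P" "\<forall>i\<ge>Suc k. coeff P r i = \<zero>" "t \<otimes>\<^bsub>P\<^esub> Y \<ominus>\<^bsub>P\<^esub> r \<in> I"
    using span[of "t \<otimes>\<^bsub>P\<^esub> Y"] c Y by auto
  obtain s a where s: "s \<in> carrier P" "a \<in> carrier R" "\<forall>i\<ge>k. coeff P s i = \<zero>" "r = s \<oplus>\<^bsub>P\<^esub> monom P a k"
    using split[OF r(1,2)] by blast
  define w where "w = inv (\<one> \<oplus> c \<otimes> a)"
  have w: "w \<in> carrier R" "w \<otimes> (\<one> \<oplus> c \<otimes> a) = \<one>"
    unfolding w_def using unit[OF s(2)] by simp_all
  define A W Z where "A = monom P a 0" "W = monom P w 0" "Z = monom P \<one> k"
  have AWZ: "A \<in> carrier P" "W \<in> carrier P" "Z \<in> carrier P"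
    unfolding A_W_Z_def using s(2) w(1) by simp_all
  have XY: "monom P \<one> 1 \<otimes>\<^bsub>P\<^esub> Y = Z"
    unfolding Y_def A_W_Z_def using k by (simp add: monom_mult[symmetric] del: monom_mult)
  have Ak: "monom P a k = A \<otimes>\<^bsub>P\<^esub> Z"
    unfolding A_W_Z_def using s(2) by (simp add: monom_mult[symmetric] del: monom_mult)
  have W1: "W \<otimes>\<^bsub>P\<^esub> (\<one>\<^bsub>P\<^esub> \<oplus>\<^bsub>P\<^esub> C \<otimes>\<^bsub>P\<^esub> A) = \<one>\<^bsub>P\<^esub>"
  proof -
    have "W \<otimes>\<^bsub>P\<^esub> (\<one>\<^bsub>P\<^esub> \<oplus>\<^bsub>P\<^esub> C \<otimes>\<^bsub>P\<^esub> A) = monom P (w \<otimes> (\<one> \<oplus> c \<otimes> a)) 0"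
      unfolding A_W_Z_def B_C_def using s(2) w(1) c(1)
      by (simp add: monom_mult[symmetric] monom_add[symmetric] monom_one[symmetric] del: monom_mult monom_add monom_one)
    then show ?thesis using w(2) by simp
  qed
  \<comment> \<open>Collecting \<open>X^k\<close> gives it the coefficient \<open>1 + c a\<close>,
    with inverse \<open>w\<close>. So \<open>X^k\<close> is congruent to this polynomial, which has
    no term of degree \<open>k\<close> or more.\<close>
  let ?s = "W \<otimes>\<^bsub>P\<^esub> (B \<otimes>\<^bsub>P\<^esub> Y \<ominus>\<^bsub>P\<^esub> C \<otimes>\<^bsub>P\<^esub> s)"
  have sc: "?s \<in> carrier P" using AWZ BC Y s(1) by simp
  have "Z \<ominus>\<^bsub>P\<^esub> ?s \<in> I"
  proof -
    define U where "U = monom P \<one> 1"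
    have U: "U \<in> carrier P" unfolding U_def by simp
    have XI: "U \<ominus>\<^bsub>P\<^esub> B \<oplus>\<^bsub>P\<^esub> C \<otimes>\<^bsub>P\<^esub> t \<in> I" using X unfolding lin_def U_def B_C_def .
    have "W \<otimes>\<^bsub>P\<^esub> ((U \<ominus>\<^bsub>P\<^esub> B \<oplus>\<^bsub>P\<^esub> C \<otimes>\<^bsub>P\<^esub> t) \<otimes>\<^bsub>P\<^esub> Y \<ominus>\<^bsub>P\<^esub> C \<otimes>\<^bsub>P\<^esub> (t \<otimes>\<^bsub>P\<^esub> Y \<ominus>\<^bsub>P\<^esub> r)) \<in> I"
      using I.I_l_closed[OF I.I_r_closed[OF XI Y] AWZ(2)] I.I_l_closed[OF I.I_l_closed[OF r(3) BC(2)] AWZ(2)]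
        AWZ BC Y c(2) r(1) U by (simp add: P.r_distr a_minus_def P.r_minus del: UP_r_distr) 
    also have "W \<otimes>\<^bsub>P\<^esub> ((U \<ominus>\<^bsub>P\<^esub> B \<oplus>\<^bsub>P\<^esub> C \<otimes>\<^bsub>P\<^esub> t) \<otimes>\<^bsub>P\<^esub> Y \<ominus>\<^bsub>P\<^esub> C \<otimes>\<^bsub>P\<^esub> (t \<otimes>\<^bsub>P\<^esub> Y \<ominus>\<^bsub>P\<^esub> r)) =
        W \<otimes>\<^bsub>P\<^esub> (U \<otimes>\<^bsub>P\<^esub> Y \<ominus>\<^bsub>P\<^esub> B \<otimes>\<^bsub>P\<^esub> Y \<oplus>\<^bsub>P\<^esub> C \<otimes>\<^bsub>P\<^esub> r)"
      using AWZ BC Y c(2) r(1) U by algebra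
    also have "\<dots> = W \<otimes>\<^bsub>P\<^esub> (Z \<ominus>\<^bsub>P\<^esub> B \<otimes>\<^bsub>P\<^esub> Y \<oplus>\<^bsub>P\<^esub> C \<otimes>\<^bsub>P\<^esub> (s \<oplus>\<^bsub>P\<^esub> A \<otimes>\<^bsub>P\<^esub> Z))"
      unfolding U_def XY s(4) Ak ..
    also have "\<dots> = (W \<otimes>\<^bsub>P\<^esub> (\<one>\<^bsub>P\<^esub> \<oplus>\<^bsub>P\<^esub> C \<otimes>\<^bsub>P\<^esub> A)) \<otimes>\<^bsub>P\<^esub> Z \<ominus>\<^bsub>P\<^esub> ?s"
      using AWZ BC Y s(1) by algebra
    also have "\<dots> = Z \<ominus>\<^bsub>P\<^esub> ?s" unfolding W1 using AWZ by simp
    finally show ?thesis .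
  qed
  have s_low: "coeff P ?s i = \<zero>" if i: "k \<le> i" for i
  proof -
    have "coeff P (B \<otimes>\<^bsub>P\<^esub> Y \<ominus>\<^bsub>P\<^esub> C \<otimes>\<^bsub>P\<^esub> s) i = \<zero>"
      using i k b c(1) s(1,3) Y unfolding B_C_def
      by (simp add: monom_mult_is_smult a_minus_def del: coeff_mult) (auto simp: Y_def)
    then show ?thesis
      using w(1) BC Y s(1) unfolding A_W_Z_def by (simp add: monom_mult_is_smult del: coeff_mult)
  qed
  obtain q1 where q1: "q1 \<in> carrier P" "\<forall>i\<ge>Suc k. coeff P q1 i = \<zero>" "q \<ominus>\<^bsub>P\<^esub> q1 \<in> I"
    using span[OF q] by blast
  obtain q2 a2 where q2: "q2 \<in> carrier P" "a2 \<in> carrier R" "\<forall>i\<ge>k. coeff P q2 i = \<zero>"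
    "q1 = q2 \<oplus>\<^bsub>P\<^esub> monom P a2 k" using split[OF q1(1,2)] by blast
  define A2 where "A2 = monom P a2 0"
  have A2: "A2 \<in> carrier P" unfolding A2_def using q2(2) by simp
  have A2k: "monom P a2 k = A2 \<otimes>\<^bsub>P\<^esub> Z"
    unfolding A_W_Z_def A2_def using q2(2) by (simp add: monom_mult[symmetric] del: monom_mult)
  \<comment> \<open>In the representative \<open>q1\<close> the term \<open>a2 X^k\<close> is
    replaced by \<open>a2\<close> times \<open>?s\<close>.\<close>
  let ?r = "q2 \<oplus>\<^bsub>P\<^esub> A2 \<otimes>\<^bsub>P\<^esub> ?s"
  have "(q \<ominus>\<^bsub>P\<^esub> q1) \<oplus>\<^bsub>P\<^esub> A2 \<otimes>\<^bsub>P\<^esub> (Z \<ominus>\<^bsub>P\<^esub> ?s) \<in> I"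
    using q1(3) I.I_l_closed[OF \<open>Z \<ominus>\<^bsub>P\<^esub> ?s \<in> I\<close> A2] by (rule I.a_closed)
  also have "(q \<ominus>\<^bsub>P\<^esub> q1) \<oplus>\<^bsub>P\<^esub> A2 \<otimes>\<^bsub>P\<^esub> (Z \<ominus>\<^bsub>P\<^esub> ?s) = q \<ominus>\<^bsub>P\<^esub> ?r"
    unfolding q2(4) A2k using q q2(1) A2 AWZ BC Y s(1) by algebra
  finally have "q \<ominus>\<^bsub>P\<^esub> ?r \<in> I" .
  moreover have "coeff P ?r i = \<zero>" if "k \<le> i" for i
    using s_low[OF that] q2 that sc unfolding A2_def by (simp add: monom_mult_is_smult del: coeff_mult)
  ultimately show ?thesis using q2(1) A2 sc by (intro bexI[of _ ?r]) auto
qed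

text \<open>The lifting condition of \<open>henselian_local_ring\<close> for a representative
  \<open>b\<close> of the residue class.\<close>

lemma simple_root_lift:
  assumes p: "Factorial_Ring.prime (p :: nat)" and char: "[p] \<cdot> \<one> = \<zero>" and NIP: "NIP_ring R"
    and M: "maximalideal M R" and f: "f \<in> carrier P" "lcoeff f = \<one>" and b: "b \<in> carrier R"
    and root: "ev b f \<in> M" and simple: "ev b (UP_deriv R f) \<notin> M"
  shows "\<exists>a \<in> carrier R. ev a f = \<zero> \<and> b \<ominus> a \<in> M"
proof -
  interpret M: maximalideal M R by fact
  note unit_or_unit = R.NIP_imp_unit_or_unit[OF p char NIP]
  have M_nonunits: "M = R.nonunits"
    by (rule R.maximalideal_eq_nonunits) (use unit_or_unit R.one_not_zero M in auto)
  have one_M: "\<one> \<notin> M" using M.one_imp_carrier M.I_notcarr by blast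
  have M_prime: "primeideal M R" using R.maximalideal_prime[OF M] .
  interpret ev: ring_hom_cring P R "ev b" by (rule ev_hom[OF b])
  \<comment> \<open>The preimage of \<open>M\<close> under evaluation at \<open>b\<close>. An ideal
    \<open>I\<close> inside it remembers the residue class of \<open>b\<close>.\<close>
  define Q where "Q = {r \<in> carrier P. ev b r \<in> M}"
  have "ring_hom_ring P R (ev b)"
    by (intro ring_hom_ring.intro ring_hom_ring_axioms.intro P.ring_axioms R.ring_axioms ev.homh)
  then have Q: "primeideal Q P"
    unfolding Q_def by (rule ring_hom_ring.primeideal_vimage[OF _ P.cring_axioms M_prime])
  have fQ: "f \<in> Q" using f root by (simp add: Q_def)
  obtain h where h: "h \<in> carrier P" and I: "primeideal (colon f h) P" and IQ: "colon f h \<subseteq> Q"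
    using ex_prime_colon[OF f Q fQ] by blast
  define I where "I = colon f h"
  have I_Q: "I \<subseteq> Q" and fI: "f \<in> I" using IQ colon_self[OF f(1) h] unfolding I_def by auto
  \<comment> \<open>A nonzero constant in \<open>I\<close> could be cancelled, and 1 would lie in
    \<open>I\<close>.\<close>
  have I_const: "\<delta> = \<zero>" if "\<delta> \<in> carrier R" "monom P \<delta> 0 \<in> I" for \<delta>
  proof (rule ccontr)
    assume "\<delta> \<noteq> \<zero>"
    then have "\<one>\<^bsub>P\<^esub> \<in> I"
      using colon_saturated[OF f h, of \<delta> "\<one>\<^bsub>P\<^esub>"] that unfolding I_def by simp
    then show False using I_Q one_M by (auto simp: Q_def)
  qed
  interpret I: primeideal I P using I unfolding I_def .
  interpret A: domain "P Quot I" by (rule I.quotient_is_domain)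
  interpret \<pi>: ring_hom_cring P "P Quot I" "(+>\<^bsub>P\<^esub>) I"
    by (rule I.rcos_ring_hom_cring)
  have \<iota>: "ring_hom_cring R (P Quot I) (\<lambda>a. I +>\<^bsub>P\<^esub> monom P a 0)"
    using ring_hom_trans[OF const_ring_hom \<pi>.homh]
    by (intro ring_hom_cringI R.cring_axioms A.cring_axioms) (simp add: comp_def)
  have NIP_A: "NIP_ring (P Quot I)"
    using linear_presentation_colon[OF f h] linear_presentation.NIP_ring_presented[OF _ NIP]
    unfolding I_def by blast
  have char_A: "[p] \<cdot>\<^bsub>P Quot I\<^esub> \<one>\<^bsub>P Quot I\<^esub> = \<zero>\<^bsub>P Quot I\<^esub>"
    using ring_hom_cring.hom_add_pow[OF \<iota> R.one_closed, of p] char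
      ring_hom_cring.hom_zero[OF \<iota>] ring_hom_cring.hom_one[OF \<iota>] by simp
  obtain g where g: "g \<in> carrier P" "f = monom P (ev b f) 0 \<oplus>\<^bsub>P\<^esub> lin b \<otimes>\<^bsub>P\<^esub> g"
    "ev b g = ev b (UP_deriv R f)" using taylor[OF f(1) b] by blast
  define c where "c = ev b f"
  have c: "c \<in> carrier R" "c \<in> M" using root f(1) by (auto simp: c_def)
  have "ev b g \<in> Units R" using simple g(3) ev.hom_closed[OF g(1)] unfolding M_nonunits R.nonunits_def by auto
  define w where "w = inv (ev b g)"
  have w: "w \<in> carrier R" "ev b g \<otimes> w = \<one>" using \<open>ev b g \<in> Units R\<close> by (simp_all add: w_def)
  \<comment> \<open>Scaling the cofactor \<open>g\<close> to the value 1 at \<open>b\<close> makes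
    \<open>1 - s\<close> vanish there.\<close>
  define s where "s = g \<otimes>\<^bsub>P\<^esub> monom P w 0"
  have s: "s \<in> carrier P" "ev b s = \<one>" using g(1) w b by (simp_all add: s_def ev_monom)
  have inverse_mod: "\<exists>t \<in> carrier P. r \<otimes>\<^bsub>P\<^esub> t \<ominus>\<^bsub>P\<^esub> \<one>\<^bsub>P\<^esub> \<in> I"
    if r: "r \<in> carrier P" "I +>\<^bsub>P\<^esub> r \<in> Units (P Quot I)" for r
  proof -
    obtain y where y: "y \<in> carrier (P Quot I)" "(I +>\<^bsub>P\<^esub> r) \<otimes>\<^bsub>P Quot I\<^esub> y = \<one>\<^bsub>P Quot I\<^esub>"
      using r(2) unfolding Units_def by blast
    obtain t where t: "t \<in> carrier P" "y = I +>\<^bsub>P\<^esub> t" using y(1) by (rule I.quotient_carrierE)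
    have "I +>\<^bsub>P\<^esub> (r \<otimes>\<^bsub>P\<^esub> t) = I +>\<^bsub>P\<^esub> \<one>\<^bsub>P\<^esub>" using y(2) t r(1) by simp
    then show ?thesis using t(1) r(1) I.rcos_eq_iff[of "r \<otimes>\<^bsub>P\<^esub> t" "\<one>\<^bsub>P\<^esub>"] by auto
  qed
  have "I +>\<^bsub>P\<^esub> s \<in> Units (P Quot I)"
  proof (rule ccontr)
    assume "I +>\<^bsub>P\<^esub> s \<notin> Units (P Quot I)"
    then have "\<one>\<^bsub>P Quot I\<^esub> \<ominus>\<^bsub>P Quot I\<^esub> (I +>\<^bsub>P\<^esub> s) \<in> Units (P Quot I)"
      using A.NIP_imp_unit_or_unit[OF p char_A NIP_A, of "I +>\<^bsub>P\<^esub> s"] s(1) \<pi>.hom_closed by blast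
    also have "\<one>\<^bsub>P Quot I\<^esub> \<ominus>\<^bsub>P Quot I\<^esub> (I +>\<^bsub>P\<^esub> s) = I +>\<^bsub>P\<^esub> (\<one>\<^bsub>P\<^esub> \<ominus>\<^bsub>P\<^esub> s)"
      using s(1) by (simp add: a_minus_def)
    finally obtain t where t: "t \<in> carrier P" "(\<one>\<^bsub>P\<^esub> \<ominus>\<^bsub>P\<^esub> s) \<otimes>\<^bsub>P\<^esub> t \<ominus>\<^bsub>P\<^esub> \<one>\<^bsub>P\<^esub> \<in> I"
      using inverse_mod[of "\<one>\<^bsub>P\<^esub> \<ominus>\<^bsub>P\<^esub> s"] s(1) by auto
    \<comment> \<open>An inverse of \<open>1 - s\<close> modulo \<open>I\<close> would put an
      element of value -1 at \<open>b\<close> into \<open>I\<close>, whose elements take values in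
      \<open>M\<close>.\<close>
    have "ev b ((\<one>\<^bsub>P\<^esub> \<ominus>\<^bsub>P\<^esub> s) \<otimes>\<^bsub>P\<^esub> t \<ominus>\<^bsub>P\<^esub> \<one>\<^bsub>P\<^esub>) = \<ominus> \<one>"
      using s t(1) by (simp add: a_minus_def R.r_neg)
    then have "\<ominus> \<one> \<in> M" using t(2) I_Q by (auto simp: Q_def)
    then have "\<ominus> (\<ominus> \<one>) \<in> M" by (rule M.a_inv_closed)
    then show False using one_M by simp
  qed
  then obtain t where t: "t \<in> carrier P" "s \<otimes>\<^bsub>P\<^esub> t \<ominus>\<^bsub>P\<^esub> \<one>\<^bsub>P\<^esub> \<in> I"
    using inverse_mod[OF s(1)] by blast
  define u where "u = monom P w 0 \<otimes>\<^bsub>P\<^esub> t"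
  have u: "u \<in> carrier P" unfolding u_def using w(1) t(1) by simp
  have gu: "g \<otimes>\<^bsub>P\<^esub> u \<ominus>\<^bsub>P\<^esub> \<one>\<^bsub>P\<^esub> \<in> I"
    using t w(1) g(1) by (simp add: u_def s_def P.m_assoc)
  define L C where "L = lin b" and "C = monom P c 0"
  have LC: "L \<in> carrier P" "C \<in> carrier P" unfolding L_def C_def using b c lin_closed by simp_all
  have fLC: "f = C \<oplus>\<^bsub>P\<^esub> L \<otimes>\<^bsub>P\<^esub> g" using g(2) unfolding C_def c_def L_def .
  \<comment> \<open>With \<open>f = C + L g\<close>, and \<open>g u\<close> equal to 1 modulo
    \<open>I\<close>, this combination collapses to \<open>L + C u\<close>.\<close>
  have "f \<otimes>\<^bsub>P\<^esub> u \<oplus>\<^bsub>P\<^esub> (\<ominus>\<^bsub>P\<^esub> L) \<otimes>\<^bsub>P\<^esub> (g \<otimes>\<^bsub>P\<^esub> u \<ominus>\<^bsub>P\<^esub> \<one>\<^bsub>P\<^esub>) \<in> I"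
    using I.I_r_closed[OF fI u] I.I_l_closed[OF gu, of "\<ominus>\<^bsub>P\<^esub> L"] LC by (intro I.a_closed) auto
  also have "f \<otimes>\<^bsub>P\<^esub> u \<oplus>\<^bsub>P\<^esub> (\<ominus>\<^bsub>P\<^esub> L) \<otimes>\<^bsub>P\<^esub> (g \<otimes>\<^bsub>P\<^esub> u \<ominus>\<^bsub>P\<^esub> \<one>\<^bsub>P\<^esub>) = L \<oplus>\<^bsub>P\<^esub> C \<otimes>\<^bsub>P\<^esub> u"
    unfolding fLC using LC g(1) u by algebra
  finally have X: "lin b \<oplus>\<^bsub>P\<^esub> monom P c 0 \<otimes>\<^bsub>P\<^esub> u \<in> I" unfolding L_def C_def .
  have unit: "\<one> \<oplus> c \<otimes> a \<in> Units R" if a: "a \<in> carrier R" for a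
  proof -
    have "\<ominus> (c \<otimes> a) \<in> M" using M.I_r_closed[OF c(2) a] by (rule M.a_inv_closed)
    then have "\<one> \<ominus> (\<ominus> (c \<otimes> a)) \<in> Units R"
      using unit_or_unit[of "\<ominus> (c \<otimes> a)"] unfolding M_nonunits R.nonunits_def by auto
    then show ?thesis using c(1) a by (simp add: a_minus_def)
  qed
  let ?span = "\<lambda>k. \<forall>q \<in> carrier P. \<exists>r \<in> carrier P. (\<forall>i\<ge>k. coeff P r i = \<zero>) \<and> q \<ominus>\<^bsub>P\<^esub> r \<in> I"
  \<comment> \<open>The maximum keeps the start of the descent at or above its end, 1.\<close>
  have "?span (max 1 (deg R f))"
  proof
    fix q assume q: "q \<in> carrier P"
    obtain k r where kr: "k \<in> carrier P" "r \<in> carrier P" "q = f \<otimes>\<^bsub>P\<^esub> k \<oplus>\<^bsub>P\<^esub> r"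
      "\<And>i. deg R f \<le> i \<Longrightarrow> coeff P r i = \<zero>"
      using monic_division[OF f q] by metis
    have "q \<ominus>\<^bsub>P\<^esub> r = f \<otimes>\<^bsub>P\<^esub> k"
      unfolding kr(3) using f(1) kr(1,2) by algebra
    then have "q \<ominus>\<^bsub>P\<^esub> r \<in> I" using I.I_r_closed[OF fI kr(1)] by simp
    then show "\<exists>r \<in> carrier P. (\<forall>i\<ge>max 1 (deg R f). coeff P r i = \<zero>) \<and> q \<ominus>\<^bsub>P\<^esub> r \<in> I"
      using kr(2,4) by auto
  qed
  moreover have "1 \<le> N \<Longrightarrow> ?span N \<Longrightarrow> ?span 1" for N
  proof (induction N rule: dec_induct)
    case base
    then show ?case .
  next
    case (step k)
    then have "?span k"
      using powers_descent[OF I.is_ideal step(1) b c(1) u unit X] by simp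
    then show ?case by (rule step.IH)
  qed
  ultimately have "?span 1" using max.cobounded1 by blast
  \<comment> \<open>Being spanned by 1 means that \<open>X\<close> is congruent to a constant, the
    desired root.\<close>
  then obtain r where r: "r \<in> carrier P" "\<forall>i\<ge>1. coeff P r i = \<zero>" "monom P \<one> 1 \<ominus>\<^bsub>P\<^esub> r \<in> I"
    by (meson R.one_closed monom_closed)
  define a where "a = coeff P r 0"
  have a: "a \<in> carrier R" unfolding a_def using r(1) by simp
  have "r = monom P a 0"
    using r(1,2) unfolding a_def by (intro up_eqI) (auto simp: Suc_le_eq)
  then have lin_a: "lin a \<in> I" using r(3) by (simp add: lin_def)
  have "ev a f = \<zero>"
  proof -
    obtain q where q: "q \<in> carrier P" "f = monom P (ev a f) 0 \<oplus>\<^bsub>P\<^esub> lin a \<otimes>\<^bsub>P\<^esub> q"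
      using taylor[OF f(1) a] by blast
    interpret ev_a: ring_hom_cring P R "ev a" by (rule ev_hom[OF a])
    have ec: "ev a f \<in> carrier R" using f(1) by (rule ev_a.hom_closed)
    define K L where "K = monom P (ev a f) 0" and "L = lin a"
    have KL: "K \<in> carrier P" "L \<in> carrier P" unfolding K_def L_def using ec a lin_closed by simp_all
    \<comment> \<open>Subtracting a multiple of \<open>X - a\<close> from \<open>f\<close> leaves
      the constant \<open>f(a)\<close>, which lies in \<open>I\<close> and hence is zero.\<close>
    have "f \<oplus>\<^bsub>P\<^esub> \<ominus>\<^bsub>P\<^esub> (L \<otimes>\<^bsub>P\<^esub> q) \<in> I"
      using fI I.I_r_closed[OF lin_a q(1)] unfolding L_def by (intro I.a_closed I.a_inv_closed)
    also have "f \<oplus>\<^bsub>P\<^esub> \<ominus>\<^bsub>P\<^esub> (L \<otimes>\<^bsub>P\<^esub> q) = K"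
    proof -
      have "f = K \<oplus>\<^bsub>P\<^esub> L \<otimes>\<^bsub>P\<^esub> q" using q(2) unfolding K_def L_def .
      moreover have "(K \<oplus>\<^bsub>P\<^esub> L \<otimes>\<^bsub>P\<^esub> q) \<oplus>\<^bsub>P\<^esub> \<ominus>\<^bsub>P\<^esub> (L \<otimes>\<^bsub>P\<^esub> q) = K"
        using KL q(1) by algebra
      ultimately show ?thesis by simp
    qed
    finally show ?thesis using I_const[OF ec] unfolding K_def by simp
  qed
  moreover have "b \<ominus> a \<in> M"
  proof -
    have "ev b (lin a) = b \<ominus> a" using a b by (simp add: lin_def a_minus_def ev_monom)
    then show ?thesis using lin_a I_Q by (auto simp: Q_def)
  qed
  ultimately show ?thesis using a by blast
qed

end

section \<open>The algebra structure over the prime field and the passage to residue classes\<close>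

lemma char_of_ZFact_hom:
  assumes "ring_hom_ring (ZFact (int p)) R h"
  shows "[p] \<cdot>\<^bsub>R\<^esub> \<one>\<^bsub>R\<^esub> = \<zero>\<^bsub>R\<^esub>"
proof -
  interpret h: ring_hom_ring "ZFact (int p)" R h by fact
  interpret I: ideal "Idl\<^bsub>\<Z>\<^esub> {int p}" \<Z> by (rule int.genideal_ideal) simp
  let ?\<pi> = "(+>\<^bsub>\<Z>\<^esub>) (Idl\<^bsub>\<Z>\<^esub> {int p})"
  have \<pi>: "?\<pi> \<in> ring_hom \<Z> (ZFact (int p))"
    unfolding ZFact_def by (rule I.rcos_ring_hom)
  have hom: "h \<circ> ?\<pi> \<in> ring_hom \<Z> R" using \<pi> h.homh by (rule ring_hom_trans)
  interpret hom: ring_hom_ring \<Z> R "h \<circ> ?\<pi>"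
    by (intro ring_hom_ring.intro ring_hom_ring_axioms.intro int.ring_axioms h.S.ring_axioms hom)
  \<comment> \<open>The composite homomorphism from the integers is determined by preserving 1, and
    it kills \<open>p\<close>.\<close>
  have "(h \<circ> ?\<pi>) (int k) = [k] \<cdot>\<^bsub>R\<^esub> \<one>\<^bsub>R\<^esub>" for k :: nat
  proof (induction k)
    case 0
    then show ?case using hom.hom_zero by simp
  next
    case (Suc k)
    have "(h \<circ> ?\<pi>) (int (Suc k)) = (h \<circ> ?\<pi>) (int k) \<oplus>\<^bsub>R\<^esub> (h \<circ> ?\<pi>) 1"
      using hom.hom_add[of "int k" 1] by (simp add: add.commute)
    also have "(h \<circ> ?\<pi>) 1 = \<one>\<^bsub>R\<^esub>" using hom.hom_one by simp
    finally show ?case using Suc by simp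
  qed
  from this[of p] have "[p] \<cdot>\<^bsub>R\<^esub> \<one>\<^bsub>R\<^esub> = h (?\<pi> (int p))" by simp
  also have "?\<pi> (int p) = \<zero>\<^bsub>ZFact (int p)\<^esub>"
    using int.a_rcos_zero[OF I.is_ideal int.genideal_self'[of "int p"]] by (simp add: ZFact_def FactRing_def)
  finally show ?thesis by simp
qed

theorem theorem3p15:
  fixes R :: "('a, 'b) ring_scheme" and p :: nat and h :: "int set \<Rightarrow> 'a"
  assumes "Factorial_Ring.prime p"
    and "domain R"
    and "ring_hom_ring (ZFact (int p)) R h"
    and "NIP_ring R"
  shows "domain R \<and> henselian_local_ring R"
proof -
  interpret UP_domain R "UP R"
    by (intro UP_domain.intro assms(2)) simp
  note p = assms(1) and NIP = assms(4)
  have char: "[p] \<cdot>\<^bsub>R\<^esub> \<one>\<^bsub>R\<^esub> = \<zero>\<^bsub>R\<^esub>" using assms(3) by (rule char_of_ZFact_hom)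
  have "local_ring R"
    by (rule R.local_ring_of_unit_or_unit)
      (use R.NIP_imp_unit_or_unit[OF p char NIP] R.one_not_zero in auto)
  moreover have "\<exists>a \<in> carrier R. eval R R id a f = \<zero>\<^bsub>R\<^esub> \<and> M +>\<^bsub>R\<^esub> a = \<alpha>"
    if M: "maximalideal M R" and f: "UP_monic R f" and \<alpha>: "\<alpha> \<in> carrier (R Quot M)"
      and root: "eval R (R Quot M) ((+>\<^bsub>R\<^esub>) M) \<alpha> f = \<zero>\<^bsub>R Quot M\<^esub>"
      and simple: "eval R (R Quot M) ((+>\<^bsub>R\<^esub>) M) \<alpha> (UP_deriv R f) \<noteq> \<zero>\<^bsub>R Quot M\<^esub>" for M f \<alpha>
  proof -
    interpret M: maximalideal M R by fact
    obtain b where b: "b \<in> carrier R" "\<alpha> = M +>\<^bsub>R\<^esub> b" using \<alpha> by (rule M.quotient_carrierE)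
    interpret \<pi>: ring_hom_cring R "R Quot M" "(+>\<^bsub>R\<^esub>) M"
      by (rule M.rcos_ring_hom_cring[OF R.cring_axioms])
    interpret ev: ring_hom_cring "UP R" R "ev b" by (rule ev_hom[OF b(1)])
    interpret U: UP_pre_univ_prop R "R Quot M" "(+>\<^bsub>R\<^esub>) M" "UP R"
      by (intro UP_pre_univ_prop.intro \<pi>.ring_hom_cring_axioms UP_cring_axioms)
    \<comment> \<open>Both sides are homomorphisms on \<open>R[X]\<close> that agree on constants
      and on \<open>X\<close>, so they coincide by the universal property.\<close>
    have eval: "eval R (R Quot M) ((+>\<^bsub>R\<^esub>) M) \<alpha> q = M +>\<^bsub>R\<^esub> ev b q" if q: "q \<in> carrier (UP R)" for q
    proof (rule U.UP_hom_unique[OF _ _ _ _ _ _ q \<alpha>])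
      show "ring_hom_cring (UP R) (R Quot M) (eval R (R Quot M) ((+>\<^bsub>R\<^esub>) M) \<alpha>)"
        by (rule U.ring_homD[OF U.eval_ring_hom[OF \<alpha>]])
      show "ring_hom_cring (UP R) (R Quot M) (\<lambda>q. M +>\<^bsub>R\<^esub> ev b q)"
        using ring_hom_trans[OF ev.homh \<pi>.homh]
        by (intro ring_hom_cringI P.cring_axioms \<pi>.S.cring_axioms) (simp add: comp_def)
    qed (use U.eval_monom1[OF \<alpha>] U.eval_const[OF \<alpha>] b in \<open>simp_all add: ev_monom\<close>)
    have fc: "f \<in> carrier (UP R)" "lcoeff f = \<one>\<^bsub>R\<^esub>" using f by (simp_all add: UP_monic_def)
    have "ev b f \<in> M"
      using root M.rcos_eq_zero_iff[of "ev b f"] fc(1) by (simp add: eval)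
    moreover have "ev b (UP_deriv R f) \<notin> M"
      using simple M.rcos_eq_zero_iff[of "ev b (UP_deriv R f)"] UP_deriv_carrier[OF fc(1)]
      by (simp add: eval)
    ultimately obtain a where a: "a \<in> carrier R" "ev a f = \<zero>\<^bsub>R\<^esub>" "b \<ominus>\<^bsub>R\<^esub> a \<in> M"
      using simple_root_lift[OF p char NIP M fc b(1)] by blast
    then have "\<alpha> = M +>\<^bsub>R\<^esub> a" using b M.rcos_eq_iff by simp
    then show ?thesis using a unfolding ev_def by blast
  qed
  ultimately show ?thesis using assms(2) unfolding henselian_local_ring_def by blast
qed

end
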